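(* A spectral measure over $\mathbb{T}^2$ for the group $\mathrm{J}\cong TA_5$ (the ternary $A_5$ group, a subgroup of $SU(3)$ of order 180) is $$\mathrm{d}\varepsilon=\frac{1}{72\pi^4}J^2\,\mathrm{d}^{(3)}+\frac13\,\mathrm{d}^{(2)}-\frac1{15}\,\mathrm{d}^{(1)}+\frac15\,\mathrm{d}^{((5))}+\frac15\,\mathrm{d}^{((5/2))}.$$
   Context: The group $\mathrm{J}$ is the subgroup of $SU(3)$ of order 180 generated by a subgroup isomorphic to the alternating group $A_5$ and the centre $\{1,\omega,\omega^2\}$ of $SU(3)$, $\omega=e^{2\pi i/3}$. For a finite subgroup $\Gamma\subset SU(3)$ let $\rho$ be the 3-dimensional representation given by the inclusion. The McKay graph $\mathcal{G}_\Gamma$ has as vertices the irreducible representations of $\Gamma$ (up to isomorphism), with adjacency matrix $\Delta_{\sigma,\sigma'}$ = multiplicity of $\sigma'$ in $\rho\otimes\sigma$; $\Delta$ is normal. Let $e_1$ be the basis vector of the trivial representation. With $\mathbb{T}$ the unit circle and $R_{m,n}(\omega_1,\omega_2)=(\omega_1+\omega_2^{-1}+\omega_1^{-1}\omega_2)^{m}(\omega_1^{-1}+\omega_2+\omega_1\omega_2^{-1})^{n}$, a measure $\varepsilon$ on $\mathbb{T}^2$ is called a spectral measure over $\mathbb{T}^2$ of $\Gamma$ if $\int_{\mathbb{T}^2}R_{m,n}\,\mathrm{d}\varepsilon=\langle\Delta^{m}(\Delta^\ast)^{n} e_1,e_1\rangle$ for all integers $m,n\ge0$. The group $S_3$ acts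 on $\mathbb{T}^2$, generated by $(\omega_1,\omega_2)\mapsto(\omega_2^{-1},\omega_1^{-1})$ and $(\omega_1,\omega_2)\mapsto(\omega_2^{-1},\omega_1\omega_2^{-1})$. For rational $s\ge2$ and $\tau=e^{2\pi i/s}$, $\mathrm{d}^{((s))}$ is the uniform probability measure on the union of the $S_3$-orbits of $(\tau,\tau)$, $(\overline{\omega}\,\overline{\tau},\omega)$, $(\omega,\overline{\omega}\,\overline{\tau})$. For $N\in\mathbb{N}$, $\mathrm{d}^{(N)}$ is the uniform probability measure on $D_N=\{(e^{2\pi iq_1/3N},e^{2\pi iq_2/3N}) : q_1,q_2\in\{0,\dots,3N-1\},\ q_1+q_2\equiv0 \bmod 3\}$. $J$ (the function, not the group) is given at $(e^{2\pi i\theta_1},e^{2\pi i\theta_2})$ by $J=4\pi^2\big(\sin(2\pi(\theta_1+\theta_2))-\sin(2\pi(2\theta_1-\theta_2))-\sin(2\pi(2\theta_2-\theta_1))\big)$, and $J^2\mathrm{d}^{(N)}$ is the measure with density $J^2$ with respect to $\mathrm{d}^{(N)}$. *)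

theory Defs
  imports
    "HOL-Probability.Probability"
    "HOL-Algebra.Algebra"
    "Jordan_Normal_Form.Schur_Decomposition"
    "Jordan_Normal_Form.VS_Connect"
begin

section \<open>Matrix representations of a group\<close>

text \<open>
  A finite-dimensional complex representation is given as a pair of its dimension $d$ and
  a map into the $d \times d$ matrices.  Only the values of the map on the carrier of the group
  are relevant; in particular equivalence of representations compares only those.
\<close>

type_synonym 'g rep = "nat \<times> ('g \<Rightarrow> complex mat)"

definition GL :: "nat \<Rightarrow> complex mat monoid" where
  "GL d = units_of (ring_mat TYPE(complex) d ())"

definition is_rep :: "('g, 'b) monoid_scheme \<Rightarrow> 'g rep \<Rightarrow> bool" where
  "is_rep G \<sigma> \<longleftrightarrow> snd \<sigma> \<in> hom G (GL (fst \<sigma>))"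

definition invariant_subspace :: "('g, 'b) monoid_scheme \<Rightarrow> 'g rep \<Rightarrow> complex Matrix.vec set \<Rightarrow> bool" where
  "invariant_subspace G \<sigma> W \<longleftrightarrow>
     subspace class_ring W (module_vec TYPE(complex) (fst \<sigma>)) \<and>
     (\<forall>g\<in>carrier G. \<forall>w\<in>W. snd \<sigma> g *\<^sub>v w \<in> W)"

definition irreducible_rep :: "('g, 'b) monoid_scheme \<Rightarrow> 'g rep \<Rightarrow> bool" where
  "irreducible_rep G \<sigma> \<longleftrightarrow> is_rep G \<sigma> \<and> fst \<sigma> > 0 \<and>
     (\<forall>W. invariant_subspace G \<sigma> W \<longrightarrow> W = {0\<^sub>v (fst \<sigma>)} \<or> W = carrier_vec (fst \<sigma>))"

definition rep_iso :: "('g, 'b) monoid_scheme \<Rightarrow> 'g rep \<Rightarrow> 'g rep \<Rightarrow> bool" where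
  "rep_iso G \<sigma> \<sigma>' \<longleftrightarrow> fst \<sigma> = fst \<sigma>' \<and>
     (\<exists>P\<in>carrier (GL (fst \<sigma>)). \<forall>g\<in>carrier G. P * snd \<sigma> g = snd \<sigma>' g * P)"

definition kronecker :: "complex mat \<Rightarrow> complex mat \<Rightarrow> complex mat" where
  "kronecker A B = Matrix.mat (dim_row A * dim_row B) (dim_col A * dim_col B)
     (\<lambda>(i, j). A $$ (i div dim_row B, j div dim_col B) * B $$ (i mod dim_row B, j mod dim_col B))"

definition tensor_rep :: "'g rep \<Rightarrow> 'g rep \<Rightarrow> 'g rep" where
  "tensor_rep \<sigma> \<sigma>' = (fst \<sigma> * fst \<sigma>', \<lambda>g. kronecker (snd \<sigma> g) (snd \<sigma>' g))"

definition direct_sum_rep :: "'g rep list \<Rightarrow> 'g rep" where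
  "direct_sum_rep \<sigma>s = (sum_list (map fst \<sigma>s), \<lambda>g. diag_block_mat (map (\<lambda>\<sigma>. snd \<sigma> g) \<sigma>s))"

text \<open>The number of summands isomorphic to \<open>\<sigma>\<close> in a decomposition of \<open>V\<close> into irreducibles
  (well defined for representations of finite groups).\<close>

definition rep_multiplicity :: "('g, 'b) monoid_scheme \<Rightarrow> 'g rep \<Rightarrow> 'g rep \<Rightarrow> nat" where
  "rep_multiplicity G \<sigma> V = (THE k. \<exists>\<sigma>s. (\<forall>\<tau>\<in>set \<sigma>s. irreducible_rep G \<tau>) \<and>
     rep_iso G V (direct_sum_rep \<sigma>s) \<and> k = length (filter (rep_iso G \<sigma>) \<sigma>s))"

definition trivial_rep :: "'g rep" where
  "trivial_rep = (1, \<lambda>_. 1\<^sub>m 1)"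


section \<open>McKay graphs of subgroups of \<open>SU(3)\<close>\<close>

definition SU3 :: "complex mat monoid" where
  "SU3 = \<lparr>carrier = {U \<in> carrier_mat 3 3. U * mat_adjoint U = 1\<^sub>m 3 \<and> Determinant.det U = 1},
          mult = (*), one = 1\<^sub>m 3\<rparr>"

definition inclusion_rep :: "complex mat rep" where
  "inclusion_rep = (3, \<lambda>g. g)"

definition iso_rel :: "complex mat set \<Rightarrow> (complex mat rep \<times> complex mat rep) set" where
  "iso_rel \<Gamma> = {(\<sigma>, \<sigma>'). irreducible_rep (SU3\<lparr>carrier := \<Gamma>\<rparr>) \<sigma> \<and>
     irreducible_rep (SU3\<lparr>carrier := \<Gamma>\<rparr>) \<sigma>' \<and> rep_iso (SU3\<lparr>carrier := \<Gamma>\<rparr>) \<sigma> \<sigma>'}"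

definition McKay_vertices :: "complex mat set \<Rightarrow> complex mat rep set set" where
  "McKay_vertices \<Gamma> = {\<sigma>. irreducible_rep (SU3\<lparr>carrier := \<Gamma>\<rparr>) \<sigma>} // iso_rel \<Gamma>"

text \<open>The multiplicity does not depend on the chosen representatives of the two classes.\<close>

definition McKay_adj :: "complex mat set \<Rightarrow> complex mat rep set \<Rightarrow> complex mat rep set \<Rightarrow> nat" where
  "McKay_adj \<Gamma> v v' = rep_multiplicity (SU3\<lparr>carrier := \<Gamma>\<rparr>) (SOME \<sigma>'. \<sigma>' \<in> v')
     (tensor_rep inclusion_rep (SOME \<sigma>. \<sigma> \<in> v))"

text \<open>The adjacency matrix and its adjoint (conjugate transpose) as operators on vectors indexed
  by the vertices.\<close>

definition apply_matrix :: "'v set \<Rightarrow> ('v \<Rightarrow> 'v \<Rightarrow> complex) \<Rightarrow> ('v \<Rightarrow> complex) \<Rightarrow> 'v \<Rightarrow> complex" where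
  "apply_matrix V M x = (\<lambda>v. \<Sum>w\<in>V. M v w * x w)"

definition McKay_op :: "complex mat set \<Rightarrow> (complex mat rep set \<Rightarrow> complex) \<Rightarrow> complex mat rep set \<Rightarrow> complex" where
  "McKay_op \<Gamma> = apply_matrix (McKay_vertices \<Gamma>) (\<lambda>v w. of_nat (McKay_adj \<Gamma> v w))"

definition McKay_op_adjoint :: "complex mat set \<Rightarrow> (complex mat rep set \<Rightarrow> complex) \<Rightarrow> complex mat rep set \<Rightarrow> complex" where
  "McKay_op_adjoint \<Gamma> = apply_matrix (McKay_vertices \<Gamma>) (\<lambda>v w. cnj (of_nat (McKay_adj \<Gamma> w v)))"

definition e_trivial :: "complex mat set \<Rightarrow> complex mat rep set \<Rightarrow> complex" where
  "e_trivial \<Gamma> = (\<lambda>v. if v = iso_rel \<Gamma> `` {trivial_rep} then 1 else 0)"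

definition vertex_inner ::
    "complex mat set \<Rightarrow> (complex mat rep set \<Rightarrow> complex) \<Rightarrow> (complex mat rep set \<Rightarrow> complex) \<Rightarrow> complex" where
  "vertex_inner \<Gamma> x y = (\<Sum>v\<in>McKay_vertices \<Gamma>. x v * cnj (y v))"


section \<open>Spectral measures over the torus\<close>

definition torus :: "(complex \<times> complex) set" where
  "torus = sphere 0 1 \<times> sphere 0 1"

definition R_fun :: "nat \<Rightarrow> nat \<Rightarrow> complex \<times> complex \<Rightarrow> complex" where
  "R_fun m n = (\<lambda>(w1, w2). (w1 + inverse w2 + inverse w1 * w2) ^ m * (inverse w1 + w2 + w1 * inverse w2) ^ n)"

definition spectral_measure_over_torus :: "complex mat set \<Rightarrow> (complex \<times> complex) measure \<Rightarrow> bool" where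
  "spectral_measure_over_torus \<Gamma> \<epsilon> \<longleftrightarrow>
     finite_measure \<epsilon> \<and> sets \<epsilon> = sets (restrict_space borel torus) \<and>
     (\<forall>m n. (\<integral>x. R_fun m n x \<partial>\<epsilon>)
        = vertex_inner \<Gamma> ((McKay_op \<Gamma> ^^ m) ((McKay_op_adjoint \<Gamma> ^^ n) (e_trivial \<Gamma>))) (e_trivial \<Gamma>))"


section \<open>Particular measures on the torus\<close>

text \<open>The sine formula is 1-periodic in both angles, so the choice of the branch of the
  argument does not matter; see \<open>J_fun_cis\<close> below.\<close>

definition J_fun :: "complex \<times> complex \<Rightarrow> real" where
  "J_fun = (\<lambda>(w1, w2). let \<theta>1 = Arg w1 / (2 * pi); \<theta>2 = Arg w2 / (2 * pi) in
     4 * pi\<^sup>2 * (sin (2 * pi * (\<theta>1 + \<theta>2)) - sin (2 * pi * (2 * \<theta>1 - \<theta>2)) - sin (2 * pi * (2 * \<theta>2 - \<theta>1))))"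

lemma J_fun_cis:
  "J_fun (cis (2 * pi * \<theta>1), cis (2 * pi * \<theta>2)) =
     4 * pi\<^sup>2 * (sin (2 * pi * (\<theta>1 + \<theta>2)) - sin (2 * pi * (2 * \<theta>1 - \<theta>2)) - sin (2 * pi * (2 * \<theta>2 - \<theta>1)))"
proof -
  have arg: "cis (Arg (cis t)) = cis t" for t
    using rcis_cmod_Arg[of "cis t"] by (simp add: rcis_def)
  have *: "sin (p + q) = Im (cis p * cis q)" "sin (2 * p - q) = Im (cis p * cis p * inverse (cis q))"
    for p q :: real
    by (simp_all add: cis_mult)
  have **: "J_fun (w1, w2) = 4 * pi\<^sup>2 * (sin (Arg w1 + Arg w2) - sin (2 * Arg w1 - Arg w2) - sin (2 * Arg w2 - Arg w1))"
    for w1 w2 by (simp add: J_fun_def Let_def field_simps)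
  have "J_fun (cis (2 * pi * \<theta>1), cis (2 * pi * \<theta>2)) =
     4 * pi\<^sup>2 * (sin (2 * pi * \<theta>1 + 2 * pi * \<theta>2) - sin (2 * (2 * pi * \<theta>1) - 2 * pi * \<theta>2)
       - sin (2 * (2 * pi * \<theta>2) - 2 * pi * \<theta>1))"
    unfolding ** unfolding * by (simp add: arg)
  then show ?thesis by (simp add: algebra_simps)
qed

definition D_set :: "nat \<Rightarrow> (complex \<times> complex) set" where
  "D_set N = {(cis (2 * pi * real q1 / (3 * real N)), cis (2 * pi * real q2 / (3 * real N))) | q1 q2.
     q1 \<in> {0..3 * N - 1} \<and> q2 \<in> {0..3 * N - 1} \<and> (q1 + q2) mod 3 = 0}"

definition dN :: "nat \<Rightarrow> (complex \<times> complex) pmf" where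
  "dN N = pmf_of_set (D_set N)"

definition J2_dN :: "nat \<Rightarrow> (complex \<times> complex) measure" where
  "J2_dN N = density (measure_pmf (dN N)) (\<lambda>x. ennreal ((J_fun x)\<^sup>2))"

definition torus_map1 :: "complex \<times> complex \<Rightarrow> complex \<times> complex" where
  "torus_map1 = (\<lambda>(w1, w2) \<in> torus. (inverse w2, inverse w1))"

definition torus_map2 :: "complex \<times> complex \<Rightarrow> complex \<times> complex" where
  "torus_map2 = (\<lambda>(w1, w2) \<in> torus. (inverse w2, w1 * inverse w2))"

text \<open>In particular, products of these maps in \<open>BijGroup torus\<close> are compositions.\<close>

lemma torus_maps_Bij: "torus_map1 \<in> Bij torus" "torus_map2 \<in> Bij torus"
proof -
  have nz: "inverse a * a = 1" "a * inverse a = 1" "inverse a * (a * b) = b" "b * inverse a * a = b" if "norm a = 1" for a b :: complex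
    using that by (auto simp: field_simps)
  show "torus_map1 \<in> Bij torus"
    unfolding Bij_def
  proof safe
    show "bij_betw torus_map1 torus torus"
      by (rule bij_betwI[where g = torus_map1])
        (auto simp: torus_map1_def torus_def norm_inverse)
  qed (auto simp: torus_map1_def)
  show "torus_map2 \<in> Bij torus"
    unfolding Bij_def
  proof safe
    show "bij_betw torus_map2 torus torus"
      by (rule bij_betwI[where g = "\<lambda>(w1, w2). (w2 * inverse w1, inverse w1)"])
        (auto simp: torus_map2_def torus_def norm_inverse norm_mult nz mult_ac simp del: left_inverse right_inverse)
  qed (auto simp: torus_map2_def)
qed

definition S3_group :: "(complex \<times> complex \<Rightarrow> complex \<times> complex) set" where
  "S3_group = generate (BijGroup torus) {torus_map1, torus_map2}"

definition S3_orbit :: "complex \<times> complex \<Rightarrow> (complex \<times> complex) set" where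
  "S3_orbit x = {\<phi> x | \<phi>. \<phi> \<in> S3_group}"

definition omega :: complex where
  "omega = cis (2 * pi / 3)"

definition ddN :: "real \<Rightarrow> (complex \<times> complex) pmf" where
  "ddN s = (let \<tau> = cis (2 * pi / s) in
     pmf_of_set (S3_orbit (\<tau>, \<tau>) \<union> S3_orbit (cnj omega * cnj \<tau>, omega)
       \<union> S3_orbit (omega, cnj omega * cnj \<tau>)))"


section \<open>The ternary \<open>A\<^sub>5\<close> group\<close>

definition centre_SU3 :: "complex mat set" where
  "centre_SU3 = {c \<cdot>\<^sub>m 1\<^sub>m 3 | c. c \<in> {1, omega, omega\<^sup>2}}"

definition ternary_A5 :: "complex mat set \<Rightarrow> bool" where
  "ternary_A5 \<Gamma> \<longleftrightarrow>
     (\<exists>A. subgroup A SU3 \<and> SU3\<lparr>carrier := A\<rparr> \<cong> alt_group 5 \<and> \<Gamma> = generate SU3 (A \<union> centre_SU3)) \<and>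
     card \<Gamma> = 180"

end

theory Submission
  imports Defs
begin

text \<open>Both sides are moments of a trace. For a finite \<open>\<Gamma>\<close> in \<open>SU(3)\<close> the vectors of values of the irreducible
  characters at a fixed \<open>g\<close> diagonalise \<open>\<Delta>\<close> with eigenvalue the trace of \<open>g\<close>, so the McKay moments are the averages
  of \<open>tr(g)\<^sup>m\<close> times the \<open>n\<close>-th power of its conjugate. In a copy of \<open>A\<^sub>5\<close> in \<open>SU(3)\<close> all traces are real, and the
  Newton identities for matrices of determinant one then force the traces \<open>3\<close>, \<open>-1\<close>, \<open>0\<close> and the two roots of
  \<open>t\<^sup>2 = t + 1\<close>, attained 1, 15, 20, 12 and 12 times; the centre rotates them by cube roots of unity. On the other
  side the function \<open>\<omega>\<^sub>1 + \<omega>\<^sub>2\<^sup>-\<^sup>1 + \<omega>\<^sub>1\<^sup>-\<^sup>1\<omega>\<^sub>2\<close> takes the value \<open>0\<close> on the part of \<open>D\<^sub>3\<close> where \<open>J\<close> does not vanish,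
  the values \<open>3\<close> and \<open>-1\<close> up to cube roots of unity on \<open>D\<^sub>2\<close>, the value \<open>3\<close> on \<open>D\<^sub>1\<close>, and the golden roots on the two
  orbit unions, with matching weights.\<close>

text \<open>Since \<open>rep_multiplicity\<close> is a definite description, the entries of the
  McKay matrix are only accessible once decompositions are known to exist (Maschke) and to have
  well-defined counts (orthogonality of characters). The bridge to the moments is row orthogonality
  with the trivial character. An abstract copy of \<open>A\<^sub>5\<close> carries no information on
  which of its two faithful 3-dimensional representations it is. The argument is symmetric in this
  choice, because squaring exchanges the two golden traces. In units of 1/180 the weights match as
  follows, for each cube root of unity \<open>c\<close>. The term with \<open>d^(2)\<close> puts 5
  on \<open>3 c\<close> and 15 on \<open>- c\<close>, and the term with \<open>d^(1)\<close> takes 4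
  away from \<open>3 c\<close>, leaving 1. Each orbit term puts 12 on \<open>c\<close> times its
  golden root. The term with \<open>J^2\<close> has total mass 60, all at value 0, which is 20 for
  each of the three rotations. The combination is signed and its terms live on the full power set,
  whereas a positive measure on the Borel sets of the torus is wanted; it is therefore built from
  point weights whose positivity is proved.\<close>

unbundle no vec_syntax

section \<open>Traces\<close>

definition mtrace :: "complex mat \<Rightarrow> complex" where
  "mtrace A = (\<Sum>i<dim_row A. A $$ (i, i))"

lemma mult_mat_index:
  assumes "A \<in> carrier_mat n k" "B \<in> carrier_mat k m" "i < n" "j < m"
  shows "(A * B) $$ (i, j) = (\<Sum>l<k. A $$ (i, l) * B $$ (l, j))"
  using assms by (auto simp: scalar_prod_def atLeast0LessThan intro!: sum.cong)

lemma mult_mat_vec_index: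
  assumes "A \<in> carrier_mat n k" "v \<in> carrier_vec k" "i < n"
  shows "(A *\<^sub>v v) $ i = (\<Sum>l<k. A $$ (i, l) * v $ l)"
  using assms by (auto simp: scalar_prod_def atLeast0LessThan intro!: sum.cong)

lemma mtrace_comm:
  assumes "A \<in> carrier_mat n k" "B \<in> carrier_mat k n"
  shows "mtrace (A * B) = mtrace (B * A)"
proof -
  have tr: "mtrace (M * N) = (\<Sum>i<n. \<Sum>l<k. M $$ (i, l) * N $$ (l, i))"
    if MN: "M \<in> carrier_mat n k" "N \<in> carrier_mat k n" for M N n k
  proof -
    have "mtrace (M * N) = (\<Sum>i<n. (M * N) $$ (i, i))" using MN by (simp add: mtrace_def)
    also have "\<dots> = (\<Sum>i<n. \<Sum>l<k. M $$ (i, l) * N $$ (l, i))"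
      by (intro sum.cong refl mult_mat_index[OF MN]) auto
    finally show ?thesis .
  qed
  have "mtrace (A * B) = (\<Sum>l<k. \<Sum>i<n. A $$ (i, l) * B $$ (l, i))"
    by (subst tr[OF assms], rule sum.swap)
  also have "\<dots> = mtrace (B * A)"
    by (subst tr[OF assms(2,1)]) (simp only: mult.commute)
  finally show ?thesis .
qed

text \<open>Serves twice: characters are invariant under isomorphism of representations, and an
  element of \<open>A\<^sub>5\<close> has the same trace as its inverse.\<close>

lemma mtrace_similar:
  assumes "P \<in> carrier_mat n n" "Q \<in> carrier_mat n n" "Q * P = 1\<^sub>m n"
    and "A \<in> carrier_mat n n" "B \<in> carrier_mat n n" "P * A = B * P"
  shows "mtrace A = mtrace B"
proof -
  have "P * Q = 1\<^sub>m n" by (rule mat_mult_left_right_inverse[OF assms(2,1,3)])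
  have "B = B * (P * Q)" using assms \<open>P * Q = 1\<^sub>m n\<close> by simp
  also have "\<dots> = B * P * Q" by (rule assoc_mult_mat[symmetric]) (use assms in auto)
  finally have "mtrace B = mtrace (P * A * Q)" using assms(6) by simp
  also have "\<dots> = mtrace (Q * (P * A))" by (rule mtrace_comm[of _ n n]) (use assms in auto)
  also have "Q * (P * A) = (Q * P) * A" by (rule assoc_mult_mat[symmetric]) (use assms in auto)
  also have "\<dots> = A" using assms by simp
  finally show ?thesis by simp
qed

lemma mtrace_one [simp]: "mtrace (1\<^sub>m n) = of_nat n"
  by (simp add: mtrace_def)

lemma mtrace_smult: "A \<in> carrier_mat n n \<Longrightarrow> mtrace (c \<cdot>\<^sub>m A) = c * mtrace A"
  by (auto simp: mtrace_def sum_distrib_left)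

lemma mtrace_four_block_diag:
  assumes "A \<in> carrier_mat n n" "D \<in> carrier_mat m m"
  shows "mtrace (four_block_mat A (0\<^sub>m n m) (0\<^sub>m m n) D) = mtrace A + mtrace D"
proof -
  let ?M = "four_block_mat A (0\<^sub>m n m) (0\<^sub>m m n) D"
  have *: "(\<Sum>i<n + m. f i) = (\<Sum>i<n. f i) + (\<Sum>i<m. f (n + i))" for f :: "nat \<Rightarrow> complex"
    by (induct m) (auto simp: add.assoc)
  have "mtrace ?M = (\<Sum>i<n + m. ?M $$ (i, i))" using assms by (simp add: mtrace_def)
  also note *
  finally show ?thesis using assms by (simp add: mtrace_def)
qed

section \<open>Representations of finite groups\<close>

abbreviation chr :: "'g rep \<Rightarrow> 'g \<Rightarrow> complex" where
  "chr \<sigma> g \<equiv> mtrace (snd \<sigma> g)"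

lemma GL_carrier: "P \<in> carrier (GL d) \<longleftrightarrow> P \<in> carrier_mat d d \<and> (\<exists>Q\<in>carrier_mat d d. Q * P = 1\<^sub>m d \<and> P * Q = 1\<^sub>m d)"
  by (auto simp: GL_def units_of_def Units_def ring_mat_simps)

lemma GL_I: "P \<in> carrier_mat d d \<Longrightarrow> Q \<in> carrier_mat d d \<Longrightarrow> Q * P = 1\<^sub>m d \<Longrightarrow> P \<in> carrier (GL d)"
  using mat_mult_left_right_inverse[of Q d P] by (auto simp: GL_carrier)

lemma GL_E:
  assumes "P \<in> carrier (GL d)"
  obtains Q where "P \<in> carrier_mat d d" "Q \<in> carrier_mat d d" "Q * P = 1\<^sub>m d" "P * Q = 1\<^sub>m d" "Q \<in> carrier (GL d)"
  using assms by (auto simp: GL_carrier)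

lemma GL_mult: "mult (GL d) = (*)" "one (GL d) = 1\<^sub>m d"
  by (auto simp: GL_def units_of_def ring_mat_simps)

lemma GL_group: "group (GL d)"
proof -
  interpret R: ring "ring_mat TYPE(complex) d ()" by (rule ring_mat)
  show ?thesis unfolding GL_def by (rule R.units_group)
qed

lemma GL_times: "P \<in> carrier (GL d) \<Longrightarrow> Q \<in> carrier (GL d) \<Longrightarrow> P * Q \<in> carrier (GL d)"
  using group.is_monoid[OF GL_group, THEN monoid.m_closed, of P d Q] by (simp add: GL_mult)

text \<open>Replaces the module-theoretic notion in \<open>invariant_subspace\<close> by closure
  conditions on plain vectors.\<close>

lemma subspace_iff:
  "subspace class_ring W (module_vec TYPE(complex) d) \<longleftrightarrow>
     W \<subseteq> carrier_vec d \<and> 0\<^sub>v d \<in> W \<and> (\<forall>v\<in>W. \<forall>w\<in>W. v + w \<in> W) \<and> (\<forall>c. \<forall>v\<in>W. c \<cdot>\<^sub>v v \<in> W)"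
proof -
  interpret vec_space "TYPE(complex)" d .
  show ?thesis
  proof
    assume "subspace class_ring W V"
    then have "submodule class_ring W V" by (simp add: subspace_def)
    then show "W \<subseteq> carrier_vec d \<and> 0\<^sub>v d \<in> W \<and> (\<forall>v\<in>W. \<forall>w\<in>W. v + w \<in> W) \<and> (\<forall>c. \<forall>v\<in>W. c \<cdot>\<^sub>v v \<in> W)"
      by (auto simp: submodule_def module_vec_simps class_ring_simps)
  next
    assume "W \<subseteq> carrier_vec d \<and> 0\<^sub>v d \<in> W \<and> (\<forall>v\<in>W. \<forall>w\<in>W. v + w \<in> W) \<and> (\<forall>c. \<forall>v\<in>W. c \<cdot>\<^sub>v v \<in> W)"
    then show "subspace class_ring W V"
      by (auto simp: subspace_def submodule_def module_vec_simps class_ring_simps vectorspace_axioms module_axioms)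
  qed
qed

locale finite_group = group G for G :: "('g, 'b) monoid_scheme" (structure) +
  assumes fin: "finite (carrier G)"
begin

lemma rep_carrier: "is_rep G \<sigma> \<Longrightarrow> g \<in> carrier G \<Longrightarrow> snd \<sigma> g \<in> carrier_mat (fst \<sigma>) (fst \<sigma>)"
  by (auto simp: is_rep_def hom_def GL_carrier)

lemma rep_mult: "is_rep G \<sigma> \<Longrightarrow> g \<in> carrier G \<Longrightarrow> h \<in> carrier G \<Longrightarrow> snd \<sigma> (g \<otimes> h) = snd \<sigma> g * snd \<sigma> h"
  by (auto simp: is_rep_def hom_def GL_mult)

lemma rep_one: "is_rep G \<sigma> \<Longrightarrow> snd \<sigma> \<one> = 1\<^sub>m (fst \<sigma>)"
  using hom_one[of "snd \<sigma>" G "GL (fst \<sigma>)"] GL_group is_group by (auto simp: is_rep_def GL_mult)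

lemma rep_inv: "is_rep G \<sigma> \<Longrightarrow> g \<in> carrier G \<Longrightarrow> snd \<sigma> (inv g) * snd \<sigma> g = 1\<^sub>m (fst \<sigma>)"
  "is_rep G \<sigma> \<Longrightarrow> g \<in> carrier G \<Longrightarrow> snd \<sigma> g * snd \<sigma> (inv g) = 1\<^sub>m (fst \<sigma>)"
  by (simp_all flip: rep_mult add: rep_one)

text \<open>\<open>f (inv g)\<close> is an inverse matrix of \<open>f g\<close>, so invertibility
  follows from multiplicativity and the value at the unit.\<close>

lemma repI:
  assumes "\<And>g. g \<in> carrier G \<Longrightarrow> f g \<in> carrier_mat d d"
    and "\<And>g h. g \<in> carrier G \<Longrightarrow> h \<in> carrier G \<Longrightarrow> f (g \<otimes> h) = f g * f h"
    and "f \<one> = 1\<^sub>m d"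
  shows "is_rep G (d, f)"
  unfolding is_rep_def hom_def
proof (intro CollectI conjI ballI Pi_I)
  fix g h assume g: "g \<in> carrier G" and h: "h \<in> carrier G"
  show "snd (d, f) g \<in> carrier (GL (fst (d, f)))"
    using GL_I[of "f g" d "f (inv g)"] assms(1) g assms(2)[of "inv g" g] assms(3) by simp
  show "snd (d, f) (g \<otimes> h) = snd (d, f) g \<otimes>\<^bsub>GL (fst (d, f))\<^esub> snd (d, f) h"
    using assms g h by (simp add: GL_mult)
qed

lemma rep_iso_refl: "is_rep G \<sigma> \<Longrightarrow> rep_iso G \<sigma> \<sigma>"
  using GL_I[of "1\<^sub>m (fst \<sigma>)" "fst \<sigma>" "1\<^sub>m (fst \<sigma>)"]
  by (auto simp: rep_iso_def intro!: bexI[of _ "1\<^sub>m (fst \<sigma>)"]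
      dest: rep_carrier simp: left_mult_one_mat[of _ "fst \<sigma>" "fst \<sigma>"] right_mult_one_mat[of _ "fst \<sigma>" "fst \<sigma>"])

lemma rep_iso_sym:
  assumes "is_rep G \<sigma>" "is_rep G \<tau>" "rep_iso G \<sigma> \<tau>" shows "rep_iso G \<tau> \<sigma>"
proof -
  let ?d = "fst \<sigma>"
  from assms obtain P where d: "fst \<tau> = ?d" and P: "P \<in> carrier (GL ?d)"
    and c: "\<And>g. g \<in> carrier G \<Longrightarrow> P * snd \<sigma> g = snd \<tau> g * P" by (auto simp: rep_iso_def)
  from P obtain Q where Q: "P \<in> carrier_mat ?d ?d" "Q \<in> carrier_mat ?d ?d" "Q * P = 1\<^sub>m ?d" "P * Q = 1\<^sub>m ?d"
     "Q \<in> carrier (GL ?d)" by (rule GL_E)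
  have "Q * snd \<tau> g = snd \<sigma> g * Q" if g: "g \<in> carrier G" for g
  proof -
    note m = assoc_mult_mat[of _ ?d ?d _ ?d _ ?d]
    have s: "snd \<sigma> g \<in> carrier_mat ?d ?d" "snd \<tau> g \<in> carrier_mat ?d ?d"
      using rep_carrier[OF assms(1) g] rep_carrier[OF assms(2) g] d by auto
    have "Q * snd \<tau> g = Q * (snd \<tau> g * P) * Q" using Q s by (simp add: m)
    also have "\<dots> = (Q * P) * snd \<sigma> g * Q" using Q(1,2) s by (simp add: c[OF g, symmetric] m)
    also have "\<dots> = snd \<sigma> g * Q" using Q s by simp
    finally show ?thesis .
  qed
  then show ?thesis using d Q by (auto simp: rep_iso_def)
qed

lemma rep_iso_trans:
  assumes "is_rep G \<sigma>" "is_rep G \<tau>" "is_rep G \<pi>" "rep_iso G \<sigma> \<tau>" "rep_iso G \<tau> \<pi>" shows "rep_iso G \<sigma> \<pi>"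
proof -
  let ?d = "fst \<sigma>"
  from assms obtain P where d: "fst \<tau> = ?d" and P: "P \<in> carrier (GL ?d)"
    and c: "\<And>g. g \<in> carrier G \<Longrightarrow> P * snd \<sigma> g = snd \<tau> g * P" by (auto simp: rep_iso_def)
  from assms d obtain Q where d': "fst \<pi> = ?d" and Q: "Q \<in> carrier (GL ?d)"
    and c': "\<And>g. g \<in> carrier G \<Longrightarrow> Q * snd \<tau> g = snd \<pi> g * Q" by (auto simp: rep_iso_def)
  have PQ: "P \<in> carrier_mat ?d ?d" "Q \<in> carrier_mat ?d ?d" using P Q by (auto simp: GL_carrier)
  have "Q * P * snd \<sigma> g = snd \<pi> g * (Q * P)" if g: "g \<in> carrier G" for g
  proof -
    note m = assoc_mult_mat[of _ ?d ?d _ ?d _ ?d]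
    have s: "snd \<sigma> g \<in> carrier_mat ?d ?d" "snd \<tau> g \<in> carrier_mat ?d ?d" "snd \<pi> g \<in> carrier_mat ?d ?d"
      using rep_carrier[OF assms(1) g] rep_carrier[OF assms(2) g] rep_carrier[OF assms(3) g] d d' by auto
    have "Q * P * snd \<sigma> g = Q * snd \<tau> g * P" using PQ s by (simp add: m c[OF g])
    also have "\<dots> = snd \<pi> g * (Q * P)" using PQ s by (simp add: m c'[OF g])
    finally show ?thesis .
  qed
  then show ?thesis using d d' GL_times[OF Q P] by (auto simp: rep_iso_def)
qed

lemma rep_iso_chr:
  assumes "is_rep G \<sigma>" "is_rep G \<tau>" "rep_iso G \<sigma> \<tau>" "g \<in> carrier G" shows "chr \<sigma> g = chr \<tau> g"
proof -
  from assms obtain P where d: "fst \<tau> = fst \<sigma>" and P: "P \<in> carrier (GL (fst \<sigma>))"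
    and c: "P * snd \<sigma> g = snd \<tau> g * P" by (auto simp: rep_iso_def)
  from P obtain Q where Q: "P \<in> carrier_mat (fst \<sigma>) (fst \<sigma>)" "Q \<in> carrier_mat (fst \<sigma>) (fst \<sigma>)" "Q * P = 1\<^sub>m (fst \<sigma>)"
    by (rule GL_E)
  show ?thesis by (rule mtrace_similar[OF Q _ _ c]) (use assms rep_carrier d in metis)+
qed

lemma irreducible_is_rep: "irreducible_rep G \<sigma> \<Longrightarrow> is_rep G \<sigma>"
  by (simp add: irreducible_rep_def)

end

subsection \<open>Schur's lemma\<close>

lemma mat_eq_vecI:
  fixes A :: "complex mat"
  assumes "A \<in> carrier_mat n m" "B \<in> carrier_mat n m" "\<And>v. v \<in> carrier_vec m \<Longrightarrow> A *\<^sub>v v = B *\<^sub>v v"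
  shows "A = B"
proof (rule eq_matI)
  fix i j assume ij: "i < dim_row B" "j < dim_col B"
  have "(A *\<^sub>v unit_vec m j) $ i = (B *\<^sub>v unit_vec m j) $ i" using assms(3) by simp
  then show "A $$ (i, j) = B $$ (i, j)" using ij assms(1,2) by auto
qed (use assms in auto)

context finite_group begin

text \<open>The kernel and the image of an intertwiner are invariant subspaces, so irreducibility on
  both sides leaves only the zero map and bijections.\<close>

lemma schur_GL:
  assumes \<sigma>: "irreducible_rep G \<sigma>" and \<tau>: "irreducible_rep G \<tau>"
    and Y: "Y \<in> carrier_mat (fst \<sigma>) (fst \<tau>)" "Y \<noteq> 0\<^sub>m (fst \<sigma>) (fst \<tau>)"
    and comm: "\<And>g. g \<in> carrier G \<Longrightarrow> snd \<sigma> g * Y = Y * snd \<tau> g"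
  shows "fst \<sigma> = fst \<tau> \<and> Y \<in> carrier (GL (fst \<sigma>))"
proof -
  let ?d = "fst \<sigma>" and ?e = "fst \<tau>"
  have c: "snd \<sigma> g \<in> carrier_mat ?d ?d" "snd \<tau> g \<in> carrier_mat ?e ?e" if "g \<in> carrier G" for g
    using that rep_carrier irreducible_is_rep \<sigma> \<tau> by blast+
  have Yc: "Y *\<^sub>v (snd \<tau> g *\<^sub>v v) = snd \<sigma> g *\<^sub>v (Y *\<^sub>v v)" if "g \<in> carrier G" "v \<in> carrier_vec ?e" for g v
    using c[OF that(1)] Y(1) that(2) comm[OF that(1)]
    by (simp flip: assoc_mult_mat_vec)
  have nz: False if "\<And>v. v \<in> carrier_vec ?e \<Longrightarrow> Y *\<^sub>v v = 0\<^sub>v ?d"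
  proof -
    have "Y *\<^sub>v v = 0\<^sub>m ?d ?e *\<^sub>v v" if "v \<in> carrier_vec ?e" for v
      using \<open>\<And>v. v \<in> carrier_vec ?e \<Longrightarrow> Y *\<^sub>v v = 0\<^sub>v ?d\<close>[OF that] that by (intro eq_vecI) auto
    with Y show False using mat_eq_vecI[OF Y(1) zero_carrier_mat] by blast
  qed
  let ?K = "{v \<in> carrier_vec ?e. Y *\<^sub>v v = 0\<^sub>v ?d}"
  have "invariant_subspace G \<tau> ?K"
    unfolding invariant_subspace_def subspace_iff
  proof (intro conjI ballI allI)
    show "snd \<tau> g *\<^sub>v w \<in> ?K" if "g \<in> carrier G" "w \<in> ?K" for g w
      using that c[OF that(1)] Yc[of g w] by auto
  qed (use Y in \<open>auto simp: mult_add_distrib_mat_vec[OF Y(1)] mult_mat_vec[OF Y(1)]\<close>)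
  then have "?K = {0\<^sub>v ?e} \<or> ?K = carrier_vec ?e" using \<tau> by (simp add: irreducible_rep_def)
  with nz have K: "?K = {0\<^sub>v ?e}" by blast
  let ?I = "(\<lambda>v. Y *\<^sub>v v) ` carrier_vec ?e"
  have "invariant_subspace G \<sigma> ?I"
    unfolding invariant_subspace_def subspace_iff
  proof (intro conjI ballI allI)
    show "0\<^sub>v ?d \<in> ?I" using Y(1) by (auto intro!: image_eqI[of _ _ "0\<^sub>v ?e"])
    show "v + w \<in> ?I" if "v \<in> ?I" "w \<in> ?I" for v w
      using that by (auto simp: mult_add_distrib_mat_vec[OF Y(1), symmetric])
    show "k \<cdot>\<^sub>v v \<in> ?I" if "v \<in> ?I" for k v
      using that by (auto simp: mult_mat_vec[OF Y(1), symmetric])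
    show "snd \<sigma> g *\<^sub>v w \<in> ?I" if "g \<in> carrier G" "w \<in> ?I" for g w
      using that c[OF that(1)] by (auto simp: Yc[OF that(1), symmetric])
  qed (use Y in auto)
  then have "?I = {0\<^sub>v ?d} \<or> ?I = carrier_vec ?d" using \<sigma> by (simp add: irreducible_rep_def)
  with nz have I: "?I = carrier_vec ?d" by blast
  have inj: "v = w" if "v \<in> carrier_vec ?e" "w \<in> carrier_vec ?e" "Y *\<^sub>v v = Y *\<^sub>v w" for v w
  proof -
    have "Y *\<^sub>v (v - w) = 0\<^sub>v ?d"
      using mult_minus_distrib_mat_vec[OF Y(1) that(1,2)] that Y(1) by auto
    then have "v - w \<in> ?K" using that by auto
    then have "v - w = 0\<^sub>v ?e" using K by blast
    then have "v - w + w = w" using that by simp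
    moreover have "v - w + w = v" by (rule eq_vecI) (use that in auto)
    ultimately show ?thesis by simp
  qed
  have "\<forall>j. \<exists>z. j < ?d \<longrightarrow> z \<in> carrier_vec ?e \<and> Y *\<^sub>v z = unit_vec ?d j"
    using I by (metis (no_types, lifting) image_iff unit_vec_carrier)
  then obtain z where z: "\<And>j. j < ?d \<Longrightarrow> z j \<in> carrier_vec ?e" "\<And>j. j < ?d \<Longrightarrow> Y *\<^sub>v z j = unit_vec ?d j"
    by metis
  \<comment> \<open>Preimages of the unit vectors are the columns of a right inverse; injectivity of
    \<open>Y\<close> then makes it a left inverse as well.\<close>
  define Z where "Z = mat_of_cols ?e (map z [0..<?d])"
  have Z: "Z \<in> carrier_mat ?e ?d" unfolding Z_def by (metis mat_of_cols_carrier(1) length_map length_upt minus_nat.diff_0)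
  have YZ: "Y * Z = 1\<^sub>m ?d"
  proof (rule mat_col_eqI)
    fix j assume "j < dim_col (1\<^sub>m ?d :: complex mat)"
    then have j: "j < ?d" by simp
    have "col Z j = z j" using j z(1)[OF j] unfolding Z_def by (subst col_mat_of_cols) auto
    then show "col (Y * Z) j = col (1\<^sub>m ?d) j" using col_mult2[OF Y(1) Z j] z(2)[OF j] j by simp
  qed (use Y Z in auto)
  have ZY: "Z * Y = 1\<^sub>m ?e"
  proof (rule mat_eq_vecI[of _ ?e ?e])
    fix v :: "complex Matrix.vec" assume v: "v \<in> carrier_vec ?e"
    have "Y *\<^sub>v (Z * Y *\<^sub>v v) = (Y * Z) *\<^sub>v (Y *\<^sub>v v)"
      using Y(1) Z v by (simp add: assoc_mult_mat_vec[of _ ?d ?e _ ?d] assoc_mult_mat_vec[of _ ?e ?d _ ?e])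
    also have "\<dots> = Y *\<^sub>v v" using YZ Y(1) v by simp
    finally have "Z * Y *\<^sub>v v = v" by (rule inj[rotated 2]) (use Y(1) Z v in auto)
    then show "Z * Y *\<^sub>v v = 1\<^sub>m ?e *\<^sub>v v" using v by simp
  qed (use Y Z in auto)
  \<comment> \<open>So far \<open>Y\<close> may be rectangular. The traces of \<open>Y * Z\<close>
    and \<open>Z * Y\<close> agree and are the two dimensions.\<close>
  have "complex_of_nat ?d = complex_of_nat ?e" using mtrace_comm[OF Y(1) Z] by (simp only: YZ ZY mtrace_one)
  then have de: "?d = ?e" by (simp only: of_nat_eq_iff)
  have "Y \<in> carrier (GL ?d)"
    by (rule GL_I[of Y ?d Z]) (use Y(1) Z ZY de in \<open>simp_all only:\<close>)
  with de show ?thesis by (rule conjI)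
qed

lemma schur_iso:
  assumes "irreducible_rep G \<sigma>" "irreducible_rep G \<tau>"
    and "Y \<in> carrier_mat (fst \<sigma>) (fst \<tau>)" "Y \<noteq> 0\<^sub>m (fst \<sigma>) (fst \<tau>)"
    and "\<And>g. g \<in> carrier G \<Longrightarrow> snd \<sigma> g * Y = Y * snd \<tau> g"
  shows "rep_iso G \<tau> \<sigma>"
proof -
  note * = schur_GL[OF assms]
  show ?thesis unfolding rep_iso_def
  proof (intro conjI bexI[of _ Y] ballI)
    show "fst \<tau> = fst \<sigma>" "Y \<in> carrier (GL (fst \<tau>))" using * by auto
    show "Y * snd \<tau> g = snd \<sigma> g * Y" if "g \<in> carrier G" for g using assms(5)[OF that] by (rule sym)
  qed
qed

text \<open>Over the complex numbers \<open>Y\<close> has an eigenvalue \<open>c\<close>. Then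
  \<open>Y - c\<close> is again an intertwiner and kills an eigenvector, so it is not invertible and
  must vanish by \<open>schur_GL\<close>.\<close>

lemma schur_scalar:
  assumes \<sigma>: "irreducible_rep G \<sigma>" and Y: "Y \<in> carrier_mat (fst \<sigma>) (fst \<sigma>)"
    and comm: "\<And>g. g \<in> carrier G \<Longrightarrow> snd \<sigma> g * Y = Y * snd \<sigma> g"
  obtains c where "Y = c \<cdot>\<^sub>m 1\<^sub>m (fst \<sigma>)"
proof -
  let ?d = "fst \<sigma>"
  have "?d > 0" using \<sigma> by (simp add: irreducible_rep_def)
  then have "Polynomial.degree (char_poly Y) \<noteq> 0" using degree_monic_char_poly[OF Y] by simp
  then obtain c where "eigenvalue Y c"
    using fundamental_theorem_of_algebra[of "char_poly Y"] eigenvalue_root_char_poly[OF Y]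
    by (auto simp: constant_degree)
  then obtain v where v: "v \<in> carrier_vec ?d" "v \<noteq> 0\<^sub>v ?d" "Y *\<^sub>v v = c \<cdot>\<^sub>v v"
    using Y by (auto simp: eigenvalue_def eigenvector_def)
  define N where "N = Y - c \<cdot>\<^sub>m 1\<^sub>m ?d"
  have N: "N \<in> carrier_mat ?d ?d" unfolding N_def by (rule minus_carrier_mat) auto
  have c1: "(c \<cdot>\<^sub>m 1\<^sub>m ?d) *\<^sub>v v = c \<cdot>\<^sub>v v"
    by (rule eq_vecI) (use v in auto)
  have "N *\<^sub>v v = 0\<^sub>v ?d"
    unfolding N_def by (subst minus_mult_distrib_mat_vec[of _ ?d ?d]) (use v Y c1 in auto)
  have "N = 0\<^sub>m ?d ?d"
  proof (rule ccontr)
    assume n: "N \<noteq> 0\<^sub>m ?d ?d"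
    have "snd \<sigma> g * N = N * snd \<sigma> g" if g: "g \<in> carrier G" for g
    proof -
      have s: "snd \<sigma> g \<in> carrier_mat ?d ?d" using rep_carrier irreducible_is_rep \<sigma> g by blast
      then show ?thesis unfolding N_def using Y comm[OF g]
        by (simp add: mult_minus_distrib_mat[of _ ?d ?d _ ?d] minus_mult_distrib_mat[of _ ?d ?d _ _ ?d]
            mult_smult_distrib[of _ ?d ?d _ ?d] mult_smult_assoc_mat[of _ ?d ?d _ ?d])
    qed
    then have "N \<in> carrier (GL ?d)" using schur_GL[OF \<sigma> \<sigma> N n] by blast
    then obtain Z where Z: "Z \<in> carrier_mat ?d ?d" "Z * N = 1\<^sub>m ?d" by (rule GL_E)
    have "v = (Z * N) *\<^sub>v v" unfolding Z(2) using v by simp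
    also have "\<dots> = Z *\<^sub>v (N *\<^sub>v v)" by (rule assoc_mult_mat_vec[OF Z(1) N v(1)])
    also have "\<dots> = 0\<^sub>v ?d" unfolding \<open>N *\<^sub>v v = 0\<^sub>v ?d\<close> using Z(1) by auto
    finally show False using v by simp
  qed
  then have "Y = c \<cdot>\<^sub>m 1\<^sub>m ?d"
  proof -
    assume N0: "N = 0\<^sub>m ?d ?d"
    show ?thesis
    proof (rule eq_matI)
      fix i j assume "i < dim_row (c \<cdot>\<^sub>m 1\<^sub>m ?d)" "j < dim_col (c \<cdot>\<^sub>m 1\<^sub>m ?d)"
      then show "Y $$ (i, j) = (c \<cdot>\<^sub>m 1\<^sub>m ?d) $$ (i, j)"
        using arg_cong[OF N0, of "\<lambda>M. M $$ (i, j)"] Y unfolding N_def by simp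
    qed (use Y in auto)
  qed
  then show ?thesis by (rule that)
qed

subsection \<open>Orthogonality of characters\<close>

lemma sum_left_translate:
  assumes "h \<in> carrier G"
  shows "(\<Sum>g\<in>carrier G. f (h \<otimes> g)) = (\<Sum>g\<in>carrier G. f g)"
  by (rule sum.reindex_bij_witness[of _ "\<lambda>g. inv h \<otimes> g" "\<lambda>g. h \<otimes> g"])
    (use assms in \<open>auto simp: m_assoc[symmetric]\<close>)

lemma sum_inv: "(\<Sum>g\<in>carrier G. f (inv g)) = (\<Sum>g\<in>carrier G. f g)"
  by (rule sum.reindex_bij_witness[of _ "\<lambda>g. inv g" "\<lambda>g. inv g"]) auto

text \<open>The sum over \<open>g\<close> of \<open>\<sigma> g * E * \<tau> (inv g)\<close>, where
  \<open>E\<close> is the matrix unit at \<open>(k, l)\<close>, written entry by entry: the standard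
  way of producing an intertwiner.\<close>

definition avg_mat :: "'g rep \<Rightarrow> 'g rep \<Rightarrow> nat \<Rightarrow> nat \<Rightarrow> complex mat" where
  "avg_mat \<sigma> \<tau> k l = Matrix.mat (fst \<sigma>) (fst \<tau>)
     (\<lambda>(i, j). \<Sum>g\<in>carrier G. snd \<sigma> g $$ (i, k) * snd \<tau> (inv g) $$ (l, j))"

lemma avg_mat_carrier: "avg_mat \<sigma> \<tau> k l \<in> carrier_mat (fst \<sigma>) (fst \<tau>)"
  by (simp add: avg_mat_def)

text \<open>Replacing \<open>g\<close> by \<open>h \<otimes> g\<close> absorbs the factor on the
  left, and \<open>inv (h \<otimes> g) \<otimes> h = inv g\<close> releases it on the right.\<close>

lemma avg_mat_comm:
  assumes \<sigma>: "is_rep G \<sigma>" and \<tau>: "is_rep G \<tau>" and k: "k < fst \<sigma>" and l: "l < fst \<tau>" and h: "h \<in> carrier G"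
  shows "snd \<sigma> h * avg_mat \<sigma> \<tau> k l = avg_mat \<sigma> \<tau> k l * snd \<tau> h"
proof (rule eq_matI)
  let ?d = "fst \<sigma>" and ?e = "fst \<tau>" and ?Y = "avg_mat \<sigma> \<tau> k l"
  have c: "snd \<sigma> g \<in> carrier_mat ?d ?d" "snd \<tau> g \<in> carrier_mat ?e ?e" if "g \<in> carrier G" for g
    using that rep_carrier \<sigma> \<tau> by blast+
  fix i j assume "i < dim_row (?Y * snd \<tau> h)" "j < dim_col (?Y * snd \<tau> h)"
  then have i: "i < ?d" and j: "j < ?e" using c[OF h] by (auto simp: avg_mat_def)
  have "(snd \<sigma> h * ?Y) $$ (i, j) = (\<Sum>p<?d. snd \<sigma> h $$ (i, p) * ?Y $$ (p, j))"
    by (rule mult_mat_index[OF c(1)[OF h] avg_mat_carrier i j])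
  also have "\<dots> = (\<Sum>p<?d. \<Sum>g\<in>carrier G. snd \<sigma> h $$ (i, p) * snd \<sigma> g $$ (p, k) * snd \<tau> (inv g) $$ (l, j))"
    using j by (simp add: avg_mat_def sum_distrib_left mult.assoc)
  also have "\<dots> = (\<Sum>g\<in>carrier G. (\<Sum>p<?d. snd \<sigma> h $$ (i, p) * snd \<sigma> g $$ (p, k)) * snd \<tau> (inv g) $$ (l, j))"
    by (subst sum.swap) (simp add: sum_distrib_right)
  also have "\<dots> = (\<Sum>g\<in>carrier G. snd \<sigma> (h \<otimes> g) $$ (i, k) * snd \<tau> (inv (h \<otimes> g) \<otimes> h) $$ (l, j))"
  proof (intro sum.cong refl)
    fix g assume g: "g \<in> carrier G"
    have i1: "inv (h \<otimes> g) \<otimes> h = inv g" using h g by (simp add: inv_mult_group m_assoc)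
    show "(\<Sum>p<?d. snd \<sigma> h $$ (i, p) * snd \<sigma> g $$ (p, k)) * snd \<tau> (inv g) $$ (l, j) =
        snd \<sigma> (h \<otimes> g) $$ (i, k) * snd \<tau> (inv (h \<otimes> g) \<otimes> h) $$ (l, j)"
      by (simp only: i1 rep_mult[OF \<sigma> h g] mult_mat_index[OF c(1)[OF h] c(1)[OF g] i k])
  qed
  also have "\<dots> = (\<Sum>g\<in>carrier G. snd \<sigma> g $$ (i, k) * snd \<tau> (inv g \<otimes> h) $$ (l, j))"
    by (rule sum_left_translate[OF h, of "\<lambda>g. snd \<sigma> g $$ (i, k) * snd \<tau> (inv g \<otimes> h) $$ (l, j)"])
  also have "\<dots> = (\<Sum>g\<in>carrier G. \<Sum>p<?e. snd \<sigma> g $$ (i, k) * snd \<tau> (inv g) $$ (l, p) * snd \<tau> h $$ (p, j))"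
  proof (intro sum.cong refl)
    fix g assume g: "g \<in> carrier G"
    show "snd \<sigma> g $$ (i, k) * snd \<tau> (inv g \<otimes> h) $$ (l, j) =
        (\<Sum>p<?e. snd \<sigma> g $$ (i, k) * snd \<tau> (inv g) $$ (l, p) * snd \<tau> h $$ (p, j))"
      by (simp only: rep_mult[OF \<tau> inv_closed[OF g] h] mult_mat_index[OF c(2)[OF inv_closed[OF g]] c(2)[OF h] l j]
          sum_distrib_left mult.assoc)
  qed
  also have "\<dots> = (\<Sum>p<?e. ?Y $$ (i, p) * snd \<tau> h $$ (p, j))"
    using i by (subst sum.swap) (simp add: avg_mat_def sum_distrib_right)
  also have "\<dots> = (?Y * snd \<tau> h) $$ (i, j)"
    by (rule mult_mat_index[OF avg_mat_carrier c(2)[OF h] i j, symmetric])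
  finally show "(snd \<sigma> h * ?Y) $$ (i, j) = (?Y * snd \<tau> h) $$ (i, j)" .
qed (use rep_carrier[OF \<sigma> h] rep_carrier[OF \<tau> h] in \<open>auto simp: avg_mat_def\<close>)

text \<open>A product of two traces is a double sum over diagonal entries \<open>(k, k)\<close> and
  \<open>(l, l)\<close>; summed over the group, each such product is one entry of an intertwiner.
  This reduces both orthogonality relations to Schur's lemma.\<close>

lemma chr_sum_avg_mat:
  assumes \<sigma>: "is_rep G \<sigma>" and \<tau>: "is_rep G \<tau>"
  shows "(\<Sum>g\<in>carrier G. chr \<sigma> g * chr \<tau> (inv g)) = (\<Sum>k<fst \<sigma>. \<Sum>l<fst \<tau>. avg_mat \<sigma> \<tau> k l $$ (k, l))"
proof -
  have "(\<Sum>g\<in>carrier G. chr \<sigma> g * chr \<tau> (inv g)) =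
    (\<Sum>g\<in>carrier G. \<Sum>k<fst \<sigma>. \<Sum>l<fst \<tau>. snd \<sigma> g $$ (k, k) * snd \<tau> (inv g) $$ (l, l))"
  proof (intro sum.cong refl)
    fix g assume g: "g \<in> carrier G"
    have "dim_row (snd \<sigma> g) = fst \<sigma>" "dim_row (snd \<tau> (inv g)) = fst \<tau>"
      using rep_carrier[OF \<sigma> g] rep_carrier[OF \<tau>, of "inv g"] g by auto
    then show "chr \<sigma> g * chr \<tau> (inv g) = (\<Sum>k<fst \<sigma>. \<Sum>l<fst \<tau>. snd \<sigma> g $$ (k, k) * snd \<tau> (inv g) $$ (l, l))"
      by (simp add: mtrace_def sum_product)
  qed
  also have "\<dots> = (\<Sum>k<fst \<sigma>. \<Sum>g\<in>carrier G. \<Sum>l<fst \<tau>. snd \<sigma> g $$ (k, k) * snd \<tau> (inv g) $$ (l, l))"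
    by (rule sum.swap)
  also have "\<dots> = (\<Sum>k<fst \<sigma>. \<Sum>l<fst \<tau>. \<Sum>g\<in>carrier G. snd \<sigma> g $$ (k, k) * snd \<tau> (inv g) $$ (l, l))"
    by (rule sum.cong[OF refl], rule sum.swap)
  also have "\<dots> = (\<Sum>k<fst \<sigma>. \<Sum>l<fst \<tau>. avg_mat \<sigma> \<tau> k l $$ (k, l))"
    by (simp add: avg_mat_def)
  finally show ?thesis .
qed

lemma chr_orthogonal:
  assumes \<sigma>: "irreducible_rep G \<sigma>" and \<tau>: "irreducible_rep G \<tau>" and n: "\<not> rep_iso G \<sigma> \<tau>"
  shows "(\<Sum>g\<in>carrier G. chr \<sigma> g * chr \<tau> (inv g)) = 0"
proof -
  note r = irreducible_is_rep[OF \<sigma>] irreducible_is_rep[OF \<tau>]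
  have "avg_mat \<sigma> \<tau> k l = 0\<^sub>m (fst \<sigma>) (fst \<tau>)" if "k < fst \<sigma>" "l < fst \<tau>" for k l
  proof (rule ccontr)
    assume "avg_mat \<sigma> \<tau> k l \<noteq> 0\<^sub>m (fst \<sigma>) (fst \<tau>)"
    from schur_iso[OF \<sigma> \<tau> avg_mat_carrier this avg_mat_comm[OF r that]] rep_iso_sym[OF r(2,1)] n
    show False by simp
  qed
  then show ?thesis unfolding chr_sum_avg_mat[OF r] by simp
qed

lemma chr_norm:
  assumes \<sigma>: "irreducible_rep G \<sigma>"
  shows "(\<Sum>g\<in>carrier G. chr \<sigma> g * chr \<sigma> (inv g)) = of_nat (order G)"
proof -
  note r = irreducible_is_rep[OF \<sigma>]
  have d0: "fst \<sigma> > 0" using \<sigma> by (simp add: irreducible_rep_def)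
  let ?d = "fst \<sigma>"
  have c: "snd \<sigma> g \<in> carrier_mat ?d ?d" if "g \<in> carrier G" for g using that rep_carrier r by blast
  have *: "avg_mat \<sigma> \<sigma> k l $$ (k, l) = (if k = l then of_nat (order G) / of_nat ?d else 0)"
    if k: "k < ?d" and l: "l < ?d" for k l
  proof -
    obtain a where a: "avg_mat \<sigma> \<sigma> k l = a \<cdot>\<^sub>m 1\<^sub>m ?d"
      using schur_scalar[OF \<sigma> avg_mat_carrier avg_mat_comm[OF r r k l]] by blast
    \<comment> \<open>The scalar \<open>a\<close> is found from the trace: swapping the two factors
      gives the \<open>(l, k)\<close> entry of \<open>\<sigma> (inv g) * \<sigma> g\<close>, an
      identity matrix, once for each \<open>g\<close>.\<close>
    have "a * of_nat ?d = mtrace (avg_mat \<sigma> \<sigma> k l)" by (simp add: a mtrace_smult[of _ ?d])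
    also have "\<dots> = (\<Sum>i<?d. \<Sum>g\<in>carrier G. snd \<sigma> (inv g) $$ (l, i) * snd \<sigma> g $$ (i, k))"
      unfolding mtrace_def by (intro sum.cong) (auto simp: avg_mat_def intro!: sum.cong)
    also have "\<dots> = (\<Sum>g\<in>carrier G. \<Sum>i<?d. snd \<sigma> (inv g) $$ (l, i) * snd \<sigma> g $$ (i, k))"
      by (rule sum.swap)
    also have "\<dots> = (\<Sum>g\<in>carrier G. (1\<^sub>m ?d) $$ (l, k))"
    proof (rule sum.cong[OF refl])
      fix g assume g: "g \<in> carrier G"
      show "(\<Sum>i<?d. snd \<sigma> (inv g) $$ (l, i) * snd \<sigma> g $$ (i, k)) = (1\<^sub>m ?d) $$ (l, k)"
        by (simp only: mult_mat_index[OF c[OF inv_closed[OF g]] c[OF g] l k, symmetric] rep_inv(1)[OF r g])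
    qed
    also have "\<dots> = (if k = l then of_nat (order G) else 0)" using k l by (simp add: order_def)
    finally have "a * of_nat ?d = (if k = l then of_nat (order G) else 0)" .
    then have "a = (if k = l then of_nat (order G) / of_nat ?d else 0)" using d0 by (auto simp: field_simps)
    then show ?thesis using a k l by simp
  qed
  have "(\<Sum>g\<in>carrier G. chr \<sigma> g * chr \<sigma> (inv g)) = (\<Sum>k<?d. \<Sum>l<?d. if k = l then of_nat (order G) / of_nat ?d else 0)"
    unfolding chr_sum_avg_mat[OF r r] by (intro sum.cong refl *) auto
  also have "\<dots> = of_nat (order G)" using d0 by (simp add: sum.delta)
  finally show ?thesis .
qed

end

subsection \<open>Complete reducibility\<close>

lemma mat_vec_in_subspace:
  assumes W: "W \<subseteq> carrier_vec d" "0\<^sub>v d \<in> W" "\<And>v w. v \<in> W \<Longrightarrow> w \<in> W \<Longrightarrow> v + w \<in> W"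
      "\<And>c v. v \<in> W \<Longrightarrow> c \<cdot>\<^sub>v v \<in> W"
    and P: "(P :: complex mat) \<in> carrier_mat d d" and u: "u \<in> carrier_vec d"
    and k: "k \<le> d" "\<And>j. j < k \<Longrightarrow> col P j \<in> W" "\<And>j. k \<le> j \<Longrightarrow> j < d \<Longrightarrow> u $ j = 0"
  shows "P *\<^sub>v u \<in> W"
proof -
  have *: "Matrix.vec d (\<lambda>i. \<Sum>j<m. P $$ (i, j) * u $ j) \<in> W" if "m \<le> k" for m
    using that
  proof (induction m)
    case 0
    have "Matrix.vec d (\<lambda>i. 0) = (0\<^sub>v d :: complex Matrix.vec)" by (rule eq_vecI) auto
    then show ?case using W by simp
  next
    case (Suc m)
    have "Matrix.vec d (\<lambda>i. \<Sum>j<Suc m. P $$ (i, j) * u $ j) =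
      Matrix.vec d (\<lambda>i. \<Sum>j<m. P $$ (i, j) * u $ j) + (u $ m) \<cdot>\<^sub>v col P m"
      using P Suc.prems k(1) by (intro eq_vecI) (auto simp: mult.commute)
    then show ?case using W(3)[OF Suc.IH W(4)[OF k(2)]] Suc.prems by simp
  qed
  have "P *\<^sub>v u = Matrix.vec d (\<lambda>i. \<Sum>j<k. P $$ (i, j) * u $ j)"
  proof (rule eq_vecI)
    fix i assume "i < dim_vec (Matrix.vec d (\<lambda>i. \<Sum>j<k. P $$ (i, j) * u $ j))"
    then have i: "i < d" by simp
    have "(P *\<^sub>v u) $ i = (\<Sum>j<d. P $$ (i, j) * u $ j)" by (rule mult_mat_vec_index[OF P u i])
    also have "\<dots> = (\<Sum>j<k. P $$ (i, j) * u $ j)"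
      by (rule sum.mono_neutral_right) (use k in auto)
    finally show "(P *\<^sub>v u) $ i = Matrix.vec d (\<lambda>i. \<Sum>j<k. P $$ (i, j) * u $ j) $ i" using i by simp
  qed (use P in auto)
  then show ?thesis using *[of k] by simp
qed

text \<open>A Steinitz exchange: column \<open>k\<close> of the identity is overwritten by
  \<open>u\<close>, and the displaced unit vector number \<open>k\<close> moves to column
  \<open>j\<close>. Row \<open>j\<close> then has \<open>u $ j\<close> as its only nonzero entry, so
  a kernel vector vanishes at \<open>k\<close>, and the other columns are distinct unit
  vectors.\<close>

lemma replace_column_GL:
  assumes u: "u \<in> carrier_vec d" and j: "j < d" and k: "k < d" and nz: "u $ j \<noteq> 0"
  shows "Matrix.mat d d (\<lambda>(a, b). if b = k then u $ a else if (if b = j then k else b) = a then 1 else 0)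
    \<in> carrier (GL d)" (is "?M \<in> _")
proof -
  have M: "?M \<in> carrier_mat d d" by simp
  have "v = 0\<^sub>v d" if v: "v \<in> carrier_vec d" and Mv: "?M *\<^sub>v v = 0\<^sub>v d" for v
  proof -
    have row: "u $ a * v $ k + (\<Sum>b\<in>{..<d}-{k}. (if (if b = j then k else b) = a then v $ b else 0)) = 0"
      if a: "a < d" for a
    proof -
      have "0 = (?M *\<^sub>v v) $ a" using Mv a by simp
      also have "\<dots> = (\<Sum>b<d. ?M $$ (a, b) * v $ b)" by (rule mult_mat_vec_index[OF M v a])
      also have "\<dots> = ?M $$ (a, k) * v $ k + (\<Sum>b\<in>{..<d}-{k}. ?M $$ (a, b) * v $ b)"
        by (rule sum.remove) (use k in auto)
      also have "(\<Sum>b\<in>{..<d}-{k}. ?M $$ (a, b) * v $ b) =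
          (\<Sum>b\<in>{..<d}-{k}. (if (if b = j then k else b) = a then v $ b else 0))"
        by (rule sum.cong) (use a in auto)
      finally show ?thesis using a k by simp
    qed
    have "(\<Sum>b\<in>{..<d}-{k}. (if (if b = j then k else b) = j then v $ b else 0)) = 0"
      by (rule sum.neutral) auto
    with row[OF j] nz have vk: "v $ k = 0" by simp
    have "v $ b = 0" if b: "b < d" for b
    proof (cases "b = k")
      case False
      let ?a = "if b = j then k else b"
      have "(\<Sum>c\<in>{..<d}-{k}. (if (if c = j then k else c) = ?a then v $ c else 0)) =
        (\<Sum>c\<in>{..<d}-{k}. (if c = b then v $ c else 0))"
        by (rule sum.cong) (use False in auto)
      also have "\<dots> = v $ b" using b False by (simp add: sum.delta)
      finally show ?thesis using row[of ?a] vk b k by auto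
    qed (use vk in simp)
    then show ?thesis using v by (intro eq_vecI) auto
  qed
  then have "Determinant.det ?M \<noteq> 0" using det_0_iff_vec_prod_zero_field[OF M] by blast
  from det_non_zero_imp_unit[OF M this, of "()"] show ?thesis
    unfolding GL_def units_of_def by simp
qed

text \<open>Basis extension by maximality: \<open>k\<close> is the largest number for which some
  invertible matrix has its first \<open>k\<close> columns in \<open>W\<close>. Membership in
  \<open>W\<close> is then read off the last coordinates with respect to these columns.\<close>

lemma adapted_basis:
  assumes W: "subspace class_ring W (module_vec TYPE(complex) d)" and "W \<noteq> {0\<^sub>v d}" "W \<noteq> carrier_vec d"
  obtains P Q k where "P \<in> carrier_mat d d" "Q \<in> carrier_mat d d" "Q * P = 1\<^sub>m d" "P * Q = 1\<^sub>m d" "0 < k" "k < d"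
    "\<forall>w\<in>carrier_vec d. w \<in> W \<longleftrightarrow> (\<forall>i. k \<le> i \<longrightarrow> i < d \<longrightarrow> (Q *\<^sub>v w) $ i = 0)"
proof -
  have W': "W \<subseteq> carrier_vec d" "0\<^sub>v d \<in> W" "\<And>v w. v \<in> W \<Longrightarrow> w \<in> W \<Longrightarrow> v + w \<in> W"
      "\<And>c v. v \<in> W \<Longrightarrow> c \<cdot>\<^sub>v v \<in> W" using W unfolding subspace_iff by auto
  define S where "S = {k. k \<le> d \<and> (\<exists>P\<in>carrier (GL d). \<forall>j<k. col P j \<in> W)}"
  have fS: "finite S" unfolding S_def by (rule finite_subset[of _ "{..d}"]) auto
  have "0 \<in> S" unfolding S_def using GL_I[of "1\<^sub>m d" d "1\<^sub>m d"] by auto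
  define k where "k = Max S"
  have "k \<in> S" unfolding k_def using fS \<open>0 \<in> S\<close> by (intro Max_in) auto
  then obtain P where k: "k \<le> d" and PG: "P \<in> carrier (GL d)" and cols: "\<And>j. j < k \<Longrightarrow> col P j \<in> W"
    unfolding S_def by auto
  from PG obtain Q where PQ: "P \<in> carrier_mat d d" "Q \<in> carrier_mat d d" "Q * P = 1\<^sub>m d" "P * Q = 1\<^sub>m d"
    by (rule GL_E)
  have iff: "w \<in> W \<longleftrightarrow> (\<forall>i. k \<le> i \<longrightarrow> i < d \<longrightarrow> (Q *\<^sub>v w) $ i = 0)" if w: "w \<in> carrier_vec d" for w
  proof -
    have u: "Q *\<^sub>v w \<in> carrier_vec d" using PQ w by auto
    have "P *\<^sub>v (Q *\<^sub>v w) = (P * Q) *\<^sub>v w" by (rule assoc_mult_mat_vec[OF PQ(1,2) w, symmetric])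
    then have Pu: "P *\<^sub>v (Q *\<^sub>v w) = w" unfolding PQ(4) using w by simp
    define u where "u = Q *\<^sub>v w"
    note u = u[folded u_def] and Pu = Pu[folded u_def]
    show ?thesis unfolding u_def[symmetric]
    proof
    show "w \<in> W" if "\<forall>i. k \<le> i \<longrightarrow> i < d \<longrightarrow> u $ i = 0"
      using mat_vec_in_subspace[OF W' PQ(1) u k cols] that unfolding Pu by simp
    show "\<forall>i. k \<le> i \<longrightarrow> i < d \<longrightarrow> u $ i = 0" if wW: "w \<in> W"
    proof (rule ccontr)
      assume "\<not> ?thesis"
      \<comment> \<open>A vector of \<open>W\<close> with a nonzero coordinate at some
        \<open>j \<ge> k\<close> could be exchanged into column \<open>k\<close>, giving
        \<open>Suc k\<close> columns in \<open>W\<close> and contradicting the maximality of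
        \<open>k\<close>.\<close>
      then obtain j where j: "k \<le> j" "j < d" "u $ j \<noteq> 0" by auto
      then have kd: "k < d" by simp
      define M where "M = Matrix.mat d d (\<lambda>(a, b). if b = k then u $ a else if (if b = j then k else b) = a then 1 else 0)"
      have MG: "M \<in> carrier (GL d)" unfolding M_def by (rule replace_column_GL[OF u j(2) kd j(3)])
      then have M: "M \<in> carrier_mat d d" by (simp add: GL_carrier)
      have "col (P * M) i \<in> W" if i: "i < Suc k" for i
      proof (cases "i = k")
        case True
        have "col M k = u" using kd u by (intro eq_vecI) (auto simp: M_def)
        then show ?thesis using col_mult2[OF PQ(1) M kd] Pu wW True by simp
      next
        case False
        then have ik: "i < k" using i by simp
        have "col M i = unit_vec d i" using ik j kd by (intro eq_vecI) (auto simp: M_def unit_vec_def)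
        moreover have "P *\<^sub>v unit_vec d i = col P i" using ik kd PQ by (intro eq_vecI) auto
        ultimately show ?thesis using col_mult2[OF PQ(1) M, of i] ik kd cols[OF ik] by simp
      qed
      moreover have "P * M \<in> carrier (GL d)" by (rule GL_times[OF PG MG])
      ultimately have "Suc k \<in> S" unfolding S_def using kd by auto
      then show False using Max_ge[OF fS, of "Suc k"] by (simp add: k_def)
    qed
    qed
  qed
  have "k \<noteq> d"
  proof
    assume "k = d"
    then have "w \<in> W" if "w \<in> carrier_vec d" for w using iff[OF that] by auto
    with W'(1) have "W = carrier_vec d" by blast
    then show False using assms(3) by contradiction
  qed
  moreover have "k \<noteq> 0"
  proof
    assume k0: "k = 0"
    have "w = 0\<^sub>v d" if wW: "w \<in> W" for w
    proof -
      have w: "w \<in> carrier_vec d" using wW W' by auto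
      have "Q *\<^sub>v w = 0\<^sub>v d" using iff[OF w] wW k0 PQ by (intro eq_vecI) auto
      moreover have "(P * Q) *\<^sub>v w = P *\<^sub>v (Q *\<^sub>v w)" by (rule assoc_mult_mat_vec[OF PQ(1,2) w])
      ultimately show ?thesis unfolding PQ(4) using w PQ by auto
    qed
    with W'(2) have "W = {0\<^sub>v d}" by blast
    then show False using assms(2) by contradiction
  qed
  ultimately have "0 < k" "k < d" using k by auto
  from that[OF PQ this] iff show ?thesis by blast
qed

section \<open>Block matrices and sums of matrices\<close>

lemma four_block_mat_inj:
  assumes "four_block_mat A B C D = four_block_mat A' B' C' D'"
    and "A \<in> carrier_mat n n'" "B \<in> carrier_mat n m'" "C \<in> carrier_mat m n'" "D \<in> carrier_mat m m'"
    and "A' \<in> carrier_mat n n'" "B' \<in> carrier_mat n m'" "C' \<in> carrier_mat m n'" "D' \<in> carrier_mat m m'"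
  shows "A = A'" "B = B'" "C = C'" "D = D'"
proof -
  have e: "four_block_mat A B C D $$ (i, j) = four_block_mat A' B' C' D' $$ (i, j)" for i j using assms(1) by simp
  show "A = A'"
  proof (rule eq_matI)
    fix i j assume "i < dim_row A'" "j < dim_col A'"
    then show "A $$ (i, j) = A' $$ (i, j)" using e[of i j] assms(2-) by auto
  qed (use assms(2-) in auto)
  show "B = B'"
  proof (rule eq_matI)
    fix i j assume "i < dim_row B'" "j < dim_col B'"
    then show "B $$ (i, j) = B' $$ (i, j)" using e[of i "n' + j"] assms(2-) by auto
  qed (use assms(2-) in auto)
  show "C = C'"
  proof (rule eq_matI)
    fix i j assume "i < dim_row C'" "j < dim_col C'"
    then show "C $$ (i, j) = C' $$ (i, j)" using e[of "n + i" j] assms(2-) by auto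
  qed (use assms(2-) in auto)
  show "D = D'"
  proof (rule eq_matI)
    fix i j assume "i < dim_row D'" "j < dim_col D'"
    then show "D $$ (i, j) = D' $$ (i, j)" using e[of "n + i" "n' + j"] assms(2-) by auto
  qed (use assms(2-) in auto)
qed

lemma split_four_block:
  assumes M: "(M :: complex mat) \<in> carrier_mat (n + m) (n + m)"
    and 0: "\<And>i j. n \<le> i \<Longrightarrow> i < n + m \<Longrightarrow> j < n \<Longrightarrow> M $$ (i, j) = 0"
  shows "M = four_block_mat (Matrix.mat n n (\<lambda>(i, j). M $$ (i, j))) (Matrix.mat n m (\<lambda>(i, j). M $$ (i, n + j)))
     (0\<^sub>m m n) (Matrix.mat m m (\<lambda>(i, j). M $$ (n + i, n + j)))"
  by (rule eq_matI) (use M 0 in auto)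

text \<open>The zero matrix depends on the dimensions, so the sum is formed entrywise with the
  dimensions given explicitly.\<close>

definition sum_matrices :: "nat \<Rightarrow> nat \<Rightarrow> ('g \<Rightarrow> complex mat) \<Rightarrow> 'g set \<Rightarrow> complex mat" where
  "sum_matrices n m f S = Matrix.mat n m (\<lambda>ij. \<Sum>g\<in>S. f g $$ ij)"

lemma sum_matrices_carrier [simp]: "sum_matrices n m f S \<in> carrier_mat n m"
  by (simp add: sum_matrices_def)

lemma sum_matrices_mult_left:
  assumes A: "A \<in> carrier_mat k n" and f: "\<And>g. g \<in> S \<Longrightarrow> f g \<in> carrier_mat n m"
  shows "A * sum_matrices n m f S = sum_matrices k m (\<lambda>g. A * f g) S"
proof (rule eq_matI)
  fix i j assume "i < dim_row (sum_matrices k m (\<lambda>g. A * f g) S)" "j < dim_col (sum_matrices k m (\<lambda>g. A * f g) S)"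
  then have ij: "i < k" "j < m" by (auto simp: sum_matrices_def)
  have "(A * sum_matrices n m f S) $$ (i, j) = (\<Sum>l<n. A $$ (i, l) * sum_matrices n m f S $$ (l, j))"
    by (rule mult_mat_index[OF A sum_matrices_carrier ij])
  also have "\<dots> = (\<Sum>l<n. \<Sum>g\<in>S. A $$ (i, l) * f g $$ (l, j))"
    using ij by (simp add: sum_matrices_def sum_distrib_left)
  also have "\<dots> = (\<Sum>g\<in>S. \<Sum>l<n. A $$ (i, l) * f g $$ (l, j))" by (rule sum.swap)
  also have "\<dots> = (\<Sum>g\<in>S. (A * f g) $$ (i, j))"
    by (intro sum.cong refl mult_mat_index[OF A f ij, symmetric])
  also have "\<dots> = sum_matrices k m (\<lambda>g. A * f g) S $$ (i, j)" using ij by (simp add: sum_matrices_def)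
  finally show "(A * sum_matrices n m f S) $$ (i, j) = sum_matrices k m (\<lambda>g. A * f g) S $$ (i, j)" .
qed (use A in \<open>auto simp: sum_matrices_def\<close>)

lemma sum_matrices_mult_right:
  assumes A: "A \<in> carrier_mat m k" and f: "\<And>g. g \<in> S \<Longrightarrow> f g \<in> carrier_mat n m"
  shows "sum_matrices n m f S * A = sum_matrices n k (\<lambda>g. f g * A) S"
proof (rule eq_matI)
  fix i j assume "i < dim_row (sum_matrices n k (\<lambda>g. f g * A) S)" "j < dim_col (sum_matrices n k (\<lambda>g. f g * A) S)"
  then have ij: "i < n" "j < k" by (auto simp: sum_matrices_def)
  have "(sum_matrices n m f S * A) $$ (i, j) = (\<Sum>l<m. sum_matrices n m f S $$ (i, l) * A $$ (l, j))"
    by (rule mult_mat_index[OF sum_matrices_carrier A ij])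
  also have "\<dots> = (\<Sum>l<m. \<Sum>g\<in>S. f g $$ (i, l) * A $$ (l, j))"
    using ij by (simp add: sum_matrices_def sum_distrib_right)
  also have "\<dots> = (\<Sum>g\<in>S. \<Sum>l<m. f g $$ (i, l) * A $$ (l, j))" by (rule sum.swap)
  also have "\<dots> = (\<Sum>g\<in>S. (f g * A) $$ (i, j))"
    by (intro sum.cong refl mult_mat_index[OF f A ij, symmetric])
  also have "\<dots> = sum_matrices n k (\<lambda>g. f g * A) S $$ (i, j)" using ij by (simp add: sum_matrices_def)
  finally show "(sum_matrices n m f S * A) $$ (i, j) = sum_matrices n k (\<lambda>g. f g * A) S $$ (i, j)" .
qed (use A in \<open>auto simp: sum_matrices_def\<close>)

definition block_rep :: "'g rep \<Rightarrow> 'g rep \<Rightarrow> 'g rep" where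
  "block_rep \<sigma> \<tau> = (fst \<sigma> + fst \<tau>,
     \<lambda>g. four_block_mat (snd \<sigma> g) (0\<^sub>m (fst \<sigma>) (fst \<tau>)) (0\<^sub>m (fst \<tau>) (fst \<sigma>)) (snd \<tau> g))"

lemma four_block_diag_mult:
  assumes "A \<in> carrier_mat n n" "B \<in> carrier_mat m m" "A' \<in> carrier_mat n n" "B' \<in> carrier_mat m m"
  shows "four_block_mat A (0\<^sub>m n m) (0\<^sub>m m n) B * four_block_mat A' (0\<^sub>m n m) (0\<^sub>m m n) B' =
    (four_block_mat (A * A') (0\<^sub>m n m) (0\<^sub>m m n) (B * B') :: complex mat)"
  using assms by (subst mult_four_block_mat[of _ n n _ m _ m _ _ n _ m]) auto

context finite_group begin

lemma block_rep:
  assumes "is_rep G \<sigma>" "is_rep G \<tau>" shows "is_rep G (block_rep \<sigma> \<tau>)"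
  unfolding block_rep_def
proof (rule repI)
  fix g h assume g: "g \<in> carrier G" and h: "h \<in> carrier G"
  show "four_block_mat (snd \<sigma> g) (0\<^sub>m (fst \<sigma>) (fst \<tau>)) (0\<^sub>m (fst \<tau>) (fst \<sigma>)) (snd \<tau> g)
    \<in> carrier_mat (fst \<sigma> + fst \<tau>) (fst \<sigma> + fst \<tau>)"
    using rep_carrier[OF assms(1) g] rep_carrier[OF assms(2) g] by simp
  show "four_block_mat (snd \<sigma> (g \<otimes> h)) (0\<^sub>m (fst \<sigma>) (fst \<tau>)) (0\<^sub>m (fst \<tau>) (fst \<sigma>)) (snd \<tau> (g \<otimes> h)) =
    four_block_mat (snd \<sigma> g) (0\<^sub>m (fst \<sigma>) (fst \<tau>)) (0\<^sub>m (fst \<tau>) (fst \<sigma>)) (snd \<tau> g) *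
    four_block_mat (snd \<sigma> h) (0\<^sub>m (fst \<sigma>) (fst \<tau>)) (0\<^sub>m (fst \<tau>) (fst \<sigma>)) (snd \<tau> h)"
    using four_block_diag_mult[OF rep_carrier[OF assms(1) g] rep_carrier[OF assms(2) g]
        rep_carrier[OF assms(1) h] rep_carrier[OF assms(2) h]]
      rep_mult[OF assms(1) g h] rep_mult[OF assms(2) g h] by simp
qed (simp add: rep_one assms)

lemma block_rep_iso:
  assumes r: "is_rep G \<sigma>" "is_rep G \<tau>" "is_rep G \<sigma>'" "is_rep G \<tau>'" and "rep_iso G \<sigma> \<sigma>'" "rep_iso G \<tau> \<tau>'"
  shows "rep_iso G (block_rep \<sigma> \<tau>) (block_rep \<sigma>' \<tau>')"
proof -
  let ?n = "fst \<sigma>" and ?m = "fst \<tau>"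
  from assms obtain P R where d: "fst \<sigma>' = ?n" "fst \<tau>' = ?m" and P: "P \<in> carrier (GL ?n)" and R: "R \<in> carrier (GL ?m)"
    and c: "\<And>g. g \<in> carrier G \<Longrightarrow> P * snd \<sigma> g = snd \<sigma>' g * P" "\<And>g. g \<in> carrier G \<Longrightarrow> R * snd \<tau> g = snd \<tau>' g * R"
    by (auto simp: rep_iso_def)
  from P obtain P' where P': "P \<in> carrier_mat ?n ?n" "P' \<in> carrier_mat ?n ?n" "P' * P = 1\<^sub>m ?n" by (rule GL_E)
  from R obtain R' where R': "R \<in> carrier_mat ?m ?m" "R' \<in> carrier_mat ?m ?m" "R' * R = 1\<^sub>m ?m" by (rule GL_E)
  let ?D = "\<lambda>A B. four_block_mat A (0\<^sub>m ?n ?m) (0\<^sub>m ?m ?n) B"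
  have "?D P R \<in> carrier (GL (?n + ?m))"
    by (rule GL_I[of _ _ "?D P' R'"]) (use P' R' in \<open>auto simp: four_block_diag_mult\<close>)
  moreover have "?D P R * ?D (snd \<sigma> g) (snd \<tau> g) = ?D (snd \<sigma>' g) (snd \<tau>' g) * ?D P R" if g: "g \<in> carrier G" for g
    using rep_carrier[OF r(1) g] rep_carrier[OF r(2) g] rep_carrier[OF r(3) g] rep_carrier[OF r(4) g] d P' R'
    by (simp add: four_block_diag_mult c[OF g])
  ultimately show ?thesis unfolding rep_iso_def block_rep_def fst_conv snd_conv d by blast
qed

text \<open>\<open>diag_block_mat\<close> reads the block sizes off the matrices,
  \<open>block_rep\<close> takes the declared dimensions. These are only known to agree at elements
  of the group, hence the pointwise form.\<close>

lemma direct_sum_Cons: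
  assumes "is_rep G \<sigma>" "g \<in> carrier G" "is_rep G (direct_sum_rep \<sigma>s)"
  shows "snd (direct_sum_rep (\<sigma> # \<sigma>s)) g = snd (block_rep \<sigma> (direct_sum_rep \<sigma>s)) g"
  using rep_carrier[OF assms(1,2)] rep_carrier[OF assms(3,2)]
  by (auto simp: direct_sum_rep_def block_rep_def Let_def)

lemma is_rep_cong:
  assumes "fst \<sigma> = fst \<tau>" "\<And>g. g \<in> carrier G \<Longrightarrow> snd \<sigma> g = snd \<tau> g"
  shows "is_rep G \<sigma> = is_rep G \<tau>"
  using assms by (auto simp: is_rep_def hom_def Pi_def)

lemma direct_sum_rep:
  "(\<And>\<sigma>. \<sigma> \<in> set \<sigma>s \<Longrightarrow> is_rep G \<sigma>) \<Longrightarrow> is_rep G (direct_sum_rep \<sigma>s)"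
proof (induction \<sigma>s)
  case Nil
  have "(1\<^sub>m 0 :: complex mat) = 0\<^sub>m 0 0" by (rule eq_matI) auto
  then show ?case by (simp add: direct_sum_rep_def) (rule repI, auto)
next
  case (Cons \<sigma> \<sigma>s)
  then have r: "is_rep G \<sigma>" "is_rep G (direct_sum_rep \<sigma>s)" by auto
  have "is_rep G (direct_sum_rep (\<sigma> # \<sigma>s)) = is_rep G (block_rep \<sigma> (direct_sum_rep \<sigma>s))"
    by (rule is_rep_cong) (use direct_sum_Cons[OF r(1) _ r(2)] in \<open>auto simp: direct_sum_rep_def block_rep_def\<close>)
  then show ?case using block_rep[OF r] by simp
qed

lemma direct_sum_append:
  assumes "\<And>\<sigma>. \<sigma> \<in> set \<sigma>s \<union> set \<tau>s \<Longrightarrow> is_rep G \<sigma>" "g \<in> carrier G"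
  shows "snd (direct_sum_rep (\<sigma>s @ \<tau>s)) g = snd (block_rep (direct_sum_rep \<sigma>s) (direct_sum_rep \<tau>s)) g"
proof -
  have "is_rep G (direct_sum_rep \<sigma>s)" "is_rep G (direct_sum_rep \<tau>s)"
    by (rule direct_sum_rep; use assms(1) in simp)+
  then have "snd (direct_sum_rep \<sigma>s) g \<in> carrier_mat (fst (direct_sum_rep \<sigma>s)) (fst (direct_sum_rep \<sigma>s))"
    "snd (direct_sum_rep \<tau>s) g \<in> carrier_mat (fst (direct_sum_rep \<tau>s)) (fst (direct_sum_rep \<tau>s))"
    using assms(2) rep_carrier by blast+
  then show ?thesis
    by (auto simp: direct_sum_rep_def block_rep_def diag_block_mat_append Let_def)
qed

lemma chr_direct_sum:
  assumes "\<And>\<sigma>. \<sigma> \<in> set \<sigma>s \<Longrightarrow> is_rep G \<sigma>" "g \<in> carrier G"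
  shows "chr (direct_sum_rep \<sigma>s) g = (\<Sum>\<sigma>\<leftarrow>\<sigma>s. chr \<sigma> g)"
  using assms(1)
proof (induction \<sigma>s)
  case Nil
  then show ?case by (simp add: direct_sum_rep_def mtrace_def)
next
  case (Cons \<sigma> \<sigma>s)
  then have r: "is_rep G \<sigma>" "is_rep G (direct_sum_rep \<sigma>s)" by (auto intro: direct_sum_rep)
  have "chr (direct_sum_rep (\<sigma> # \<sigma>s)) g = chr \<sigma> g + chr (direct_sum_rep \<sigma>s) g"
    unfolding direct_sum_Cons[OF r(1) assms(2) r(2)] block_rep_def snd_conv
    by (rule mtrace_four_block_diag[OF rep_carrier[OF r(1) assms(2)] rep_carrier[OF r(2) assms(2)]])
  then show ?case using Cons by simp
qed

end

lemma four_block_upper_mult: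
  fixes A A' B B' D D' :: "complex mat"
  assumes A: "A \<in> carrier_mat n n" "A' \<in> carrier_mat n n" and B: "B \<in> carrier_mat n m" "B' \<in> carrier_mat n m"
    and D: "D \<in> carrier_mat m m" "D' \<in> carrier_mat m m"
  shows "four_block_mat A B (0\<^sub>m m n) D * four_block_mat A' B' (0\<^sub>m m n) D' =
    four_block_mat (A * A') (A * B' + B * D') (0\<^sub>m m n) (D * D')"
proof -
  have "B * 0\<^sub>m m n = 0\<^sub>m n n" "0\<^sub>m m n * A' = 0\<^sub>m m n" "D * 0\<^sub>m m n = 0\<^sub>m m n" "0\<^sub>m m n * B' = 0\<^sub>m m m"
    using right_mult_zero_mat[OF B(1)] left_mult_zero_mat[OF A(2)] right_mult_zero_mat[OF D(1)] left_mult_zero_mat[OF B(2)]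
    by blast+
  moreover have "A * A' \<in> carrier_mat n n" "D * D' \<in> carrier_mat m m"
    by (rule mult_carrier_mat[OF A], rule mult_carrier_mat[OF D])
  ultimately show ?thesis
    by (simp only: mult_four_block_mat[OF A(1) B(1) zero_carrier_mat D(1) A(2) B(2) zero_carrier_mat D(2)]
        right_add_zero_mat left_add_zero_mat right_add_zero_mat[OF zero_carrier_mat])
qed

context finite_group begin

lemma order_pos: "order G > 0"
  using fin one_closed by (auto simp: order_def card_gt_0_iff)

text \<open>The inductive step of Maschke's theorem. In a basis adapted to an invariant subspace all
  matrices are block upper triangular, and one unipotent change of basis, found by averaging, clears
  the upper right block for all group elements at once.\<close>

lemma reducible_split:
  assumes r: "is_rep G \<sigma>" and d: "fst \<sigma> > 0" and red: "\<not> irreducible_rep G \<sigma>"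
  obtains \<sigma>1 \<sigma>2 where "is_rep G \<sigma>1" "is_rep G \<sigma>2" "fst \<sigma>1 < fst \<sigma>" "fst \<sigma>2 < fst \<sigma>"
    "rep_iso G \<sigma> (block_rep \<sigma>1 \<sigma>2)"
proof -
  let ?d = "fst \<sigma>"
  from r d red obtain W where W: "invariant_subspace G \<sigma> W" "W \<noteq> {0\<^sub>v ?d}" "W \<noteq> carrier_vec ?d"
    unfolding irreducible_rep_def by blast
  then have sub: "subspace class_ring W (module_vec TYPE(complex) ?d)"
    and inv: "\<And>g w. g \<in> carrier G \<Longrightarrow> w \<in> W \<Longrightarrow> snd \<sigma> g *\<^sub>v w \<in> W"
    unfolding invariant_subspace_def by blast+
  obtain P Q k where
    PQ: "P \<in> carrier_mat ?d ?d" "Q \<in> carrier_mat ?d ?d" "Q * P = 1\<^sub>m ?d" "P * Q = 1\<^sub>m ?d" and k: "0 < k" "k < ?d"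
    and Wiff': "\<forall>w\<in>carrier_vec ?d. w \<in> W \<longleftrightarrow> (\<forall>i. k \<le> i \<longrightarrow> i < ?d \<longrightarrow> (Q *\<^sub>v w) $ i = 0)"
    by (rule adapted_basis[OF sub W(2,3)])
  note Wiff = bspec[OF Wiff']
  define m where "m = ?d - k"
  have dkm: "?d = k + m" and m: "m < ?d" using k by (auto simp: m_def)
  note c = rep_carrier[OF r]
  note a = assoc_mult_mat[of _ ?d ?d _ ?d _ ?d] and sq = mult_carrier_mat[of _ ?d ?d _ ?d]
  define M where "M g = Q * (snd \<sigma> g * P)" for g
  have Mc: "M g \<in> carrier_mat (k + m) (k + m)" if "g \<in> carrier G" for g
    using c[OF that] PQ unfolding M_def dkm[symmetric] by auto
  have PM: "P * M g = snd \<sigma> g * P" if g: "g \<in> carrier G" for g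
  proof -
    have "P * M g = (P * Q) * (snd \<sigma> g * P)" unfolding M_def
      by (rule assoc_mult_mat[symmetric]) (use PQ c[OF g] in auto)
    then show ?thesis unfolding PQ(4) using PQ(1) c[OF g] by simp
  qed
  have Mmult: "M (g \<otimes> h) = M g * M h" if g: "g \<in> carrier G" and h: "h \<in> carrier G" for g h
  proof -
    have "M g * M h = Q * (snd \<sigma> g * (P * M h))"
      unfolding M_def by (simp only: a sq PQ(1,2) c[OF g] c[OF h])
    also have "\<dots> = Q * (snd \<sigma> g * (snd \<sigma> h * P))" by (simp only: PM[OF h])
    also have "\<dots> = M (g \<otimes> h)" unfolding M_def rep_mult[OF r g h] by (simp only: a sq PQ(1,2) c[OF g] c[OF h])
    finally show ?thesis by simp
  qed
  have M1: "M \<one> = 1\<^sub>m (k + m)" unfolding M_def rep_one[OF r] using PQ dkm by simp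
  \<comment> \<open>The first \<open>k\<close> columns of \<open>P\<close> lie in \<open>W\<close>,
    and so do their images; their coordinates beyond \<open>k\<close> vanish, which empties the
    lower left block.\<close>
  have M0: "M g $$ (i, j) = 0" if g: "g \<in> carrier G" and i: "k \<le> i" "i < k + m" and j: "j < k" for g i j
  proof -
    have jd: "j < ?d" by (rule less_trans[OF j k(2)])
    have cP: "col P j \<in> carrier_vec ?d" by (rule carrier_vecI) (use carrier_matD(1)[OF PQ(1)] in \<open>simp only: dim_col\<close>)
    have "Q *\<^sub>v col P j = col (Q * P) j" by (rule col_mult2[OF PQ(2,1) jd, symmetric])
    also have "\<dots> = unit_vec ?d j" unfolding PQ(3) using jd by simp
    finally have e: "Q *\<^sub>v col P j = unit_vec ?d j" .
    have "col P j \<in> W"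
    proof (rule Wiff[OF cP, THEN iffD2], intro allI impI)
      fix i assume "k \<le> i" "i < ?d"
      then show "(Q *\<^sub>v col P j) $ i = 0" unfolding e using j jd by simp
    qed
    then have "snd \<sigma> g *\<^sub>v col P j \<in> W" by (rule inv[OF g])
    moreover have "snd \<sigma> g *\<^sub>v col P j \<in> carrier_vec ?d" using c[OF g] cP by simp
    ultimately have "\<forall>i. k \<le> i \<longrightarrow> i < ?d \<longrightarrow> (Q *\<^sub>v (snd \<sigma> g *\<^sub>v col P j)) $ i = 0"
      by (rule Wiff[THEN iffD1, rotated])
    then have z: "(Q *\<^sub>v (snd \<sigma> g *\<^sub>v col P j)) $ i = 0" using i dkm by metis
    have "snd \<sigma> g * P \<in> carrier_mat ?d ?d" using c[OF g] PQ(1) by simp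
    then have "col (M g) j = Q *\<^sub>v (snd \<sigma> g *\<^sub>v col P j)"
      unfolding M_def by (simp only: col_mult2[OF PQ(2) _ jd] col_mult2[OF c[OF g] PQ(1) jd])
    then have "col (M g) j $ i = 0" by (simp only: z)
    moreover have "col (M g) j $ i = M g $$ (i, j)" by (rule index_col) (use Mc[OF g] i j in auto)
    ultimately show ?thesis by simp
  qed
  define A where "A g = Matrix.mat k k (\<lambda>(i, j). M g $$ (i, j))" for g
  define B where "B g = Matrix.mat k m (\<lambda>(i, j). M g $$ (i, k + j))" for g
  define D where "D g = Matrix.mat m m (\<lambda>(i, j). M g $$ (k + i, k + j))" for g
  have ABD [simp]: "A g \<in> carrier_mat k k" "B g \<in> carrier_mat k m" "D g \<in> carrier_mat m m" for g
    by (auto simp: A_def B_def D_def)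
  have dB: "dim_row (B g) = k" "dim_col (B g) = m" for g by (simp_all add: B_def)
  have Mblock: "M g = four_block_mat (A g) (B g) (0\<^sub>m m k) (D g)" if "g \<in> carrier G" for g
    unfolding A_def B_def D_def by (rule split_four_block[OF Mc[OF that] M0[OF that]])
  \<comment> \<open>Comparison of blocks in \<open>M (g \<otimes> h) = M g * M h\<close>: the
    diagonal blocks are representations and \<open>B\<close> satisfies a cocycle relation.\<close>
  have mult: "A (g \<otimes> h) = A g * A h" "B (g \<otimes> h) = A g * B h + B g * D h" "D (g \<otimes> h) = D g * D h"
    if g: "g \<in> carrier G" and h: "h \<in> carrier G" for g h
  proof -
    have "four_block_mat (A (g \<otimes> h)) (B (g \<otimes> h)) (0\<^sub>m m k) (D (g \<otimes> h)) = M g * M h"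
      by (simp only: Mmult[OF g h] Mblock[OF m_closed[OF g h], symmetric])
    also have "\<dots> = four_block_mat (A g * A h) (A g * B h + B g * D h) (0\<^sub>m m k) (D g * D h)"
      unfolding Mblock[OF g] Mblock[OF h]
      by (rule four_block_upper_mult) auto
    finally have e: "four_block_mat (A (g \<otimes> h)) (B (g \<otimes> h)) (0\<^sub>m m k) (D (g \<otimes> h)) =
      four_block_mat (A g * A h) (A g * B h + B g * D h) (0\<^sub>m m k) (D g * D h)" .
    have "A g * A h \<in> carrier_mat k k" "A g * B h + B g * D h \<in> carrier_mat k m" "D g * D h \<in> carrier_mat m m"
      by (intro add_carrier_mat mult_carrier_mat[OF ABD(1) ABD(1)] mult_carrier_mat[OF ABD(2) ABD(3)] mult_carrier_mat[OF ABD(3) ABD(3)])+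
    from four_block_mat_inj[OF e ABD(1,2) zero_carrier_mat ABD(3) this(1,2) zero_carrier_mat this(3)]
    show "A (g \<otimes> h) = A g * A h" "B (g \<otimes> h) = A g * B h + B g * D h" "D (g \<otimes> h) = D g * D h" by blast+
  qed
  have one: "A \<one> = 1\<^sub>m k" "D \<one> = 1\<^sub>m m"
    by (rule eq_matI; simp add: A_def D_def M1)+
  have rA: "is_rep G (k, A)" and rD: "is_rep G (m, D)"
    by (rule repI; simp add: mult one)+
  \<comment> \<open>conjugating by the average of the cocycle \<open>h \<mapsto> B h * D (inv h)\<close> removes the off-diagonal block\<close>
  define S where "S = sum_matrices k m (\<lambda>h. B h * D (inv h)) (carrier G)"
  define N where "N = (1 / of_nat (order G)) \<cdot>\<^sub>m S"
  have S [simp]: "S \<in> carrier_mat k m" and N [simp]: "N \<in> carrier_mat k m" by (auto simp: S_def N_def)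
  have BD: "B g * D h \<in> carrier_mat k m" for g h by (rule mult_carrier_mat[of _ k m]) auto
  have AS: "A g * S + of_nat (order G) \<cdot>\<^sub>m B g = S * D g" if g: "g \<in> carrier G" for g
  proof -
    have "A g * S = sum_matrices k m (\<lambda>h. A g * (B h * D (inv h))) (carrier G)"
      unfolding S_def by (rule sum_matrices_mult_left) (auto simp: BD)
    moreover have "S * D g = sum_matrices k m (\<lambda>h. B h * D (inv h) * D g) (carrier G)"
      unfolding S_def by (rule sum_matrices_mult_right) (auto simp: BD)
    \<comment> \<open>The cocycle relation multiplied on the right by \<open>D (inv h)\<close>,
      which equals \<open>D (inv (g \<otimes> h)) * D g\<close>. Summed over \<open>h\<close>, the
      right-hand side becomes \<open>S * D g\<close> after translation by \<open>g\<close>, and the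
      constant term \<open>B g\<close> appears \<open>order G\<close> times.\<close>
    moreover have eq: "A g * (B h * D (inv h)) + B g = B (g \<otimes> h) * D (inv (g \<otimes> h)) * D g" if h: "h \<in> carrier G" for h
    proof -
      have "inv (g \<otimes> h) \<otimes> g = inv h" using g h by (simp add: inv_mult_group m_assoc)
      then have "D (inv (g \<otimes> h)) * D g = D (inv h)" using mult(3)[of "inv (g \<otimes> h)" g] g h by simp
      moreover have "B (g \<otimes> h) * D (inv (g \<otimes> h)) * D g = B (g \<otimes> h) * (D (inv (g \<otimes> h)) * D g)"
        by (rule assoc_mult_mat[of _ k m _ m _ m]) auto
      ultimately have "B (g \<otimes> h) * D (inv (g \<otimes> h)) * D g = (A g * B h + B g * D h) * D (inv h)"
        using mult(2)[OF g h] by simp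
      also have "\<dots> = A g * B h * D (inv h) + B g * D h * D (inv h)"
        by (rule add_mult_distrib_mat[OF mult_carrier_mat[OF ABD(1,2)] mult_carrier_mat[OF ABD(2,3)] ABD(3)])
      also have "A g * B h * D (inv h) = A g * (B h * D (inv h))" by (rule assoc_mult_mat[of _ k k _ m _ m]) auto
      also have "B g * D h * D (inv h) = B g * (D h * D (inv h))" by (rule assoc_mult_mat[of _ k m _ m _ m]) auto
      also have "D h * D (inv h) = 1\<^sub>m m" using mult(3)[OF h, of "inv h"] h one by simp
      also have "B g * 1\<^sub>m m = B g" by (rule right_mult_one_mat[of _ k m]) simp
      finally show ?thesis by simp
    qed
    moreover have "sum_matrices k m (\<lambda>h. A g * (B h * D (inv h))) (carrier G) + of_nat (order G) \<cdot>\<^sub>m B g =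
       sum_matrices k m (\<lambda>h. B h * D (inv h) * D g) (carrier G)"
    proof (rule eq_matI)
      fix i j assume "i < dim_row (sum_matrices k m (\<lambda>h. B h * D (inv h) * D g) (carrier G))"
        "j < dim_col (sum_matrices k m (\<lambda>h. B h * D (inv h) * D g) (carrier G))"
      then have ij: "i < k" "j < m" by (auto simp: sum_matrices_def)
      have "(\<Sum>h\<in>carrier G. (B h * D (inv h) * D g) $$ (i, j)) =
        (\<Sum>h\<in>carrier G. (B (g \<otimes> h) * D (inv (g \<otimes> h)) * D g) $$ (i, j))"
        by (rule sum_left_translate[OF g, symmetric])
      also have "\<dots> = (\<Sum>h\<in>carrier G. (A g * (B h * D (inv h)) + B g) $$ (i, j))"
        by (rule sum.cong) (simp_all only: eq)
      also have "\<dots> = (\<Sum>h\<in>carrier G. (A g * (B h * D (inv h))) $$ (i, j) + B g $$ (i, j))"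
      proof (rule sum.cong[OF refl])
        fix h
        show "(A g * (B h * D (inv h)) + B g) $$ (i, j) = (A g * (B h * D (inv h))) $$ (i, j) + B g $$ (i, j)"
          by (intro index_add_mat(1)) (use ij dB in auto)
      qed
      also have "\<dots> = (\<Sum>h\<in>carrier G. (A g * (B h * D (inv h))) $$ (i, j)) + of_nat (order G) * B g $$ (i, j)"
        by (simp add: sum.distrib order_def)
      finally have *: "(\<Sum>h\<in>carrier G. (B h * D (inv h) * D g) $$ (i, j)) = \<dots>" .
      show "(sum_matrices k m (\<lambda>h. A g * (B h * D (inv h))) (carrier G) + of_nat (order G) \<cdot>\<^sub>m B g) $$ (i, j) =
        sum_matrices k m (\<lambda>h. B h * D (inv h) * D g) (carrier G) $$ (i, j)"
        using ij dB * by (simp add: sum_matrices_def del: index_mult_mat(1))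
    qed (auto simp: sum_matrices_def dB)
    ultimately show ?thesis by simp
  qed
  have AN: "A g * N + B g = N * D g" if g: "g \<in> carrier G" for g
  proof -
    let ?c = "1 / complex_of_nat (order G)"
    have "N * D g = ?c \<cdot>\<^sub>m (S * D g)" unfolding N_def by (rule mult_smult_assoc_mat[of _ k m _ m]) auto
    also have "\<dots> = ?c \<cdot>\<^sub>m (A g * S + of_nat (order G) \<cdot>\<^sub>m B g)" by (simp only: AS[OF g])
    also have "\<dots> = ?c \<cdot>\<^sub>m (A g * S) + ?c \<cdot>\<^sub>m (of_nat (order G) \<cdot>\<^sub>m B g)"
      by (rule add_smult_distrib_left_mat[of _ k m]) (intro mult_carrier_mat[OF ABD(1) S] smult_carrier_mat ABD(2))+
    also have "?c \<cdot>\<^sub>m (A g * S) = A g * N" unfolding N_def by (rule mult_smult_distrib[of _ k k _ m, symmetric]) auto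
    also have "?c \<cdot>\<^sub>m (of_nat (order G) \<cdot>\<^sub>m B g) = B g"
      using order_pos by (intro eq_matI) auto
    finally show ?thesis by simp
  qed
  \<comment> \<open>For a unipotent \<open>?U\<close> with upper right block \<open>N\<close>, the
    equation \<open>?U * ?Dg g = M g * ?U\<close> amounts to \<open>N * D g = A g * N + B g\<close>,
    which is \<open>AN\<close>.\<close>
  let ?U = "four_block_mat (1\<^sub>m k) N (0\<^sub>m m k) (1\<^sub>m m)"
  let ?U' = "four_block_mat (1\<^sub>m k) (- N) (0\<^sub>m m k) (1\<^sub>m m)"
  have U: "?U \<in> carrier_mat ?d ?d" "?U' \<in> carrier_mat ?d ?d" unfolding dkm by auto
  have "?U' * ?U = four_block_mat (1\<^sub>m k * 1\<^sub>m k) (1\<^sub>m k * N + - N * 1\<^sub>m m) (0\<^sub>m m k) (1\<^sub>m m * 1\<^sub>m m)"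
    by (rule four_block_upper_mult) auto
  also have "\<dots> = four_block_mat (1\<^sub>m k) (N + - N) (0\<^sub>m m k) (1\<^sub>m m)"
    by (simp only: left_mult_one_mat[OF N] right_mult_one_mat[OF uminus_carrier_mat[OF N]]
        left_mult_one_mat[OF one_carrier_mat])
  also have "N + - N = 0\<^sub>m k m" by (rule eq_matI) (use carrier_matD[OF N] in simp_all)
  finally have U'U: "?U' * ?U = 1\<^sub>m ?d" unfolding dkm by simp
  let ?Dg = "\<lambda>g. four_block_mat (A g) (0\<^sub>m k m) (0\<^sub>m m k) (D g)"
  have MU: "?U * ?Dg g = M g * ?U" if g: "g \<in> carrier G" for g
  proof -
    have "?U * ?Dg g = four_block_mat (1\<^sub>m k * A g) (1\<^sub>m k * 0\<^sub>m k m + N * D g) (0\<^sub>m m k) (1\<^sub>m m * D g)"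
      by (rule four_block_upper_mult) auto
    also have "\<dots> = four_block_mat (A g) (N * D g) (0\<^sub>m m k) (D g)"
      by (simp only: left_mult_one_mat[OF ABD(1)] left_mult_one_mat[OF ABD(3)] left_mult_one_mat[OF zero_carrier_mat]
         left_add_zero_mat[OF mult_carrier_mat[OF N ABD(3)]])
    finally have 1: "?U * ?Dg g = four_block_mat (A g) (N * D g) (0\<^sub>m m k) (D g)" .
    have "M g * ?U = four_block_mat (A g * 1\<^sub>m k) (A g * N + B g * 1\<^sub>m m) (0\<^sub>m m k) (D g * 1\<^sub>m m)"
      unfolding Mblock[OF g] by (rule four_block_upper_mult) auto
    also have "\<dots> = four_block_mat (A g) (A g * N + B g) (0\<^sub>m m k) (D g)"
      by (simp only: right_mult_one_mat[OF ABD(1)] right_mult_one_mat[OF ABD(2)] right_mult_one_mat[OF ABD(3)])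
    finally show ?thesis using 1 by (simp only: AN[OF g])
  qed
  \<comment> \<open>\<open>?T\<close> is the new basis; its inverse \<open>?R\<close> intertwines in
    the direction required by \<open>rep_iso\<close>.\<close>
  let ?T = "P * ?U" and ?R = "?U' * Q"
  have T: "?T \<in> carrier_mat ?d ?d" and R: "?R \<in> carrier_mat ?d ?d" using PQ U by auto
  have "?R * ?T = ?U' * (Q * P) * ?U" by (simp only: a sq PQ(1,2) U)
  then have RT: "?R * ?T = 1\<^sub>m ?d" unfolding PQ(3) by (simp only: right_mult_one_mat[OF U(2)] U'U)
  have TR: "?T * ?R = 1\<^sub>m ?d" by (rule mat_mult_left_right_inverse[OF R T RT])
  have RG: "?R \<in> carrier (GL ?d)" by (rule GL_I[OF R T TR])
  have "?R * snd \<sigma> g = ?Dg g * ?R" if g: "g \<in> carrier G" for g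
  proof -
    have Dg: "?Dg g \<in> carrier_mat ?d ?d" unfolding dkm by auto
    have Mg: "M g \<in> carrier_mat ?d ?d" using Mc[OF g] dkm by simp
    have "snd \<sigma> g * ?T = (snd \<sigma> g * P) * ?U" by (simp only: a sq PQ(1,2) U c[OF g])
    also have "\<dots> = P * M g * ?U" by (simp only: PM[OF g])
    also have "\<dots> = P * (M g * ?U)" by (simp only: a sq PQ(1,2) U Mg)
    also have "\<dots> = P * (?U * ?Dg g)" by (simp only: MU[OF g])
    also have "\<dots> = ?T * ?Dg g" by (simp only: a sq PQ(1,2) U Dg)
    finally have sT: "snd \<sigma> g * ?T = ?T * ?Dg g" .
    have "?R * snd \<sigma> g = ?R * snd \<sigma> g * (?T * ?R)" unfolding TR by (rule right_mult_one_mat[OF sq[OF R c[OF g]], symmetric])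
    also have "\<dots> = ?R * (snd \<sigma> g * ?T) * ?R" by (simp only: a[OF R c[OF g] sq[OF T R]] a[OF c[OF g] T R, symmetric] a[OF R sq[OF c[OF g] T] R])
    also have "\<dots> = ?R * ?T * ?Dg g * ?R" unfolding sT by (simp only: a[OF R T Dg])
    also have "\<dots> = ?Dg g * ?R" unfolding RT by (simp only: left_mult_one_mat[OF Dg])
    finally show ?thesis .
  qed
  then have "rep_iso G \<sigma> (block_rep (k, A) (m, D))"
    unfolding rep_iso_def block_rep_def using RG dkm by (auto intro!: bexI[of _ ?R])
  then show ?thesis using that[OF rA rD] k m by simp
qed

lemma rep_iso_cong_right:
  assumes "fst \<tau> = fst \<tau>'" "\<And>g. g \<in> carrier G \<Longrightarrow> snd \<tau> g = snd \<tau>' g" "rep_iso G \<sigma> \<tau>"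
  shows "rep_iso G \<sigma> \<tau>'"
  using assms(3) unfolding rep_iso_def by (auto simp: assms(1,2))

lemma maschke:
  assumes "is_rep G \<sigma>"
  shows "\<exists>\<sigma>s. (\<forall>\<tau>\<in>set \<sigma>s. irreducible_rep G \<tau>) \<and> rep_iso G \<sigma> (direct_sum_rep \<sigma>s)"
  using assms
proof (induction "fst \<sigma>" arbitrary: \<sigma> rule: less_induct)
  case less
  consider "fst \<sigma> = 0" | "irreducible_rep G \<sigma>" | "fst \<sigma> > 0" "\<not> irreducible_rep G \<sigma>" by auto
  then show ?case
  proof cases
    \<comment> \<open>Irreducible representations have positive dimension, so dimension zero is the
      empty direct sum.\<close>
    case 1
    have "rep_iso G \<sigma> (direct_sum_rep [])"
      unfolding rep_iso_def direct_sum_rep_def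
    proof (intro conjI bexI[of _ "1\<^sub>m 0"] ballI)
      fix g assume "g \<in> carrier G"
      then have "snd \<sigma> g \<in> carrier_mat 0 0" using rep_carrier[OF less.prems] 1 by simp
      then show "1\<^sub>m 0 * snd \<sigma> g = snd (sum_list (map fst []), \<lambda>g. diag_block_mat (map (\<lambda>\<sigma>. snd \<sigma> g) [])) g * 1\<^sub>m 0"
        by (intro eq_matI) auto
    qed (use 1 GL_I[of "1\<^sub>m 0" 0 "1\<^sub>m 0"] in auto)
    then show ?thesis by (intro exI[of _ "[]"]) auto
  next
    case 2
    have "rep_iso G \<sigma> (direct_sum_rep [\<sigma>])"
      using rep_iso_refl[OF less.prems]
      by (simp add: direct_sum_rep_def rep_iso_def del: diag_block_mat.simps)
    then show ?thesis using 2 by (intro exI[of _ "[\<sigma>]"]) auto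
  next
    case 3
    obtain \<sigma>1 \<sigma>2 where s: "is_rep G \<sigma>1" "is_rep G \<sigma>2" "fst \<sigma>1 < fst \<sigma>" "fst \<sigma>2 < fst \<sigma>"
      "rep_iso G \<sigma> (block_rep \<sigma>1 \<sigma>2)" by (rule reducible_split[OF less.prems 3])
    from less.hyps[OF s(3,1)] obtain a where a: "\<forall>\<tau>\<in>set a. irreducible_rep G \<tau>" "rep_iso G \<sigma>1 (direct_sum_rep a)" by blast
    from less.hyps[OF s(4,2)] obtain b where b: "\<forall>\<tau>\<in>set b. irreducible_rep G \<tau>" "rep_iso G \<sigma>2 (direct_sum_rep b)" by blast
    have ra: "is_rep G (direct_sum_rep a)" and rb: "is_rep G (direct_sum_rep b)"
      by (rule direct_sum_rep; use a b irreducible_is_rep in blast)+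
    have rab: "\<tau> \<in> set a \<union> set b \<Longrightarrow> is_rep G \<tau>" for \<tau> using a b irreducible_is_rep by blast
    have "rep_iso G \<sigma> (block_rep (direct_sum_rep a) (direct_sum_rep b))"
      by (rule rep_iso_trans[OF less.prems block_rep[OF s(1,2)] block_rep[OF ra rb] s(5)
            block_rep_iso[OF s(1,2) ra rb a(2) b(2)]])
    then have "rep_iso G \<sigma> (direct_sum_rep (a @ b))"
      by (rule rep_iso_cong_right[rotated 2])
        (simp add: direct_sum_rep_def block_rep_def, simp only: direct_sum_append[OF rab])
    moreover have "\<forall>\<tau>\<in>set (a @ b). irreducible_rep G \<tau>" using a(1) b(1) by (simp only: set_append ball_Un simp_thms)
    ultimately show ?thesis by blast
  qed
qed

end

subsection \<open>Multiplicities\<close>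

context finite_group begin

lemma chr_product_sum:
  assumes \<sigma>: "irreducible_rep G \<sigma>" and \<tau>: "irreducible_rep G \<tau>"
  shows "(\<Sum>g\<in>carrier G. chr \<tau> g * chr \<sigma> (inv g)) = (if rep_iso G \<sigma> \<tau> then of_nat (order G) else 0)"
proof (cases "rep_iso G \<sigma> \<tau>")
  case True
  have "(\<Sum>g\<in>carrier G. chr \<tau> g * chr \<sigma> (inv g)) = (\<Sum>g\<in>carrier G. chr \<sigma> g * chr \<sigma> (inv g))"
    by (rule sum.cong[OF refl]) (simp only: rep_iso_chr[OF irreducible_is_rep[OF \<sigma>] irreducible_is_rep[OF \<tau>] True])
  then show ?thesis using True chr_norm[OF \<sigma>] by (simp only: if_True)
next
  case False
  then have "\<not> rep_iso G \<tau> \<sigma>"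
    using rep_iso_sym[OF irreducible_is_rep[OF \<tau>] irreducible_is_rep[OF \<sigma>]] by metis
  from chr_orthogonal[OF \<tau> \<sigma> this] False show ?thesis by (simp only: if_False)
qed

lemma sum_list_chr_inner:
  assumes \<sigma>: "irreducible_rep G \<sigma>" and "\<forall>\<tau>\<in>set \<sigma>s. irreducible_rep G \<tau>"
  shows "(\<Sum>g\<in>carrier G. (\<Sum>\<tau>\<leftarrow>\<sigma>s. chr \<tau> g) * chr \<sigma> (inv g)) =
    of_nat (order G) * of_nat (length (filter (rep_iso G \<sigma>) \<sigma>s))"
  using assms(2)
proof (induction \<sigma>s)
  case Nil
  show ?case by simp
next
  case (Cons \<tau> \<sigma>s)
  then have \<tau>: "irreducible_rep G \<tau>" and IH: "(\<Sum>g\<in>carrier G. (\<Sum>\<tau>\<leftarrow>\<sigma>s. chr \<tau> g) * chr \<sigma> (inv g)) =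
    of_nat (order G) * of_nat (length (filter (rep_iso G \<sigma>) \<sigma>s))" by simp_all
  have "(\<Sum>g\<in>carrier G. (\<Sum>\<tau>\<leftarrow>\<tau> # \<sigma>s. chr \<tau> g) * chr \<sigma> (inv g)) =
    (\<Sum>g\<in>carrier G. chr \<tau> g * chr \<sigma> (inv g)) + (\<Sum>g\<in>carrier G. (\<Sum>\<tau>\<leftarrow>\<sigma>s. chr \<tau> g) * chr \<sigma> (inv g))"
    by (simp only: list.map sum_list.Cons distrib_right sum.distrib)
  then show ?case unfolding IH chr_product_sum[OF \<sigma> \<tau>] by (simp add: distrib_left)
qed

lemma chr_decomposition:
  assumes "is_rep G U" "\<forall>\<tau>\<in>set \<sigma>s. irreducible_rep G \<tau>" "rep_iso G U (direct_sum_rep \<sigma>s)" "g \<in> carrier G"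
  shows "chr U g = (\<Sum>\<tau>\<leftarrow>\<sigma>s. chr \<tau> g)"
proof -
  have r: "\<And>\<tau>. \<tau> \<in> set \<sigma>s \<Longrightarrow> is_rep G \<tau>" using assms(2) irreducible_is_rep by metis
  have "is_rep G (direct_sum_rep \<sigma>s)" by (rule direct_sum_rep[OF r])
  from rep_iso_chr[OF assms(1) this assms(3,4)] chr_direct_sum[OF r assms(4)] show ?thesis by (rule trans)
qed

text \<open>The left-hand side does not mention the decomposition \<open>\<sigma>s\<close>, so the
  number of summands isomorphic to \<open>\<sigma>\<close> is the same in all decompositions. This
  is what makes \<open>rep_multiplicity\<close> meaningful.\<close>

lemma multiplicity_unique:
  assumes \<sigma>: "irreducible_rep G \<sigma>" and U: "is_rep G U"
    and s: "\<forall>\<tau>\<in>set \<sigma>s. irreducible_rep G \<tau>" "rep_iso G U (direct_sum_rep \<sigma>s)"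
  shows "(\<Sum>g\<in>carrier G. chr U g * chr \<sigma> (inv g)) = of_nat (order G) * of_nat (length (filter (rep_iso G \<sigma>) \<sigma>s))"
  unfolding sum_list_chr_inner[OF \<sigma> s(1), symmetric]
  by (rule sum.cong[OF refl]) (simp only: chr_decomposition[OF U s])

lemma rep_multiplicity_length:
  assumes \<sigma>: "irreducible_rep G \<sigma>" and U: "is_rep G U"
    and s: "\<forall>\<tau>\<in>set \<sigma>s. irreducible_rep G \<tau>" "rep_iso G U (direct_sum_rep \<sigma>s)"
  shows "rep_multiplicity G \<sigma> U = length (filter (rep_iso G \<sigma>) \<sigma>s)"
  unfolding rep_multiplicity_def
proof (rule the_equality)
  show "\<exists>\<sigma>s'. (\<forall>\<tau>\<in>set \<sigma>s'. irreducible_rep G \<tau>) \<and> rep_iso G U (direct_sum_rep \<sigma>s') \<and>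
    length (filter (rep_iso G \<sigma>) \<sigma>s) = length (filter (rep_iso G \<sigma>) \<sigma>s')"
    by (intro exI[of _ \<sigma>s] conjI s refl)
next
  fix k assume "\<exists>\<sigma>s'. (\<forall>\<tau>\<in>set \<sigma>s'. irreducible_rep G \<tau>) \<and> rep_iso G U (direct_sum_rep \<sigma>s') \<and>
    k = length (filter (rep_iso G \<sigma>) \<sigma>s')"
  then obtain t where t: "\<forall>\<tau>\<in>set t. irreducible_rep G \<tau>" "rep_iso G U (direct_sum_rep t)"
    and k: "k = length (filter (rep_iso G \<sigma>) t)" by (elim exE conjE)
  have "complex_of_nat (order G) * of_nat k = of_nat (order G) * of_nat (length (filter (rep_iso G \<sigma>) \<sigma>s))"
    unfolding k multiplicity_unique[OF \<sigma> U t, symmetric] multiplicity_unique[OF \<sigma> U s, symmetric] by (rule refl)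
  then show "k = length (filter (rep_iso G \<sigma>) \<sigma>s)" using order_pos by simp
qed

lemma rep_multiplicity_inner:
  assumes \<sigma>: "irreducible_rep G \<sigma>" and U: "is_rep G U"
  shows "(\<Sum>g\<in>carrier G. chr U g * chr \<sigma> (inv g)) = of_nat (order G) * of_nat (rep_multiplicity G \<sigma> U)"
proof -
  from maschke[OF U] obtain \<sigma>s where s: "\<forall>\<tau>\<in>set \<sigma>s. irreducible_rep G \<tau>" "rep_iso G U (direct_sum_rep \<sigma>s)"
    by (elim exE conjE)
  show ?thesis unfolding rep_multiplicity_length[OF \<sigma> U s] by (rule multiplicity_unique[OF \<sigma> U s])
qed

text \<open>Pairwise nonisomorphic irreducible representations have orthogonal, hence linearly
  independent characters, and these are functions on a set of \<open>order G\<close>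
  elements.\<close>

lemma nonisomorphic_card:
  assumes S: "finite S" "\<And>\<sigma>. \<sigma> \<in> S \<Longrightarrow> irreducible_rep G \<sigma>"
    and d: "\<And>\<sigma> \<tau>. \<sigma> \<in> S \<Longrightarrow> \<tau> \<in> S \<Longrightarrow> rep_iso G \<sigma> \<tau> \<Longrightarrow> \<sigma> = \<tau>"
  shows "card S \<le> order G"
proof (rule ccontr)
  let ?n = "order G" and ?N = "card S"
  assume "\<not> ?N \<le> ?n"
  then have nN: "?n < ?N" by simp
  from ex_bij_betw_nat_finite[OF S(1)] obtain x where x: "bij_betw x {0..<?N} S" by (elim exE)
  from ex_bij_betw_nat_finite[OF fin] obtain y where y: "bij_betw y {0..<?n} (carrier G)"
    unfolding order_def by (elim exE)
  have xS: "x i \<in> S" if "i < ?N" for i using bij_betwE[OF x] that by simp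
  \<comment> \<open>Rows of \<open>A\<close> are representations and columns are group elements,
    padded with zeros to square shape; \<open>B\<close> is the dual system. Orthogonality gives
    \<open>A * B = 1\<close>, hence \<open>B * A = 1\<close>, although the padded row
    \<open>?n\<close> of \<open>B\<close> is zero.\<close>
  define A where "A = Matrix.mat ?N ?N (\<lambda>(i, j). if j < ?n then chr (x i) (y j) else 0)"
  define B where "B = Matrix.mat ?N ?N (\<lambda>(j, i). if j < ?n then chr (x i) (inv (y j)) / of_nat ?n else 0)"
  have A: "A \<in> carrier_mat ?N ?N" and B: "B \<in> carrier_mat ?N ?N" by (simp_all add: A_def B_def)
  have "A * B = 1\<^sub>m ?N"
  proof (rule eq_matI)
    fix i k assume "i < dim_row (1\<^sub>m ?N :: complex mat)" "k < dim_col (1\<^sub>m ?N :: complex mat)"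
    then have ik: "i < ?N" "k < ?N" by simp_all
    have "(A * B) $$ (i, k) = (\<Sum>j<?N. A $$ (i, j) * B $$ (j, k))" by (rule mult_mat_index[OF A B ik])
    also have "\<dots> = (\<Sum>j<?n. A $$ (i, j) * B $$ (j, k))"
      by (rule sum.mono_neutral_right) (use nN ik in \<open>auto simp: A_def\<close>)
    also have "\<dots> = (\<Sum>j\<in>{0..<?n}. chr (x i) (y j) * chr (x k) (inv (y j)) / of_nat ?n)"
      by (rule sum.cong) (use nN ik in \<open>auto simp: A_def B_def\<close>)
    also have "\<dots> = (\<Sum>g\<in>carrier G. chr (x i) g * chr (x k) (inv g) / of_nat ?n)"
      by (rule sum.reindex_bij_betw[OF y])
    also have "\<dots> = (\<Sum>g\<in>carrier G. chr (x i) g * chr (x k) (inv g)) / of_nat ?n"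
      by (rule sum_divide_distrib[symmetric])
    also have "\<dots> = (if rep_iso G (x k) (x i) then of_nat ?n else 0) / of_nat ?n"
      by (simp only: chr_product_sum[OF S(2)[OF xS[OF ik(2)]] S(2)[OF xS[OF ik(1)]]])
    also have "rep_iso G (x k) (x i) \<longleftrightarrow> i = k"
    proof
      assume "rep_iso G (x k) (x i)"
      from d[OF xS[OF ik(2)] xS[OF ik(1)] this] have "x i = x k" by (rule sym)
      then show "i = k" using inj_onD[OF bij_betw_imp_inj_on[OF x]] ik by simp
    next
      assume "i = k"
      then show "rep_iso G (x k) (x i)"
        using rep_iso_refl[OF irreducible_is_rep[OF S(2)[OF xS[OF ik(1)]]]] by simp
    qed
    also have "(if i = k then of_nat ?n else 0) / complex_of_nat ?n = 1\<^sub>m ?N $$ (i, k)"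
      using ik order_pos by simp
    finally show "(A * B) $$ (i, k) = 1\<^sub>m ?N $$ (i, k)" .
  qed (use A B in simp_all)
  from mat_mult_left_right_inverse[OF A B this] have BA: "B * A = 1\<^sub>m ?N" .
  have "(B * A) $$ (?n, ?n) = (\<Sum>l<?N. B $$ (?n, l) * A $$ (l, ?n))" by (rule mult_mat_index[OF B A nN nN])
  also have "\<dots> = 0" by (rule sum.neutral) (use nN in \<open>simp add: B_def\<close>)
  finally show False unfolding BA using nN by simp
qed

definition irr_rel :: "('g rep \<times> 'g rep) set" where
  "irr_rel = {(\<sigma>, \<sigma>'). irreducible_rep G \<sigma> \<and> irreducible_rep G \<sigma>' \<and> rep_iso G \<sigma> \<sigma>'}"

lemma irr_relD: "(\<sigma>, \<tau>) \<in> irr_rel \<Longrightarrow> rep_iso G \<sigma> \<tau>"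
  by (simp add: irr_rel_def)

definition irr_classes :: "'g rep set set" where
  "irr_classes = {\<sigma>. irreducible_rep G \<sigma>} // irr_rel"

text \<open>The same choice of representative as in \<open>McKay_adj\<close>, so that the adjacency
  matrix can be rewritten literally.\<close>

definition class_rep :: "'g rep set \<Rightarrow> 'g rep" where
  "class_rep v = (SOME \<sigma>. \<sigma> \<in> v)"

lemma equiv_irr_rel: "equiv {\<sigma>. irreducible_rep G \<sigma>} irr_rel"
proof (rule equivI)
  show "irr_rel \<subseteq> {\<sigma>. irreducible_rep G \<sigma>} \<times> {\<sigma>. irreducible_rep G \<sigma>}" unfolding irr_rel_def by blast
  show "refl_on {\<sigma>. irreducible_rep G \<sigma>} irr_rel"
    unfolding irr_rel_def by (rule refl_onI) (simp add: rep_iso_refl irreducible_is_rep)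
  show "sym irr_rel"
  proof (rule symI)
    fix \<sigma> \<tau> assume "(\<sigma>, \<tau>) \<in> irr_rel"
    then have *: "irreducible_rep G \<sigma>" "irreducible_rep G \<tau>" "rep_iso G \<sigma> \<tau>" unfolding irr_rel_def by simp_all
    from * rep_iso_sym[OF irreducible_is_rep[OF *(1)] irreducible_is_rep[OF *(2)] *(3)]
    show "(\<tau>, \<sigma>) \<in> irr_rel" unfolding irr_rel_def by simp
  qed
  show "trans irr_rel"
  proof (rule transI)
    fix \<sigma> \<tau> \<pi> assume "(\<sigma>, \<tau>) \<in> irr_rel" "(\<tau>, \<pi>) \<in> irr_rel"
    then have *: "irreducible_rep G \<sigma>" "irreducible_rep G \<tau>" "irreducible_rep G \<pi>" "rep_iso G \<sigma> \<tau>" "rep_iso G \<tau> \<pi>"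
      unfolding irr_rel_def by simp_all
    from * rep_iso_trans[OF *(1-3)[THEN irreducible_is_rep] *(4,5)] show "(\<sigma>, \<pi>) \<in> irr_rel" unfolding irr_rel_def by simp
  qed
qed

lemma class_rep_in: "v \<in> irr_classes \<Longrightarrow> class_rep v \<in> v"
  unfolding class_rep_def irr_classes_def
  using in_quotient_imp_non_empty[OF equiv_irr_rel] by (simp add: some_in_eq)

lemma class_rep_irreducible:
  assumes "v \<in> irr_classes" shows "irreducible_rep G (class_rep v)"
  using in_quotient_imp_subset[OF equiv_irr_rel, of v] class_rep_in[OF assms] assms unfolding irr_classes_def by auto

lemma class_eqI:
  assumes v: "v \<in> irr_classes" "w \<in> irr_classes" and iso: "rep_iso G (class_rep v) (class_rep w)"
  shows "v = w"
proof (rule quotient_eqI[OF equiv_irr_rel])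
  show "v \<in> {\<sigma>. irreducible_rep G \<sigma>} // irr_rel" "w \<in> {\<sigma>. irreducible_rep G \<sigma>} // irr_rel"
    using v unfolding irr_classes_def by simp_all
  show "class_rep v \<in> v" "class_rep w \<in> w" using v class_rep_in by simp_all
  show "(class_rep v, class_rep w) \<in> irr_rel"
    unfolding irr_rel_def using iso class_rep_irreducible v by simp
qed

lemma class_of_irreducible:
  assumes "irreducible_rep G \<tau>"
  shows "irr_rel `` {\<tau>} \<in> irr_classes" "rep_iso G (class_rep (irr_rel `` {\<tau>})) \<tau>"
proof -
  show *: "irr_rel `` {\<tau>} \<in> irr_classes" unfolding irr_classes_def by (rule quotientI) (use assms in simp)
  have "rep_iso G \<tau> (class_rep (irr_rel `` {\<tau>}))" using class_rep_in[OF *, unfolded Image_singleton_iff] by (rule irr_relD)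
  then show "rep_iso G (class_rep (irr_rel `` {\<tau>})) \<tau>"
    by (rule rep_iso_sym[OF irreducible_is_rep[OF assms] irreducible_is_rep[OF class_rep_irreducible[OF *]]])
qed

lemma class_rep_iso_iff:
  assumes \<tau>: "irreducible_rep G \<tau>" and v: "v \<in> irr_classes"
  shows "rep_iso G (class_rep v) \<tau> \<longleftrightarrow> v = irr_rel `` {\<tau>}"
proof
  note c = class_of_irreducible[OF \<tau>]
  note r = irreducible_is_rep[OF class_rep_irreducible[OF v]] irreducible_is_rep[OF \<tau>]
    irreducible_is_rep[OF class_rep_irreducible[OF c(1)]]
  assume "rep_iso G (class_rep v) \<tau>"
  from class_eqI[OF v c(1) rep_iso_trans[OF r this rep_iso_sym[OF r(3,2) c(2)]]]
  show "v = irr_rel `` {\<tau>}" .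
next
  assume "v = irr_rel `` {\<tau>}"
  then show "rep_iso G (class_rep v) \<tau>" using class_of_irreducible[OF \<tau>] by simp
qed

lemma finite_irr_classes: "finite irr_classes"
proof (rule ccontr)
  assume "infinite irr_classes"
  from infinite_arbitrarily_large[OF this, of "Suc (order G)"] obtain T where
    T: "finite T" "card T = Suc (order G)" "T \<subseteq> irr_classes" by (elim exE conjE)
  have inj: "inj_on class_rep T"
  proof (rule inj_onI)
    fix v w assume "v \<in> T" "w \<in> T" and e: "class_rep v = class_rep w"
    then have v: "v \<in> irr_classes" "w \<in> irr_classes" using T(3) by blast+
    show "v = w" by (rule class_eqI[OF v]) (simp only: e rep_iso_refl[OF irreducible_is_rep[OF class_rep_irreducible[OF v(2)]]])
  qed
  have "card (class_rep ` T) \<le> order G"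
  proof (rule nonisomorphic_card)
    show "finite (class_rep ` T)" using T(1) by simp
    show "irreducible_rep G \<sigma>" if "\<sigma> \<in> class_rep ` T" for \<sigma>
      using that T(3) class_rep_irreducible by blast
    show "\<sigma> = \<tau>" if st: "\<sigma> \<in> class_rep ` T" "\<tau> \<in> class_rep ` T" and iso: "rep_iso G \<sigma> \<tau>" for \<sigma> \<tau>
    proof -
      from st obtain v w where "v \<in> irr_classes" "w \<in> irr_classes" "\<sigma> = class_rep v" "\<tau> = class_rep w" using T(3) by blast
      then show ?thesis using class_eqI[of v w] iso by simp
    qed
  qed
  then show False using card_image[OF inj] T(2) by simp
qed

text \<open>Induction over the summands of a decomposition, each of which belongs to exactly one
  class. For a tensor product \<open>U\<close> this expansion becomes the eigenvector equation of
  the McKay matrix.\<close>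

lemma sum_multiplicity_chr:
  assumes U: "is_rep G U" and g: "g \<in> carrier G"
  shows "(\<Sum>w\<in>irr_classes. of_nat (rep_multiplicity G (class_rep w) U) * chr (class_rep w) g) = chr U g"
proof -
  from maschke[OF U] obtain \<sigma>s where s: "\<forall>\<tau>\<in>set \<sigma>s. irreducible_rep G \<tau>" "rep_iso G U (direct_sum_rep \<sigma>s)"
    by (elim exE conjE)
  have "(\<Sum>w\<in>irr_classes. of_nat (length (filter (rep_iso G (class_rep w)) ts)) * chr (class_rep w) g) = (\<Sum>\<tau>\<leftarrow>ts. chr \<tau> g)"
    if "\<forall>\<tau>\<in>set ts. irreducible_rep G \<tau>" for ts
    using that
  proof (induction ts)
    case (Cons \<tau> ts)
    then have \<tau>: "irreducible_rep G \<tau>" and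
      IH: "(\<Sum>w\<in>irr_classes. of_nat (length (filter (rep_iso G (class_rep w)) ts)) * chr (class_rep w) g) = (\<Sum>\<tau>\<leftarrow>ts. chr \<tau> g)"
      by simp_all
    let ?v = "irr_rel `` {\<tau>}"
    note c = class_of_irreducible[OF \<tau>]
    have "(\<Sum>w\<in>irr_classes. of_nat (length (filter (rep_iso G (class_rep w)) (\<tau> # ts))) * chr (class_rep w) g) =
      (\<Sum>w\<in>irr_classes. (if w = ?v then chr (class_rep w) g else 0) + of_nat (length (filter (rep_iso G (class_rep w)) ts)) * chr (class_rep w) g)"
      by (rule sum.cong[OF refl]) (simp add: class_rep_iso_iff[OF \<tau>] distrib_right)
    also have "\<dots> = chr (class_rep ?v) g + (\<Sum>\<tau>\<leftarrow>ts. chr \<tau> g)"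
      unfolding sum.distrib IH using c(1) finite_irr_classes by (simp add: sum.delta)
    also have "chr (class_rep ?v) g = chr \<tau> g"
      by (rule rep_iso_chr[OF irreducible_is_rep[OF class_rep_irreducible[OF c(1)]] irreducible_is_rep[OF \<tau>] c(2) g])
    finally show ?case by simp
  qed simp
  from this[OF s(1)] show ?thesis unfolding chr_decomposition[OF U s g]
    by (simp add: rep_multiplicity_length[OF class_rep_irreducible U s] cong: sum.cong)
qed

lemma trivial_irreducible: "irreducible_rep G trivial_rep"
  unfolding irreducible_rep_def
proof (intro conjI allI impI)
  show "is_rep G (trivial_rep :: 'g rep)" unfolding trivial_rep_def by (rule repI) simp_all
  show "fst (trivial_rep :: 'g rep) > 0" by (simp add: trivial_rep_def)
  fix W assume "invariant_subspace G (trivial_rep :: 'g rep) W"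
  then have W: "W \<subseteq> carrier_vec 1" "0\<^sub>v 1 \<in> W" and sm: "\<forall>c. \<forall>v\<in>W. c \<cdot>\<^sub>v v \<in> W"
    unfolding invariant_subspace_def subspace_iff by (simp_all add: trivial_rep_def)
  show "W = {0\<^sub>v (fst (trivial_rep :: 'g rep))} \<or> W = carrier_vec (fst (trivial_rep :: 'g rep))"
  proof (cases "W = {0\<^sub>v 1}")
    case True
    then show ?thesis by (simp add: trivial_rep_def)
  next
    case False
    with W(2) obtain w where w: "w \<in> W" "w \<noteq> 0\<^sub>v 1" by blast
    then have wc: "w \<in> carrier_vec 1" using W(1) by blast
    have w0: "w $ 0 \<noteq> 0"
    proof
      assume "w $ 0 = 0"
      then have "w = 0\<^sub>v 1" using wc by (intro eq_vecI) simp_all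
      with w(2) show False by contradiction
    qed
    have "v \<in> W" if v: "v \<in> carrier_vec 1" for v
    proof -
      have "(v $ 0 / w $ 0) \<cdot>\<^sub>v w = v" using wc v w0 by (intro eq_vecI) simp_all
      then show ?thesis using sm w(1) by metis
    qed
    then have "W = carrier_vec 1" using W(1) by blast
    then show ?thesis by (simp add: trivial_rep_def)
  qed
qed

lemma chr_trivial: "chr (trivial_rep :: 'g rep) g = 1"
  by (simp add: trivial_rep_def)

end

subsection \<open>Tensor products\<close>

text \<open>The index pairing of \<open>kronecker\<close>: a single index \<open>l\<close> stands
  for the pair \<open>(l div e, l mod e)\<close>.\<close>

lemma sum_div_mod:
  fixes f :: "nat \<Rightarrow> nat \<Rightarrow> complex"
  shows "(\<Sum>l<d * e. f (l div e) (l mod e)) = (\<Sum>p<d. \<Sum>q<e. f p q)"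
proof (induction d)
  case (Suc d)
  have *: "(\<Sum>l<n + m. F l) = (\<Sum>l<n. F l) + (\<Sum>l<m. F (n + l))" for F :: "nat \<Rightarrow> complex" and n m
    by (induct m) (auto simp: add.assoc)
  have "Suc d * e = d * e + e" by simp
  then have "(\<Sum>l<Suc d * e. f (l div e) (l mod e)) =
    (\<Sum>l<d * e. f (l div e) (l mod e)) + (\<Sum>l<e. f ((d * e + l) div e) ((d * e + l) mod e))"
    by (simp only: *)
  also have "(\<Sum>l<e. f ((d * e + l) div e) ((d * e + l) mod e)) = (\<Sum>q<e. f d q)"
    by (rule sum.cong) auto
  finally show ?case unfolding Suc.IH by simp
qed simp

lemma kronecker_carrier:
  "A \<in> carrier_mat n m \<Longrightarrow> B \<in> carrier_mat k l \<Longrightarrow> kronecker A B \<in> carrier_mat (n * k) (m * l)"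
  by (auto simp: kronecker_def)

lemma kronecker_index:
  assumes "A \<in> carrier_mat n m" "B \<in> carrier_mat k l" "i < n * k" "j < m * l"
  shows "kronecker A B $$ (i, j) = A $$ (i div k, j div l) * B $$ (i mod k, j mod l)"
  using assms by (auto simp: kronecker_def)

lemma kronecker_mult:
  assumes A: "A \<in> carrier_mat n n" "A' \<in> carrier_mat n n" and B: "B \<in> carrier_mat m m" "B' \<in> carrier_mat m m"
  shows "kronecker (A * A') (B * B') = kronecker A B * kronecker A' B'"
proof (rule eq_matI)
  note AA = mult_carrier_mat[OF A] and BB = mult_carrier_mat[OF B]
  note K = kronecker_carrier[OF A(1) B(1)] kronecker_carrier[OF A(2) B(2)]
  fix i j assume "i < dim_row (kronecker A B * kronecker A' B')" "j < dim_col (kronecker A B * kronecker A' B')"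
  then have ij: "i < n * m" "j < n * m" using K by auto
  then have m0: "0 < m" by (cases m) auto
  have lt: "i div m < n" "i mod m < m" "j div m < n" "j mod m < m"
    using ij m0 by (simp_all add: less_mult_imp_div_less)
  have "kronecker (A * A') (B * B') $$ (i, j) = (A * A') $$ (i div m, j div m) * (B * B') $$ (i mod m, j mod m)"
    by (rule kronecker_index[OF AA BB ij])
  also have "\<dots> = (\<Sum>p<n. \<Sum>q<m. (A $$ (i div m, p) * A' $$ (p, j div m)) * (B $$ (i mod m, q) * B' $$ (q, j mod m)))"
    by (simp only: mult_mat_index[OF A lt(1,3)] mult_mat_index[OF B lt(2,4)] sum_product)
  also have "\<dots> = (\<Sum>l<n * m. (A $$ (i div m, l div m) * A' $$ (l div m, j div m)) * (B $$ (i mod m, l mod m) * B' $$ (l mod m, j mod m)))"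
    by (rule sum_div_mod[symmetric])
  also have "\<dots> = (\<Sum>l<n * m. kronecker A B $$ (i, l) * kronecker A' B' $$ (l, j))"
    by (rule sum.cong[OF refl]) (simp only: kronecker_index[OF A(1) B(1) ij(1)] kronecker_index[OF A(2) B(2) _ ij(2)] lessThan_iff mult_ac)
  also have "\<dots> = (kronecker A B * kronecker A' B') $$ (i, j)"
    by (rule mult_mat_index[OF K ij, symmetric])
  finally show "kronecker (A * A') (B * B') $$ (i, j) = (kronecker A B * kronecker A' B') $$ (i, j)" .
qed (use assms in \<open>auto simp: kronecker_def\<close>)

lemma kronecker_one: "kronecker (1\<^sub>m n) (1\<^sub>m m) = 1\<^sub>m (n * m)"
proof (rule eq_matI)
  fix i j assume "i < dim_row (1\<^sub>m (n * m) :: complex mat)" "j < dim_col (1\<^sub>m (n * m) :: complex mat)"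
  then have ij: "i < n * m" "j < n * m" by auto
  then have m0: "0 < m" by (cases m) auto
  have lt: "i div m < n" "i mod m < m" "j div m < n" "j mod m < m"
    using ij m0 by (simp_all add: less_mult_imp_div_less)
  have "i = j \<longleftrightarrow> i div m = j div m \<and> i mod m = j mod m"
    by (metis div_mult_mod_eq)
  then show "kronecker (1\<^sub>m n) (1\<^sub>m m) $$ (i, j) = 1\<^sub>m (n * m) $$ (i, j)"
    using kronecker_index[OF one_carrier_mat one_carrier_mat ij] lt ij by auto
qed (auto simp: kronecker_def)

lemma mtrace_kronecker:
  assumes A: "A \<in> carrier_mat n n" and B: "B \<in> carrier_mat m m"
  shows "mtrace (kronecker A B) = mtrace A * mtrace B"
proof -
  have "mtrace (kronecker A B) = (\<Sum>l<n * m. kronecker A B $$ (l, l))"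
    using kronecker_carrier[OF A B] by (simp add: mtrace_def)
  also have "\<dots> = (\<Sum>l<n * m. A $$ (l div m, l div m) * B $$ (l mod m, l mod m))"
    by (rule sum.cong[OF refl]) (simp only: kronecker_index[OF A B] lessThan_iff)
  also have "\<dots> = (\<Sum>p<n. \<Sum>q<m. A $$ (p, p) * B $$ (q, q))"
    by (rule sum_div_mod)
  also have "\<dots> = mtrace A * mtrace B" using A B by (simp add: mtrace_def sum_product)
  finally show ?thesis .
qed

context finite_group begin

lemma tensor_rep:
  assumes "is_rep G \<sigma>" "is_rep G \<tau>" shows "is_rep G (tensor_rep \<sigma> \<tau>)"
  unfolding tensor_rep_def
proof (rule repI)
  fix g h assume g: "g \<in> carrier G" and h: "h \<in> carrier G"
  show "kronecker (snd \<sigma> g) (snd \<tau> g) \<in> carrier_mat (fst \<sigma> * fst \<tau>) (fst \<sigma> * fst \<tau>)"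
    by (intro kronecker_carrier rep_carrier assms g)
  show "kronecker (snd \<sigma> (g \<otimes> h)) (snd \<tau> (g \<otimes> h)) = kronecker (snd \<sigma> g) (snd \<tau> g) * kronecker (snd \<sigma> h) (snd \<tau> h)"
    unfolding rep_mult[OF assms(1) g h] rep_mult[OF assms(2) g h]
    by (rule kronecker_mult[OF rep_carrier[OF assms(1) g] rep_carrier[OF assms(1) h] rep_carrier[OF assms(2) g] rep_carrier[OF assms(2) h]])
qed (simp add: rep_one assms kronecker_one)

lemma chr_tensor:
  assumes "is_rep G \<sigma>" "is_rep G \<tau>" "g \<in> carrier G"
  shows "chr (tensor_rep \<sigma> \<tau>) g = chr \<sigma> g * chr \<tau> g"
  unfolding tensor_rep_def snd_conv
  by (rule mtrace_kronecker[OF rep_carrier[OF assms(1,3)] rep_carrier[OF assms(2,3)]])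

text \<open>Both multiplicities are averages of products of three character values, and the
  substitution of \<open>inv g\<close> for \<open>g\<close> turns one average into the other. It
  identifies the transposed McKay matrix with tensoring by the dual representation.\<close>

lemma multiplicity_tensor_dual:
  assumes r: "is_rep G \<rho>" "is_rep G \<rho>'" and dual: "\<And>g. g \<in> carrier G \<Longrightarrow> chr \<rho>' g = chr \<rho> (inv g)"
    and \<sigma>: "irreducible_rep G \<sigma>" and \<tau>: "irreducible_rep G \<tau>"
  shows "rep_multiplicity G \<sigma> (tensor_rep \<rho> \<tau>) = rep_multiplicity G \<tau> (tensor_rep \<rho>' \<sigma>)"
proof -
  note s = irreducible_is_rep[OF \<sigma>] and t = irreducible_is_rep[OF \<tau>]
  have "complex_of_nat (order G) * of_nat (rep_multiplicity G \<sigma> (tensor_rep \<rho> \<tau>)) =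
    (\<Sum>g\<in>carrier G. chr \<rho> g * chr \<tau> g * chr \<sigma> (inv g))"
    unfolding rep_multiplicity_inner[OF \<sigma> tensor_rep[OF r(1) t], symmetric]
    by (rule sum.cong[OF refl]) (simp only: chr_tensor[OF r(1) t])
  also have "\<dots> = (\<Sum>g\<in>carrier G. chr \<rho> (inv g) * chr \<tau> (inv g) * chr \<sigma> (inv (inv g)))"
    by (rule sum_inv[symmetric])
  also have "\<dots> = (\<Sum>g\<in>carrier G. chr (tensor_rep \<rho>' \<sigma>) g * chr \<tau> (inv g))"
    by (rule sum.cong[OF refl]) (simp only: chr_tensor[OF r(2) s] dual inv_inv mult_ac)
  also have "\<dots> = of_nat (order G) * of_nat (rep_multiplicity G \<tau> (tensor_rep \<rho>' \<sigma>))"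
    by (rule rep_multiplicity_inner[OF \<tau> tensor_rep[OF r(2) s]])
  finally show ?thesis using order_pos by simp
qed

end

subsection \<open>Moments of the McKay graph\<close>

text \<open>The vectors $v \mapsto \chi_v(g)$ are common eigenvectors of \<open>\<Delta>\<close> and \<open>\<Delta>\<^sup>*\<close>, and their
  average over \<open>g\<close> is \<open>e\<^sub>1\<close>.\<close>

lemma map_mat_cnj_mult:
  assumes "A \<in> carrier_mat n k" "B \<in> carrier_mat k m"
  shows "map_mat cnj (A * B) = map_mat cnj A * map_mat cnj B"
proof (rule eq_matI)
  have A': "map_mat cnj A \<in> carrier_mat n k" and B': "map_mat cnj B \<in> carrier_mat k m" using assms by simp_all
  fix i j assume "i < dim_row (map_mat cnj A * map_mat cnj B)" "j < dim_col (map_mat cnj A * map_mat cnj B)"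
  then have ij: "i < n" "j < m" using assms by auto
  have "map_mat cnj (A * B) $$ (i, j) = cnj ((A * B) $$ (i, j))" using ij assms by simp
  also have "\<dots> = (\<Sum>l<k. map_mat cnj A $$ (i, l) * map_mat cnj B $$ (l, j))"
    unfolding mult_mat_index[OF assms ij] using ij assms by simp
  also have "\<dots> = (map_mat cnj A * map_mat cnj B) $$ (i, j)"
    by (rule mult_mat_index[OF A' B' ij, symmetric])
  finally show "map_mat cnj (A * B) $$ (i, j) = (map_mat cnj A * map_mat cnj B) $$ (i, j)" .
qed (use assms in auto)

lemma mtrace_map_cnj: "A \<in> carrier_mat n n \<Longrightarrow> mtrace (map_mat cnj A) = cnj (mtrace A)"
  by (simp add: mtrace_def)

lemma mtrace_adjoint: "A \<in> carrier_mat n n \<Longrightarrow> mtrace (mat_adjoint A) = cnj (mtrace A)"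
  by (auto simp: mtrace_def mat_adjoint_def mat_of_rows_def intro!: sum.cong)

locale SU3_finite_subgroup =
  fixes \<Gamma> :: "complex mat set"
  assumes SU3_group: "group (SU3\<lparr>carrier := \<Gamma>\<rparr>)" and SU3_sub: "\<Gamma> \<subseteq> carrier SU3" and finite_\<Gamma>: "finite \<Gamma>"
begin

abbreviation "\<Gamma>G \<equiv> SU3\<lparr>carrier := \<Gamma>\<rparr>"

sublocale finite_group \<Gamma>G
  by (intro finite_group.intro finite_group_axioms.intro SU3_group) (simp add: finite_\<Gamma>)

lemma \<Gamma>_carrier: "g \<in> \<Gamma> \<Longrightarrow> g \<in> carrier_mat 3 3"
  using SU3_sub by (auto simp: SU3_def)

lemma inclusion_rep: "is_rep \<Gamma>G inclusion_rep"
  unfolding inclusion_rep_def by (rule repI) (use \<Gamma>_carrier in \<open>auto simp: SU3_def\<close>)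

text \<open>The dual of the inclusion, because inverses in \<open>SU(3)\<close> are adjoints and the
  trace ignores the transposition.\<close>

definition cnj_rep :: "complex mat rep" where "cnj_rep = (3, map_mat cnj)"

lemma cnj_rep: "is_rep \<Gamma>G cnj_rep"
  unfolding cnj_rep_def
proof (rule repI)
  fix g h assume "g \<in> carrier \<Gamma>G" "h \<in> carrier \<Gamma>G"
  then have gh: "g \<in> carrier_mat 3 3" "h \<in> carrier_mat 3 3" using \<Gamma>_carrier by simp_all
  show "map_mat cnj g \<in> carrier_mat 3 3" using gh by simp
  show "map_mat cnj (g \<otimes>\<^bsub>\<Gamma>G\<^esub> h) = map_mat cnj g * map_mat cnj h"
    using map_mat_cnj_mult[OF gh] by (simp add: SU3_def)
qed (auto simp: SU3_def)

lemma inv_adjoint: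
  assumes g: "g \<in> \<Gamma>" shows "inv\<^bsub>\<Gamma>G\<^esub> g = mat_adjoint g"
proof -
  have gc: "g \<in> carrier_mat 3 3" by (rule \<Gamma>_carrier[OF g])
  have ac: "mat_adjoint g \<in> carrier_mat 3 3" using gc by (auto simp: mat_adjoint_def)
  have u: "g * mat_adjoint g = 1\<^sub>m 3" using g SU3_sub by (auto simp: SU3_def)
  have i: "inv\<^bsub>\<Gamma>G\<^esub> g \<in> \<Gamma>" using inv_closed[of g] g by simp
  have "inv\<^bsub>\<Gamma>G\<^esub> g * g = 1\<^sub>m 3" using l_inv[of g] g by (simp add: SU3_def)
  then have "mat_adjoint g = (inv\<^bsub>\<Gamma>G\<^esub> g * g) * mat_adjoint g" using ac by simp
  also have "\<dots> = inv\<^bsub>\<Gamma>G\<^esub> g * (g * mat_adjoint g)" by (rule assoc_mult_mat[OF \<Gamma>_carrier[OF i] gc ac])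
  also have "\<dots> = inv\<^bsub>\<Gamma>G\<^esub> g" unfolding u using \<Gamma>_carrier[OF i] by simp
  finally show ?thesis by simp
qed

lemma cnj_rep_dual:
  assumes "g \<in> carrier \<Gamma>G" shows "chr cnj_rep g = chr inclusion_rep (inv\<^bsub>\<Gamma>G\<^esub> g)"
proof -
  have g: "g \<in> \<Gamma>" using assms by simp
  show ?thesis unfolding cnj_rep_def inclusion_rep_def snd_conv inv_adjoint[OF g]
    by (simp only: mtrace_map_cnj[OF \<Gamma>_carrier[OF g]] mtrace_adjoint[OF \<Gamma>_carrier[OF g]])
qed

lemma McKay_vertices_eq: "McKay_vertices \<Gamma> = irr_classes"
  by (simp add: McKay_vertices_def irr_classes_def iso_rel_def irr_rel_def)

lemma McKay_adj_eq: "McKay_adj \<Gamma> v w = rep_multiplicity \<Gamma>G (class_rep w) (tensor_rep inclusion_rep (class_rep v))"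
  by (simp add: McKay_adj_def class_rep_def)

lemma McKay_adj_eigen:
  assumes v: "v \<in> irr_classes" and g: "g \<in> \<Gamma>"
  shows "(\<Sum>w\<in>irr_classes. of_nat (McKay_adj \<Gamma> v w) * chr (class_rep w) g) = mtrace g * chr (class_rep v) g"
proof -
  have g': "g \<in> carrier \<Gamma>G" using g by simp
  note r = irreducible_is_rep[OF class_rep_irreducible[OF v]]
  show ?thesis unfolding McKay_adj_eq
    by (simp only: sum_multiplicity_chr[OF tensor_rep[OF inclusion_rep r] g'] chr_tensor[OF inclusion_rep r g'])
      (simp add: inclusion_rep_def)
qed

lemma McKay_adj_eigen_adjoint:
  assumes v: "v \<in> irr_classes" and g: "g \<in> \<Gamma>"
  shows "(\<Sum>w\<in>irr_classes. of_nat (McKay_adj \<Gamma> w v) * chr (class_rep w) g) = cnj (mtrace g) * chr (class_rep v) g"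
proof -
  have g': "g \<in> carrier \<Gamma>G" using g by simp
  note r = irreducible_is_rep[OF class_rep_irreducible[OF v]]
  have "(\<Sum>w\<in>irr_classes. of_nat (McKay_adj \<Gamma> w v) * chr (class_rep w) g) =
    (\<Sum>w\<in>irr_classes. of_nat (rep_multiplicity \<Gamma>G (class_rep w) (tensor_rep cnj_rep (class_rep v))) * chr (class_rep w) g)"
    unfolding McKay_adj_eq
    by (rule sum.cong[OF refl])
      (simp only: multiplicity_tensor_dual[OF inclusion_rep cnj_rep cnj_rep_dual class_rep_irreducible[OF v] class_rep_irreducible])
  also have "\<dots> = cnj (mtrace g) * chr (class_rep v) g"
    by (simp only: sum_multiplicity_chr[OF tensor_rep[OF cnj_rep r] g'] chr_tensor[OF cnj_rep r g'])
      (simp add: cnj_rep_def mtrace_map_cnj[OF \<Gamma>_carrier[OF g]])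
  finally show ?thesis .
qed

text \<open>One application of a matrix to a weighted sum of eigenvectors, seen at one vertex:
  \<open>a\<close> is the row of the matrix, \<open>b g\<close> the coordinate of the eigenvector
  there, \<open>c g\<close> its eigenvalue. The weight \<open>k g\<close> is multiplied by the
  eigenvalue, which drives both power inductions below.\<close>

lemma sum_eigenvectors:
  assumes eig: "\<And>g. g \<in> \<Gamma> \<Longrightarrow> (\<Sum>w\<in>irr_classes. a w * chr (class_rep w) g) = c g * b g"
    and x: "\<And>w. w \<in> irr_classes \<Longrightarrow> x w = (\<Sum>g\<in>\<Gamma>. k g * chr (class_rep w) g) / N"
  shows "(\<Sum>w\<in>irr_classes. a w * x w) = (\<Sum>g\<in>\<Gamma>. k g * c g * b g) / N"
proof -
  have "(\<Sum>w\<in>irr_classes. a w * x w) = (\<Sum>w\<in>irr_classes. \<Sum>g\<in>\<Gamma>. k g * (a w * chr (class_rep w) g) / N)"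
    by (rule sum.cong[OF refl]) (simp add: x sum_distrib_left sum_divide_distrib mult_ac)
  also have "\<dots> = (\<Sum>g\<in>\<Gamma>. \<Sum>w\<in>irr_classes. k g * (a w * chr (class_rep w) g) / N)"
    by (rule sum.swap)
  also have "\<dots> = (\<Sum>g\<in>\<Gamma>. k g * (\<Sum>w\<in>irr_classes. a w * chr (class_rep w) g) / N)"
    by (simp only: sum_distrib_left sum_divide_distrib)
  also have "\<dots> = (\<Sum>g\<in>\<Gamma>. k g * c g * b g) / N"
    by (simp add: eig sum_divide_distrib mult.assoc)
  finally show ?thesis .
qed

text \<open>Row orthogonality against the trivial character, read as an expansion of the start
  vector into the eigenvectors indexed by \<open>g\<close>, all with the same weight.\<close>

lemma e_trivial_eq:
  assumes v: "v \<in> irr_classes"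
  shows "e_trivial \<Gamma> v = (\<Sum>g\<in>\<Gamma>. chr (class_rep v) g) / of_nat (card \<Gamma>)"
proof -
  have t: "irreducible_rep \<Gamma>G trivial_rep" by (rule trivial_irreducible)
  note s = class_rep_irreducible[OF v]
  have "(\<Sum>g\<in>carrier \<Gamma>G. chr (class_rep v) g * chr (trivial_rep :: complex mat rep) (inv\<^bsub>\<Gamma>G\<^esub> g)) =
     (if rep_iso \<Gamma>G trivial_rep (class_rep v) then of_nat (order \<Gamma>G) else 0)"
    by (rule chr_product_sum[OF t s])
  then have "(\<Sum>g\<in>\<Gamma>. chr (class_rep v) g) = (if rep_iso \<Gamma>G trivial_rep (class_rep v) then of_nat (card \<Gamma>) else 0)"
    by (simp add: chr_trivial order_def)
  also have "rep_iso \<Gamma>G trivial_rep (class_rep v) \<longleftrightarrow> v = iso_rel \<Gamma> `` {trivial_rep}"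
  proof -
    have R: "iso_rel \<Gamma> = irr_rel" by (simp add: iso_rel_def irr_rel_def)
    have "rep_iso \<Gamma>G trivial_rep (class_rep v) \<longleftrightarrow> rep_iso \<Gamma>G (class_rep v) trivial_rep"
      by (rule iffI[OF rep_iso_sym[OF irreducible_is_rep[OF t] irreducible_is_rep[OF s]]
            rep_iso_sym[OF irreducible_is_rep[OF s] irreducible_is_rep[OF t]]])
    then show ?thesis unfolding R class_rep_iso_iff[OF t v] .
  qed
  finally show ?thesis using order_pos by (simp add: e_trivial_def order_def)
qed

lemma McKay_adjoint_power:
  "v \<in> irr_classes \<Longrightarrow> (McKay_op_adjoint \<Gamma> ^^ n) (e_trivial \<Gamma>) v =
    (\<Sum>g\<in>\<Gamma>. cnj (mtrace g) ^ n * chr (class_rep v) g) / of_nat (card \<Gamma>)"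
proof (induction n arbitrary: v)
  case 0
  then show ?case by (simp add: e_trivial_eq)
next
  case (Suc n)
  have "(McKay_op_adjoint \<Gamma> ^^ Suc n) (e_trivial \<Gamma>) v =
    (\<Sum>w\<in>irr_classes. of_nat (McKay_adj \<Gamma> w v) * (McKay_op_adjoint \<Gamma> ^^ n) (e_trivial \<Gamma>) w)"
    by (simp add: McKay_op_adjoint_def apply_matrix_def McKay_vertices_eq)
  also have "\<dots> = (\<Sum>g\<in>\<Gamma>. cnj (mtrace g) ^ n * cnj (mtrace g) * chr (class_rep v) g) / of_nat (card \<Gamma>)"
    by (rule sum_eigenvectors[OF McKay_adj_eigen_adjoint[OF Suc.prems] Suc.IH])
  finally show ?case by (simp add: mult_ac)
qed

lemma McKay_power:
  "v \<in> irr_classes \<Longrightarrow> (McKay_op \<Gamma> ^^ m) ((McKay_op_adjoint \<Gamma> ^^ n) (e_trivial \<Gamma>)) v =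
    (\<Sum>g\<in>\<Gamma>. mtrace g ^ m * cnj (mtrace g) ^ n * chr (class_rep v) g) / of_nat (card \<Gamma>)"
proof (induction m arbitrary: v)
  case 0
  then show ?case by (simp add: McKay_adjoint_power)
next
  case (Suc m)
  have "(McKay_op \<Gamma> ^^ Suc m) ((McKay_op_adjoint \<Gamma> ^^ n) (e_trivial \<Gamma>)) v =
    (\<Sum>w\<in>irr_classes. of_nat (McKay_adj \<Gamma> v w) * (McKay_op \<Gamma> ^^ m) ((McKay_op_adjoint \<Gamma> ^^ n) (e_trivial \<Gamma>)) w)"
    by (simp add: McKay_op_def apply_matrix_def McKay_vertices_eq)
  also have "\<dots> = (\<Sum>g\<in>\<Gamma>. mtrace g ^ m * cnj (mtrace g) ^ n * mtrace g * chr (class_rep v) g) / of_nat (card \<Gamma>)"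
    by (rule sum_eigenvectors[OF McKay_adj_eigen[OF Suc.prems] Suc.IH])
  finally show ?case by (simp add: mult_ac)
qed

text \<open>The inner product with \<open>e_trivial \<Gamma>\<close> selects the coordinate at the
  trivial class, where the character factor is 1.\<close>

lemma McKay_moment:
  "vertex_inner \<Gamma> ((McKay_op \<Gamma> ^^ m) ((McKay_op_adjoint \<Gamma> ^^ n) (e_trivial \<Gamma>))) (e_trivial \<Gamma>) =
    (\<Sum>g\<in>\<Gamma>. mtrace g ^ m * cnj (mtrace g) ^ n) / of_nat (card \<Gamma>)"
proof -
  have t: "irreducible_rep \<Gamma>G trivial_rep" by (rule trivial_irreducible)
  let ?v = "irr_rel `` {trivial_rep}"
  have R: "iso_rel \<Gamma> = irr_rel" by (simp add: iso_rel_def irr_rel_def)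
  note c = class_of_irreducible[OF t]
  let ?y = "(McKay_op \<Gamma> ^^ m) ((McKay_op_adjoint \<Gamma> ^^ n) (e_trivial \<Gamma>))"
  have "vertex_inner \<Gamma> ?y (e_trivial \<Gamma>) = (\<Sum>v\<in>irr_classes. if v = ?v then ?y v else 0)"
    unfolding vertex_inner_def McKay_vertices_eq e_trivial_def R by (rule sum.cong) simp_all
  also have "\<dots> = ?y ?v" using c(1) finite_irr_classes by (simp add: sum.delta)
  also have "\<dots> = (\<Sum>g\<in>\<Gamma>. mtrace g ^ m * cnj (mtrace g) ^ n * chr (class_rep ?v) g) / of_nat (card \<Gamma>)"
    by (rule McKay_power[OF c(1)])
  also have "(\<Sum>g\<in>\<Gamma>. mtrace g ^ m * cnj (mtrace g) ^ n * chr (class_rep ?v) g) =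
    (\<Sum>g\<in>\<Gamma>. mtrace g ^ m * cnj (mtrace g) ^ n)"
  proof (rule sum.cong[OF refl])
    fix g assume "g \<in> \<Gamma>"
    then have g: "g \<in> carrier \<Gamma>G" by simp
    have "chr (class_rep ?v) g = 1"
      using rep_iso_chr[OF irreducible_is_rep[OF class_rep_irreducible[OF c(1)]] irreducible_is_rep[OF t] c(2) g]
      unfolding chr_trivial .
    then show "mtrace g ^ m * cnj (mtrace g) ^ n * chr (class_rep ?v) g = mtrace g ^ m * cnj (mtrace g) ^ n" by simp
  qed
  finally show ?thesis .
qed

end

section \<open>The alternating group on five letters\<close>

text \<open>Permutations are coded as value tables over a five-element datatype, so that the facts
  needed about \<open>A\<^sub>5\<close> can be decided by evaluation.\<close>

datatype five = E1 | E2 | E3 | E4 | E5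

datatype perm5 = P5 five five five five five

fun app5 :: "perm5 \<Rightarrow> five \<Rightarrow> five" where
  "app5 (P5 a b c d e) E1 = a"
| "app5 (P5 a b c d e) E2 = b"
| "app5 (P5 a b c d e) E3 = c"
| "app5 (P5 a b c d e) E4 = d"
| "app5 (P5 a b c d e) E5 = e"

definition comp5 :: "perm5 \<Rightarrow> perm5 \<Rightarrow> perm5" where
  "comp5 p q = P5 (app5 p (app5 q E1)) (app5 p (app5 q E2)) (app5 p (app5 q E3)) (app5 p (app5 q E4)) (app5 p (app5 q E5))"

definition id5 :: perm5 where "id5 = P5 E1 E2 E3 E4 E5"

definition fives :: "five list" where "fives = [E1, E2, E3, E4, E5]"

definition all5 :: "perm5 list" where
  "all5 = (concat (map (\<lambda>a. let A = filter (\<lambda>x. x \<noteq> a) fives in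
     concat (map (\<lambda>b. let B = filter (\<lambda>x. x \<noteq> b) A in
     concat (map (\<lambda>c. let C = filter (\<lambda>x. x \<noteq> c) B in
     concat (map (\<lambda>d. map (\<lambda>e. P5 a b c d e) (filter (\<lambda>x. x \<noteq> d) C)) C)) B)) A)) fives))"

text \<open>Every even permutation of five letters is a square.\<close>

definition squares5 :: "perm5 list" where
  "squares5 = remdups (map (\<lambda>p. comp5 p p) all5)"

text \<open>The counts are the involutions and the elements of order 3; the orders of all elements
  divide 2, 3 or 5. In the last clause \<open>p x p = x\<close> says that \<open>x\<close>
  conjugates \<open>p\<close> to its inverse, expressed by products alone so that it transfers along
  a homomorphism directly.\<close>

definition squares5_props :: "perm5 list \<Rightarrow> bool" where
  "squares5_props S \<longleftrightarrow> length S = 60 \<and>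
     length (filter (\<lambda>p. p \<noteq> id5 \<and> comp5 p p = id5) S) = 15 \<and>
     length (filter (\<lambda>p. p \<noteq> id5 \<and> comp5 p (comp5 p p) = id5) S) = 20 \<and>
     list_all (\<lambda>p. p = id5 \<or> comp5 p p = id5 \<or> comp5 p (comp5 p p) = id5 \<or>
       comp5 p (comp5 p (comp5 p (comp5 p p))) = id5) S \<and>
     list_all (\<lambda>p. list_ex (\<lambda>x. comp5 p (comp5 x p) = x) S) S"

lemma squares5_props: "squares5_props squares5"
  by code_simp

lemma length_all5: "distinct all5" "length all5 = 120"
  by code_simp+

text \<open>Every number outside 1 to 4 is sent to \<open>E5\<close>, so injectivity only holds on
  \<open>{1..5}\<close>.\<close>

definition five_of :: "nat \<Rightarrow> five" where
  "five_of i = (if i = 1 then E1 else if i = 2 then E2 else if i = 3 then E3 else if i = 4 then E4 else E5)"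

lemma five_of_simps [simp]:
  "five_of (Suc 0) = E1" "five_of 1 = E1" "five_of 2 = E2" "five_of 3 = E3" "five_of 4 = E4" "five_of 5 = E5"
  by (simp_all add: five_of_def)

definition enc5 :: "(nat \<Rightarrow> nat) \<Rightarrow> perm5" where
  "enc5 p = P5 (five_of (p 1)) (five_of (p 2)) (five_of (p 3)) (five_of (p 4)) (five_of (p 5))"

lemma atLeastAtMost_1_5: "{1..5::nat} = {1, 2, 3, 4, 5}"
  by auto

lemma five_of_inj: "i \<in> {1..5} \<Longrightarrow> j \<in> {1..5} \<Longrightarrow> five_of i = five_of j \<Longrightarrow> i = j"
  unfolding atLeastAtMost_1_5 five_of_def by (auto split: if_splits)

lemma app5_enc5: "i \<in> {1..5} \<Longrightarrow> app5 (enc5 p) (five_of i) = five_of (p i)"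
  unfolding atLeastAtMost_1_5 enc5_def by (elim insertE emptyE) simp_all

lemma enc5_comp:
  assumes "q permutes {1..5}"
  shows "enc5 (p \<circ> q) = comp5 (enc5 p) (enc5 q)"
proof -
  have q: "q i \<in> {1..5}" if "i \<in> {1..5}" for i using permutes_in_image[OF assms] that by simp
  have "app5 (enc5 p) (app5 (enc5 q) (five_of i)) = five_of (p (q i))" if "i \<in> {1..5}" for i
    by (simp only: app5_enc5[OF that] app5_enc5[OF q[OF that]])
  from this[of 1] this[of 2] this[of 3] this[of 4] this[of 5] show ?thesis
    by (simp add: comp5_def enc5_def[of "p \<circ> q"])
qed

lemma enc5_id: "enc5 id = id5"
  by (simp add: enc5_def id5_def five_of_def)

lemma enc5_inj: "inj_on enc5 {p. p permutes {1..5}}"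
proof (rule inj_onI)
  fix p q :: "nat \<Rightarrow> nat" assume p: "p \<in> {p. p permutes {1..5}}" and q: "q \<in> {p. p permutes {1..5}}" and e: "enc5 p = enc5 q"
  show "p = q"
  proof
    fix i
    show "p i = q i"
    proof (cases "i \<in> {1..5}")
      case True
      have "five_of (p i) = five_of (q i)" using app5_enc5[OF True, of p] app5_enc5[OF True, of q] e by simp
      moreover have "p i \<in> {1..5}" "q i \<in> {1..5}"
        using p q permutes_in_image[of p "{1..5}" i] permutes_in_image[of q "{1..5}" i] True by simp_all
      ultimately show ?thesis by (intro five_of_inj)
    next
      case False
      then show ?thesis using p q by (simp add: permutes_not_in)
    qed
  qed
qed

lemma in_all5:
  assumes "b \<noteq> a" "c \<noteq> a" "c \<noteq> b" "d \<noteq> a" "d \<noteq> b" "d \<noteq> c" "e \<noteq> a" "e \<noteq> b" "e \<noteq> c" "e \<noteq> d"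
  shows "P5 a b c d e \<in> set all5"
proof -
  have "x \<in> set fives" for x by (cases x) (simp_all add: fives_def)
  then have F: "set fives = UNIV" by blast
  show ?thesis
    using assms by (simp add: all5_def Let_def F image_iff)
qed

lemma enc5_all5: "p permutes {1..5} \<Longrightarrow> enc5 p \<in> set all5"
proof -
  assume p: "p permutes {1..5}"
  have ne: "five_of (p i) \<noteq> five_of (p j)" if "i \<in> {1..5}" "j \<in> {1..5}" "i \<noteq> j" for i j
  proof
    assume "five_of (p i) = five_of (p j)"
    then have "p i = p j" using five_of_inj permutes_in_image[OF p] that by simp
    then show False using permutes_inj[OF p] that by (simp add: inj_eq)
  qed
  show ?thesis unfolding enc5_def by (intro in_all5 ne) simp_all
qed

text \<open>The image lies in the list, and both have \<open>5! = 120\<close> elements.\<close>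

lemma enc5_image_sym: "enc5 ` {p. p permutes {1..5}} = set all5"
proof (rule card_subset_eq)
  show "enc5 ` {p. p permutes {1..5}} \<subseteq> set all5" using enc5_all5 by auto
  have "card (set all5) = 120" using length_all5 by (simp add: distinct_card)
  moreover have "card (enc5 ` {p. p permutes {1..5}}) = 120"
    using card_image[OF enc5_inj] card_permutations[of "{1..5::nat}" 5] by (simp add: fact_numeral)
  ultimately show "card (enc5 ` {p. p permutes {1..5}}) = card (set all5)" by simp
qed simp

lemma set_squares5: "set squares5 = (\<lambda>p. comp5 p p) ` set all5"
  by (simp add: squares5_def)

text \<open>Squares are even, which gives one inclusion, and both sides have 60 elements. Parity is
  thus only ever used for squares.\<close>

lemma enc5_image_alt: "enc5 ` carrier (alt_group 5) = set squares5"
proof (rule card_subset_eq[symmetric])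
  show "set squares5 \<subseteq> enc5 ` carrier (alt_group 5)"
  proof
    fix l assume "l \<in> set squares5"
    then obtain p where p: "p permutes {1..5::nat}" and l: "l = comp5 (enc5 p) (enc5 p)"
      unfolding set_squares5 enc5_image_sym[symmetric] by auto
    have perm: "permutation p" using p permutation_permutes by blast
    have "evenperm (p \<circ> p)" by (simp add: evenperm_comp[OF perm perm])
    then have "p \<circ> p \<in> carrier (alt_group 5)" using permutes_compose[OF p p] by (simp add: alt_group_carrier)
    then show "l \<in> enc5 ` carrier (alt_group 5)" unfolding l enc5_comp[OF p, symmetric] by (rule imageI)
  qed
  have sub: "carrier (alt_group 5) \<subseteq> {p. p permutes {1..5}}" by (auto simp: alt_group_carrier)
  have "card (set squares5) = 60" using squares5_props by (simp add: squares5_props_def squares5_def length_remdups_card_conv)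
  moreover have "card (enc5 ` carrier (alt_group 5)) = 60"
    using card_image[OF inj_on_subset[OF enc5_inj sub]] alt_group_card_carrier[of 5] by (simp add: fact_numeral)
  ultimately show "card (set squares5) = card (enc5 ` carrier (alt_group 5))" by simp
  show "finite (enc5 ` carrier (alt_group 5))"
    using finite_subset[OF sub finite_permutations] by simp
qed

section \<open>Traces in \<open>SU(3)\<close>\<close>

lemma mat_adjoint_index:
  assumes "A \<in> carrier_mat n m" "i < m" "j < n"
  shows "mat_adjoint A $$ (i, j) = cnj ((A :: complex mat) $$ (j, i))"
  using assms by (auto simp: mat_adjoint_def mat_of_rows_def)

lemma mat_adjoint_carrier: "A \<in> carrier_mat n m \<Longrightarrow> mat_adjoint (A :: complex mat) \<in> carrier_mat m n"
  by (auto simp: mat_adjoint_def)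

lemma mat_adjoint_mult:
  fixes A B :: "complex mat"
  assumes "A \<in> carrier_mat n k" "B \<in> carrier_mat k m"
  shows "mat_adjoint (A * B) = mat_adjoint B * mat_adjoint A"
proof (rule eq_matI)
  note AB = mult_carrier_mat[OF assms]
  note c = mat_adjoint_carrier[OF assms(1)] mat_adjoint_carrier[OF assms(2)]
  fix i j assume "i < dim_row (mat_adjoint B * mat_adjoint A)" "j < dim_col (mat_adjoint B * mat_adjoint A)"
  then have ij: "i < m" "j < n" using c by auto
  have "mat_adjoint (A * B) $$ (i, j) = cnj ((A * B) $$ (j, i))" by (rule mat_adjoint_index[OF AB ij])
  also have "\<dots> = (\<Sum>l<k. cnj (A $$ (j, l)) * cnj (B $$ (l, i)))"
    by (simp only: mult_mat_index[OF assms ij(2,1)] cnj_sum complex_cnj_mult)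
  also have "\<dots> = (\<Sum>l<k. mat_adjoint B $$ (i, l) * mat_adjoint A $$ (l, j))"
    by (rule sum.cong[OF refl])
      (simp only: mat_adjoint_index[OF assms(1) _ ij(2)] mat_adjoint_index[OF assms(2) ij(1)] lessThan_iff mult.commute)
  also have "\<dots> = (mat_adjoint B * mat_adjoint A) $$ (i, j)"
    by (rule mult_mat_index[OF c(2,1) ij, symmetric])
  finally show "mat_adjoint (A * B) $$ (i, j) = (mat_adjoint B * mat_adjoint A) $$ (i, j)" .
qed (use mat_adjoint_carrier[OF mult_carrier_mat[OF assms]] mat_adjoint_carrier[OF assms(1)] mat_adjoint_carrier[OF assms(2)] in auto)

lemma mat_adjoint_adjoint:
  assumes "(A :: complex mat) \<in> carrier_mat n m" shows "mat_adjoint (mat_adjoint A) = A"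
proof (rule eq_matI)
  fix i j assume "i < dim_row A" "j < dim_col A"
  then have ij: "i < n" "j < m" using assms by auto
  show "mat_adjoint (mat_adjoint A) $$ (i, j) = A $$ (i, j)"
    by (simp only: mat_adjoint_index[OF mat_adjoint_carrier[OF assms] ij] mat_adjoint_index[OF assms ij(2,1)] complex_cnj_cnj)
qed (use mat_adjoint_carrier[OF mat_adjoint_carrier[OF assms]] assms in auto)

lemma SU3_simps: "mult SU3 = (*)" "one SU3 = 1\<^sub>m 3"
  by (simp_all add: SU3_def)

lemma SU3_iff: "U \<in> carrier SU3 \<longleftrightarrow> U \<in> carrier_mat 3 3 \<and> U * mat_adjoint U = 1\<^sub>m 3 \<and> Determinant.det U = 1"
  by (simp add: SU3_def)

lemma group_SU3: "group SU3"
proof (rule groupI)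
  have c: "U \<in> carrier SU3 \<Longrightarrow> U \<in> carrier_mat 3 3" for U by (simp add: SU3_iff)
  have a1: "mat_adjoint (1\<^sub>m 3 :: complex mat) = 1\<^sub>m 3"
    by (rule eq_matI) (use mat_adjoint_carrier[of "1\<^sub>m 3" 3 3] in \<open>auto simp: mat_adjoint_index[of _ 3 3]\<close>)
  show "\<one>\<^bsub>SU3\<^esub> \<in> carrier SU3" by (simp add: SU3_iff SU3_simps a1)
  show "\<one>\<^bsub>SU3\<^esub> \<otimes>\<^bsub>SU3\<^esub> U = U" if "U \<in> carrier SU3" for U
    using c[OF that] by (simp add: SU3_simps)
  show "U \<otimes>\<^bsub>SU3\<^esub> V \<otimes>\<^bsub>SU3\<^esub> W = U \<otimes>\<^bsub>SU3\<^esub> (V \<otimes>\<^bsub>SU3\<^esub> W)"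
    if "U \<in> carrier SU3" "V \<in> carrier SU3" "W \<in> carrier SU3" for U V W
    unfolding SU3_simps by (rule assoc_mult_mat[OF c c c]; rule that)
  show "U \<otimes>\<^bsub>SU3\<^esub> V \<in> carrier SU3" if U: "U \<in> carrier SU3" and V: "V \<in> carrier SU3" for U V
    unfolding SU3_simps SU3_iff
  proof (intro conjI)
    note a = mat_adjoint_carrier[OF c[OF U]] mat_adjoint_carrier[OF c[OF V]]
    note m = assoc_mult_mat[of _ 3 3 _ 3 _ 3]
    show "U * V \<in> carrier_mat 3 3" by (rule mult_carrier_mat[OF c[OF U] c[OF V]])
    have "U * V * mat_adjoint (U * V) = U * (V * mat_adjoint V) * mat_adjoint U"
      unfolding mat_adjoint_mult[OF c[OF U] c[OF V]]
      by (simp only: m c[OF U] c[OF V] a mult_carrier_mat[of _ 3 3 _ 3])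
    also have "\<dots> = 1\<^sub>m 3"
      using U V c[OF U] unfolding SU3_iff by (simp add: right_mult_one_mat[of _ 3 3])
    finally show "U * V * mat_adjoint (U * V) = 1\<^sub>m 3" .
    show "Determinant.det (U * V) = 1" using U V unfolding det_mult[OF c[OF U] c[OF V]] SU3_iff by simp
  qed
  show "\<exists>V\<in>carrier SU3. V \<otimes>\<^bsub>SU3\<^esub> U = \<one>\<^bsub>SU3\<^esub>" if U: "U \<in> carrier SU3" for U
  proof (rule bexI[of _ "mat_adjoint U"])
    note a = mat_adjoint_carrier[OF c[OF U]]
    have u: "U * mat_adjoint U = 1\<^sub>m 3" "Determinant.det U = 1" using U by (simp_all add: SU3_iff)
    have l: "mat_adjoint U * U = 1\<^sub>m 3" by (rule mat_mult_left_right_inverse[OF c[OF U] a u(1)])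
    then show "mat_adjoint U \<otimes>\<^bsub>SU3\<^esub> U = \<one>\<^bsub>SU3\<^esub>" by (simp add: SU3_simps)
    have "Determinant.det (mat_adjoint U) = 1"
      using det_mult[OF a c[OF U]] unfolding l u(2) by simp
    then show "mat_adjoint U \<in> carrier SU3" unfolding SU3_iff mat_adjoint_adjoint[OF c[OF U]] using a l by simp
  qed
qed

section \<open>Determinants, inverses and power sums for 3 by 3 matrices\<close>

lemma less_3_cases: "i < 3 \<Longrightarrow> i = 0 \<or> i = 1 \<or> i = (2::nat)"
  by auto

lemma sum_less_3: "(\<Sum>i<3. f i) = f 0 + f 1 + f (2::nat)"
  by (simp add: eval_nat_numeral)

lemma mtrace_3: "A \<in> carrier_mat 3 3 \<Longrightarrow> mtrace A = A $$ (0, 0) + A $$ (1, 1) + A $$ (2, 2)"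
  by (simp add: mtrace_def sum_less_3)

lemma det_2x2:
  assumes A: "(A :: complex mat) \<in> carrier_mat 2 2"
  shows "Determinant.det A = A $$ (0, 0) * A $$ (1, 1) - A $$ (0, 1) * A $$ (1, 0)"
proof -
  have "Determinant.det A = (\<Sum>j<2. A $$ (0, j) * cofactor A 0 j)" by (rule laplace_expansion_row[OF A]) simp
  moreover have "Determinant.det (mat_delete A 0 0) = A $$ (1, 1)" "Determinant.det (mat_delete A 0 1) = A $$ (1, 0)"
    using A by (subst det_single; auto simp: mat_delete_def)+
  ultimately show ?thesis by (simp add: cofactor_def eval_nat_numeral)
qed

text \<open>The first row of cofactors feeds the determinant, the diagonal ones feed the trace of
  the adjugate.\<close>

lemma cofactor_3x3:
  assumes A: "(A :: complex mat) \<in> carrier_mat 3 3"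
  shows "cofactor A 0 0 = A $$ (1, 1) * A $$ (2, 2) - A $$ (1, 2) * A $$ (2, 1)"
    "cofactor A 0 1 = - (A $$ (1, 0) * A $$ (2, 2) - A $$ (1, 2) * A $$ (2, 0))"
    "cofactor A 0 2 = A $$ (1, 0) * A $$ (2, 1) - A $$ (1, 1) * A $$ (2, 0)"
    "cofactor A 1 1 = A $$ (0, 0) * A $$ (2, 2) - A $$ (0, 2) * A $$ (2, 0)"
    "cofactor A 2 2 = A $$ (0, 0) * A $$ (1, 1) - A $$ (0, 1) * A $$ (1, 0)"
proof -
  have d: "mat_delete A i j \<in> carrier_mat 2 2" for i j using A by (auto simp: mat_delete_def)
  have m: "mat_delete A i j $$ (k, l) = A $$ (if k < i then k else Suc k, if l < j then l else Suc l)" if "k < 2" "l < 2" for i j k l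
    using A that by (auto simp: mat_delete_def)
  show "cofactor A 0 0 = A $$ (1, 1) * A $$ (2, 2) - A $$ (1, 2) * A $$ (2, 1)"
    "cofactor A 0 1 = - (A $$ (1, 0) * A $$ (2, 2) - A $$ (1, 2) * A $$ (2, 0))"
    "cofactor A 0 2 = A $$ (1, 0) * A $$ (2, 1) - A $$ (1, 1) * A $$ (2, 0)"
    "cofactor A 1 1 = A $$ (0, 0) * A $$ (2, 2) - A $$ (0, 2) * A $$ (2, 0)"
    "cofactor A 2 2 = A $$ (0, 0) * A $$ (1, 1) - A $$ (0, 1) * A $$ (1, 0)"
    unfolding cofactor_def det_2x2[OF d] by (simp_all add: m eval_nat_numeral)
qed

lemma det_3x3:
  assumes A: "(A :: complex mat) \<in> carrier_mat 3 3"
  shows "Determinant.det A = A $$ (0, 0) * (A $$ (1, 1) * A $$ (2, 2) - A $$ (1, 2) * A $$ (2, 1))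
    - A $$ (0, 1) * (A $$ (1, 0) * A $$ (2, 2) - A $$ (1, 2) * A $$ (2, 0))
    + A $$ (0, 2) * (A $$ (1, 0) * A $$ (2, 1) - A $$ (1, 1) * A $$ (2, 0))"
proof -
  have "Determinant.det A = (\<Sum>j<3. A $$ (0, j) * cofactor A 0 j)" by (rule laplace_expansion_row[OF A]) simp
  then show ?thesis by (simp only: sum_less_3 cofactor_3x3[OF A]) (simp add: algebra_simps)
qed

text \<open>With determinant one the inverse is the adjugate, so its trace is the sum of the
  principal 2 by 2 minors, the second elementary symmetric function of the eigenvalues.\<close>

lemma mtrace_inverse_3x3:
  assumes A: "(A :: complex mat) \<in> carrier_mat 3 3" and B: "B \<in> carrier_mat 3 3" and AB: "A * B = 1\<^sub>m 3" and d: "Determinant.det A = 1"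
  shows "mtrace B = (A $$ (1, 1) * A $$ (2, 2) - A $$ (1, 2) * A $$ (2, 1)) + (A $$ (0, 0) * A $$ (2, 2) - A $$ (0, 2) * A $$ (2, 0))
    + (A $$ (0, 0) * A $$ (1, 1) - A $$ (0, 1) * A $$ (1, 0))"
proof -
  have adj: "adj_mat A \<in> carrier_mat 3 3" using adj_mat(1)[OF A] .
  have "adj_mat A = adj_mat A * (A * B)" unfolding AB using adj by simp
  also have "\<dots> = adj_mat A * A * B" by (rule assoc_mult_mat[OF adj A B, symmetric])
  also have "adj_mat A * A = 1\<^sub>m 3" unfolding adj_mat(3)[OF A] d by (rule eq_matI) auto
  also have "1\<^sub>m 3 * B = B" by (rule left_mult_one_mat[OF B])
  finally have "B = adj_mat A" by (rule sym)
  then have "mtrace B = cofactor A 0 0 + cofactor A 1 1 + cofactor A 2 2"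
    using A unfolding \<open>B = adj_mat A\<close> mtrace_3[OF adj] by (simp add: adj_mat_def)
  then show ?thesis by (simp only: cofactor_3x3[OF A])
qed

lemma mult_3x3:
  assumes "(A :: complex mat) \<in> carrier_mat 3 3" "B \<in> carrier_mat 3 3" "i < 3" "j < 3"
  shows "(A * B) $$ (i, j) = A $$ (i, 0) * B $$ (0, j) + A $$ (i, 1) * B $$ (1, j) + A $$ (i, 2) * B $$ (2, j)"
  unfolding mult_mat_index[OF assms] sum_less_3 ..

text \<open>Newton's identity for the second power sum, with the trace of the inverse in the role of
  the second elementary symmetric function.\<close>

lemma mtrace_square_3x3:
  assumes A: "(A :: complex mat) \<in> carrier_mat 3 3" and B: "B \<in> carrier_mat 3 3" "A * B = 1\<^sub>m 3" and d: "Determinant.det A = 1"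
  shows "mtrace (A * A) = mtrace A ^ 2 - 2 * mtrace B"
  unfolding mtrace_3[OF mult_carrier_mat[OF A A]] mtrace_3[OF A] mtrace_inverse_3x3[OF A B d]
  by (simp add: mult_3x3[OF A A] del: index_mult_mat(1)) (simp add: power2_eq_square algebra_simps)

lemma mtrace_cube_3x3:
  assumes A: "(A :: complex mat) \<in> carrier_mat 3 3" and B: "B \<in> carrier_mat 3 3" "A * B = 1\<^sub>m 3" and d: "Determinant.det A = 1"
  shows "mtrace (A * A * A) = mtrace A ^ 3 - 3 * mtrace A * mtrace B + 3"
proof -
  note AA = mult_carrier_mat[OF A A]
  \<comment> \<open>With the determinant kept as an expression, Newton's third identity is a
    polynomial identity in the nine entries; the value one is inserted afterwards.\<close>
  have "mtrace (A * A * A) = mtrace A ^ 3 - 3 * mtrace A * mtrace B + 3 * Determinant.det A"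
    unfolding mtrace_3[OF mult_carrier_mat[OF AA A]] mtrace_3[OF A] mtrace_inverse_3x3[OF A B d] det_3x3[OF A]
    by (simp add: mult_3x3[OF A A] mult_3x3[OF AA A] del: index_mult_mat(1)) (simp add: power3_eq_cube algebra_simps)
  then show ?thesis using d by simp
qed

lemma unitary_row_norm:
  assumes "U \<in> carrier SU3" "i < 3"
  shows "(\<Sum>j<3. (cmod (U $$ (i, j)))\<^sup>2) = 1"
proof -
  have U: "U \<in> carrier_mat 3 3" "U * mat_adjoint U = 1\<^sub>m 3" using assms by (simp_all add: SU3_iff)
  have "complex_of_real (\<Sum>j<3. (cmod (U $$ (i, j)))\<^sup>2) = (\<Sum>j<3. U $$ (i, j) * cnj (U $$ (i, j)))"
    by (simp only: of_real_sum complex_norm_square)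
  also have "\<dots> = (\<Sum>j<3. U $$ (i, j) * mat_adjoint U $$ (j, i))"
    by (rule sum.cong[OF refl]) (simp only: mat_adjoint_index[OF U(1) _ assms(2)] lessThan_iff)
  also have "\<dots> = (U * mat_adjoint U) $$ (i, i)"
    by (rule mult_mat_index[OF U(1) mat_adjoint_carrier[OF U(1)] assms(2,2), symmetric])
  also have "\<dots> = 1" unfolding U(2) using assms(2) by simp
  finally show ?thesis by (simp only: of_real_eq_1_iff)
qed

text \<open>Diagonal entries of a unitary matrix have modulus at most one, so trace 3 forces all
  their real parts to be one, and the unit length of the rows forces everything else to vanish. It
  lets the factor \<open>t - 3\<close> be cancelled for nontrivial elements below.\<close>

lemma SU3_trace_3:
  assumes U: "U \<in> carrier SU3" and t: "mtrace U = 3"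
  shows "U = 1\<^sub>m 3"
proof -
  have c: "U \<in> carrier_mat 3 3" using U by (simp add: SU3_iff)
  have n1: "cmod (U $$ (i, i)) \<le> 1" if "i < 3" for i
  proof -
    have "(cmod (U $$ (i, i)))\<^sup>2 \<le> (\<Sum>j<3. (cmod (U $$ (i, j)))\<^sup>2)"
      by (rule member_le_sum) (use that in auto)
    then show ?thesis unfolding unitary_row_norm[OF U that] by (simp add: power_le_one_iff abs_square_le_1)
  qed
  have "Re (U $$ (0, 0)) + Re (U $$ (1, 1)) + Re (U $$ (2, 2)) = 3"
    using arg_cong[OF t, of Re] unfolding mtrace_3[OF c] by simp
  moreover have "Re (U $$ (i, i)) \<le> 1" if "i < 3" for i using n1[OF that] complex_Re_le_cmod[of "U $$ (i, i)"] by linarith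
  note this[of 0] this[of 1] this[of 2]
  ultimately have "Re (U $$ (0, 0)) = 1" "Re (U $$ (1, 1)) = 1" "Re (U $$ (2, 2)) = 1" by simp_all
  then have re: "Re (U $$ (i, i)) = 1" if "i < 3" for i using less_3_cases[OF that] by auto
  show ?thesis
  proof (rule eq_matI)
    fix i j assume "i < dim_row (1\<^sub>m 3 :: complex mat)" "j < dim_col (1\<^sub>m 3 :: complex mat)"
    then have ij: "i < 3" "j < 3" by simp_all
    \<comment> \<open>The diagonal entry alone already exhausts the unit norm of its row, so its
      imaginary part and the rest of the row are zero.\<close>
    have ge: "(cmod (U $$ (i, i)))\<^sup>2 = 1 + (Im (U $$ (i, i)))\<^sup>2" using re[OF ij(1)] by (simp add: cmod_power2)
    have eq: "(cmod (U $$ (i, i)))\<^sup>2 + (\<Sum>l\<in>{..<3} - {i}. (cmod (U $$ (i, l)))\<^sup>2) = 1"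
      using unitary_row_norm[OF U ij(1)] sum.remove[of "{..<3}" i "\<lambda>l. (cmod (U $$ (i, l)))\<^sup>2"] ij by simp
    have p: "(\<Sum>l\<in>{..<3} - {i}. (cmod (U $$ (i, l)))\<^sup>2) \<ge> 0" by (rule sum_nonneg) simp
    show "U $$ (i, j) = 1\<^sub>m 3 $$ (i, j)"
    proof (cases "i = j")
      case True
      have "(Im (U $$ (i, i)))\<^sup>2 \<le> 0" using ge eq p by linarith
      then have "Im (U $$ (i, i)) = 0" by simp
      then show ?thesis using re[OF ij(1)] True ij by (simp add: complex_eq_iff)
    next
      case False
      have "(cmod (U $$ (i, j)))\<^sup>2 \<le> (\<Sum>l\<in>{..<3} - {i}. (cmod (U $$ (i, l)))\<^sup>2)"
        by (rule member_le_sum) (use False ij in auto)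
      also have "\<dots> \<le> 0" using ge eq zero_le_power2[of "Im (U $$ (i, i))"] by linarith
      finally show ?thesis using False ij by simp
    qed
  qed (use c in auto)
qed

section \<open>Subgroups of \<open>SU(3)\<close> isomorphic to \<open>A\<^sub>5\<close>\<close>

definition golden :: complex where "golden = of_real ((1 + sqrt 5) / 2)"

lemma golden_square: "golden\<^sup>2 = golden + 1"
proof -
  have "((1 + sqrt 5) / 2)\<^sup>2 = (1 + sqrt 5) / 2 + (1::real)" by (simp add: field_simps power2_eq_square)
  from arg_cong[OF this, of complex_of_real] show ?thesis
    unfolding golden_def of_real_power of_real_add of_real_1 .
qed

lemma golden_conj_square: "(1 - golden)\<^sup>2 = (1 - golden) + 1"
  using golden_square by (simp add: power2_eq_square algebra_simps)

lemma golden_root: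
  assumes "(t::complex)\<^sup>2 = t + 1" shows "t = golden \<or> t = 1 - golden"
proof -
  have "(t - golden) * (t - (1 - golden)) = 0"
    using assms golden_square by (simp add: power2_eq_square algebra_simps)
  then show ?thesis by auto
qed

lemma golden_root_neq: "(t::complex)\<^sup>2 = t + 1 \<Longrightarrow> t \<noteq> 3 \<and> t \<noteq> - 1 \<and> t \<noteq> 0"
  by auto

lemma golden_neq_conj: "golden \<noteq> 1 - golden"
proof
  assume "golden = 1 - golden"
  then have "complex_of_real (1 + sqrt 5) = of_real 1" unfolding golden_def by (simp add: field_simps)
  then show False unfolding of_real_eq_iff by simp
qed

locale A5_in_SU3 =
  fixes A :: "complex mat set"
  assumes sub: "subgroup A SU3" and iso: "SU3\<lparr>carrier := A\<rparr> \<cong> alt_group 5"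
begin

lemma A_SU3: "g \<in> A \<Longrightarrow> g \<in> carrier SU3"
  using subgroup.subset[OF sub] by blast

lemma A_carrier: "g \<in> A \<Longrightarrow> g \<in> carrier_mat 3 3" and A_det: "g \<in> A \<Longrightarrow> Determinant.det g = 1"
  using A_SU3 by (simp_all add: SU3_iff)

lemma A_mult: "g \<in> A \<Longrightarrow> h \<in> A \<Longrightarrow> g * h \<in> A"
  using subgroup.m_closed[OF sub] by (simp add: SU3_simps)

lemma A_one: "1\<^sub>m 3 \<in> A"
  using subgroup.one_closed[OF sub] by (simp add: SU3_simps)

lemma A_assoc: "g \<in> A \<Longrightarrow> h \<in> A \<Longrightarrow> k \<in> A \<Longrightarrow> g * h * k = g * (h * k)"
  by (rule assoc_mult_mat[OF A_carrier A_carrier A_carrier])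

lemma A_one_mult: "g \<in> A \<Longrightarrow> 1\<^sub>m 3 * g = g" "g \<in> A \<Longrightarrow> g * 1\<^sub>m 3 = g"
  using left_mult_one_mat[OF A_carrier, of g] right_mult_one_mat[OF A_carrier, of g] by blast+

text \<open>Naming the inverse as the adjoint makes its trace the complex conjugate, from which the
  traces are seen to be real.\<close>

lemma A_inv:
  assumes "g \<in> A" obtains h where "h \<in> A" "g * h = 1\<^sub>m 3" "h * g = 1\<^sub>m 3" "h = mat_adjoint g"
proof
  note c = A_carrier[OF assms]
  interpret S: group SU3 by (rule group_SU3)
  let ?h = "inv\<^bsub>SU3\<^esub> g"
  show h: "?h \<in> A" by (rule subgroup.m_inv_closed[OF sub assms])
  show r: "g * ?h = 1\<^sub>m 3" and "?h * g = 1\<^sub>m 3"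
    using S.r_inv[OF A_SU3[OF assms]] S.l_inv[OF A_SU3[OF assms]] by (simp_all add: SU3_simps)
  note a = mat_adjoint_carrier[OF c]
  have u: "g * mat_adjoint g = 1\<^sub>m 3" using A_SU3[OF assms] by (simp add: SU3_iff)
  have "?h = ?h * (g * mat_adjoint g)" unfolding u using A_one_mult[OF h] by simp
  also have "\<dots> = ?h * g * mat_adjoint g" by (rule assoc_mult_mat[OF A_carrier[OF h] c a, symmetric])
  also have "\<dots> = mat_adjoint g" unfolding \<open>?h * g = 1\<^sub>m 3\<close> by (rule left_mult_one_mat[OF a])
  finally show "?h = mat_adjoint g" .
qed

lemma encoding:
  obtains \<eta> where "bij_betw \<eta> A (set squares5)" "\<forall>g\<in>A. \<forall>h\<in>A. \<eta> (g * h) = comp5 (\<eta> g) (\<eta> h)" "\<eta> (1\<^sub>m 3) = id5"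
proof -
  from iso obtain \<phi> where \<phi>: "\<phi> \<in> Group.iso (SU3\<lparr>carrier := A\<rparr>) (alt_group 5)" unfolding is_iso_def by blast
  then have h: "\<phi> \<in> hom (SU3\<lparr>carrier := A\<rparr>) (alt_group 5)" and b: "bij_betw \<phi> A (carrier (alt_group 5))"
    by (simp_all add: Group.iso_def)
  have G: "group (SU3\<lparr>carrier := A\<rparr>)" by (rule subgroup.subgroup_is_group[OF sub group_SU3])
  have sub5: "carrier (alt_group 5) \<subseteq> {p. p permutes {1..5}}" by (auto simp: alt_group_carrier)
  have \<phi>p: "\<phi> g permutes {1..5}" if "g \<in> A" for g using bij_betwE[OF b] that sub5 by blast
  have "bij_betw enc5 (carrier (alt_group 5)) (set squares5)"
    unfolding bij_betw_def using inj_on_subset[OF enc5_inj sub5] enc5_image_alt by simp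
  from bij_betw_trans[OF b this] have 1: "bij_betw (enc5 \<circ> \<phi>) A (set squares5)" .
  have 2: "\<forall>g\<in>A. \<forall>k\<in>A. (enc5 \<circ> \<phi>) (g * k) = comp5 ((enc5 \<circ> \<phi>) g) ((enc5 \<circ> \<phi>) k)"
  proof (intro ballI)
    fix g k assume gk: "g \<in> A" "k \<in> A"
    have "\<phi> (g * k) = \<phi> g \<circ> \<phi> k" using hom_mult[OF h] gk by (simp add: SU3_simps alt_group_mult)
    then show "(enc5 \<circ> \<phi>) (g * k) = comp5 ((enc5 \<circ> \<phi>) g) ((enc5 \<circ> \<phi>) k)"
      using enc5_comp[OF \<phi>p[OF gk(2)]] by simp
  qed
  have "\<phi> (1\<^sub>m 3) = id" using hom_one[OF h G alt_group_is_group] by (simp add: SU3_simps alt_group_one)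
  then have 3: "(enc5 \<circ> \<phi>) (1\<^sub>m 3) = id5" by (simp add: enc5_id)
  from that[OF 1 2 3] show ?thesis .
qed

definition \<eta> :: "complex mat \<Rightarrow> perm5" where
  "\<eta> = (SOME \<eta>. bij_betw \<eta> A (set squares5) \<and> (\<forall>g\<in>A. \<forall>h\<in>A. \<eta> (g * h) = comp5 (\<eta> g) (\<eta> h)) \<and> \<eta> (1\<^sub>m 3) = id5)"

lemma \<eta>: "bij_betw \<eta> A (set squares5)" "g \<in> A \<Longrightarrow> h \<in> A \<Longrightarrow> \<eta> (g * h) = comp5 (\<eta> g) (\<eta> h)" "\<eta> (1\<^sub>m 3) = id5"
proof -
  have "\<exists>\<eta>. bij_betw \<eta> A (set squares5) \<and> (\<forall>g\<in>A. \<forall>h\<in>A. \<eta> (g * h) = comp5 (\<eta> g) (\<eta> h)) \<and> \<eta> (1\<^sub>m 3) = id5"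
    using encoding by metis
  from someI_ex[OF this] show "bij_betw \<eta> A (set squares5)"
    "g \<in> A \<Longrightarrow> h \<in> A \<Longrightarrow> \<eta> (g * h) = comp5 (\<eta> g) (\<eta> h)" "\<eta> (1\<^sub>m 3) = id5"
    unfolding \<eta>_def[symmetric] by blast+
qed

lemma \<eta>_eq: "g \<in> A \<Longrightarrow> h \<in> A \<Longrightarrow> \<eta> g = \<eta> h \<longleftrightarrow> g = h"
  using bij_betw_imp_inj_on[OF \<eta>(1)] by (simp add: inj_on_eq_iff)

lemma \<eta>_eq_id: "g \<in> A \<Longrightarrow> \<eta> g = id5 \<longleftrightarrow> g = 1\<^sub>m 3"
  using \<eta>_eq[OF _ A_one, of g] \<eta>(3) by simp

lemma \<eta>_in: "g \<in> A \<Longrightarrow> \<eta> g \<in> set squares5"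
  using bij_betwE[OF \<eta>(1)] by blast

lemma distinct_squares5: "distinct squares5" "length squares5 = 60"
  using squares5_props by (simp_all add: squares5_def squares5_props_def)

lemma card_A: "card A = 60"
  using bij_betw_same_card[OF \<eta>(1)] distinct_card[OF distinct_squares5(1)] distinct_squares5(2) by simp

lemma finite_A: "finite A"
  by (rule card_ge_0_finite) (simp add: card_A)

lemma card_A_filter:
  assumes "\<And>g. g \<in> A \<Longrightarrow> P g \<longleftrightarrow> Q (\<eta> g)"
  shows "card {g \<in> A. P g} = length (filter Q squares5)"
proof -
  have "\<eta> ` {g \<in> A. P g} = set (filter Q squares5)"
    using assms bij_betw_imp_surj_on[OF \<eta>(1)] by force
  moreover have "card (\<eta> ` {g \<in> A. P g}) = card {g \<in> A. P g}"
    by (rule card_image) (rule inj_on_subset[OF bij_betw_imp_inj_on[OF \<eta>(1)]], blast)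
  ultimately show ?thesis using distinct_card[OF distinct_filter[OF distinct_squares5(1)]] by simp
qed

lemma card_order_2: "card {g \<in> A. g \<noteq> 1\<^sub>m 3 \<and> g * g = 1\<^sub>m 3} = 15"
proof -
  have "card {g \<in> A. g \<noteq> 1\<^sub>m 3 \<and> g * g = 1\<^sub>m 3} = length (filter (\<lambda>p. p \<noteq> id5 \<and> comp5 p p = id5) squares5)"
    by (rule card_A_filter) (simp add: \<eta>(2)[symmetric] \<eta>_eq_id A_mult)
  then show ?thesis using squares5_props by (simp add: squares5_props_def)
qed

lemma card_order_3: "card {g \<in> A. g \<noteq> 1\<^sub>m 3 \<and> g * (g * g) = 1\<^sub>m 3} = 20"
proof -
  have "card {g \<in> A. g \<noteq> 1\<^sub>m 3 \<and> g * (g * g) = 1\<^sub>m 3} = length (filter (\<lambda>p. p \<noteq> id5 \<and> comp5 p (comp5 p p) = id5) squares5)"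
    by (rule card_A_filter) (simp add: \<eta>(2)[symmetric] \<eta>_eq_id A_mult)
  then show ?thesis using squares5_props by (simp add: squares5_props_def)
qed

lemma A_orders:
  assumes "g \<in> A"
  shows "g = 1\<^sub>m 3 \<or> g * g = 1\<^sub>m 3 \<or> g * (g * g) = 1\<^sub>m 3 \<or> g * (g * (g * (g * g))) = 1\<^sub>m 3"
proof -
  have "list_all (\<lambda>p. p = id5 \<or> comp5 p p = id5 \<or> comp5 p (comp5 p p) = id5 \<or>
       comp5 p (comp5 p (comp5 p (comp5 p p))) = id5) squares5"
    using squares5_props unfolding squares5_props_def by blast
  then show ?thesis using \<eta>_in[OF assms] assms unfolding list_all_iff
    by (auto simp: \<eta>(2)[symmetric] \<eta>_eq_id A_mult)
qed

lemma A_conj_inverse: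
  assumes g: "g \<in> A" obtains x where "x \<in> A" "g * (x * g) = x"
proof -
  have "list_all (\<lambda>p. list_ex (\<lambda>x. comp5 p (comp5 x p) = x) squares5) squares5"
    using squares5_props unfolding squares5_props_def by blast
  then obtain y where y: "y \<in> set squares5" "comp5 (\<eta> g) (comp5 y (\<eta> g)) = y"
    using \<eta>_in[OF g] unfolding list_all_iff list_ex_iff by blast
  then obtain x where x: "x \<in> A" "y = \<eta> x" using bij_betw_imp_surj_on[OF \<eta>(1)] by blast
  have "\<eta> (g * (x * g)) = \<eta> x" using y(2) x g by (simp add: \<eta>(2) A_mult)
  then have "g * (x * g) = x" using \<eta>_eq A_mult g x(1) by simp
  then show ?thesis using that x(1) by blast
qed

text \<open>Every element of \<open>A\<^sub>5\<close> is conjugate to its inverse, so all traces are real.\<close>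

lemma mtrace_inverse:
  assumes g: "g \<in> A" and h: "h \<in> A" and gh: "g * h = 1\<^sub>m 3"
  shows "mtrace h = mtrace g"
proof -
  obtain x where x: "x \<in> A" "g * (x * g) = x" by (rule A_conj_inverse[OF g])
  obtain y where y: "y \<in> A" "x * y = 1\<^sub>m 3" "y * x = 1\<^sub>m 3" "y = mat_adjoint x" by (rule A_inv[OF x(1)])
  have hg: "h * g = 1\<^sub>m 3" by (rule mat_mult_left_right_inverse[OF A_carrier[OF g] A_carrier[OF h] gh])
  have "h * x = h * (g * (x * g))" by (simp only: x(2))
  also have "\<dots> = h * g * (x * g)" by (rule A_assoc[symmetric]) (use g h x A_mult in auto)
  also have "\<dots> = x * g" unfolding hg by (rule A_one_mult(1)[OF A_mult[OF x(1) g]])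
  finally have "x * g = h * x" by (rule sym)
  from mtrace_similar[OF A_carrier[OF x(1)] A_carrier[OF y(1)] y(3) A_carrier[OF g] A_carrier[OF h] this]
  show ?thesis by (rule sym)
qed

text \<open>Since the inverse has the same trace, the Newton identities become polynomials in the
  single number \<open>mtrace g\<close>; likewise for the cube.\<close>

lemma mtrace_square:
  assumes g: "g \<in> A" shows "mtrace (g * g) = mtrace g ^ 2 - 2 * mtrace g"
proof -
  obtain h where h: "h \<in> A" "g * h = 1\<^sub>m 3" "h * g = 1\<^sub>m 3" "h = mat_adjoint g" by (rule A_inv[OF g])
  show ?thesis
    using mtrace_square_3x3[OF A_carrier[OF g] A_carrier[OF h(1)] h(2) A_det[OF g]]
    unfolding mtrace_inverse[OF g h(1,2)] .
qed

lemma mtrace_cube: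
  assumes g: "g \<in> A" shows "mtrace (g * (g * g)) = mtrace g ^ 3 - 3 * mtrace g ^ 2 + 3"
proof -
  obtain h where h: "h \<in> A" "g * h = 1\<^sub>m 3" "h * g = 1\<^sub>m 3" "h = mat_adjoint g" by (rule A_inv[OF g])
  show ?thesis
    using mtrace_cube_3x3[OF A_carrier[OF g] A_carrier[OF h(1)] h(2) A_det[OF g]]
    unfolding mtrace_inverse[OF g h(1,2)] A_assoc[OF g g g] by (simp add: power2_eq_square mult.assoc)
qed

lemma mtrace_real:
  assumes g: "g \<in> A" shows "Im (mtrace g) = 0"
proof -
  obtain h where h: "h \<in> A" "g * h = 1\<^sub>m 3" "h * g = 1\<^sub>m 3" "h = mat_adjoint g" by (rule A_inv[OF g])
  have "cnj (mtrace g) = mtrace g"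
    using mtrace_inverse[OF g h(1,2)] unfolding h(4) mtrace_adjoint[OF A_carrier[OF g]] .
  then show ?thesis by (simp add: complex_eq_iff)
qed

lemma mtrace_neq_3: "g \<in> A \<Longrightarrow> g \<noteq> 1\<^sub>m 3 \<Longrightarrow> mtrace g \<noteq> 3"
  using SU3_trace_3 A_SU3 by blast

lemma mtrace_order_2:
  assumes g: "g \<in> A" "g \<noteq> 1\<^sub>m 3" "g * g = 1\<^sub>m 3" shows "mtrace g = - 1"
proof -
  \<comment> \<open>For \<open>t = mtrace g\<close> this is \<open>t^2 - 2 t = 3\<close>, the right
    side being the trace of the identity.\<close>
  have "(mtrace g - 3) * (mtrace g + 1) = 0"
    using mtrace_square[OF g(1)] unfolding g(3) by (simp add: power2_eq_square algebra_simps)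
  then show ?thesis using mtrace_neq_3[OF g(1,2)] by (auto simp: eq_neg_iff_add_eq_0)
qed

lemma mtrace_order_3:
  assumes g: "g \<in> A" "g \<noteq> 1\<^sub>m 3" "g * (g * g) = 1\<^sub>m 3" shows "mtrace g = 0"
proof -
  \<comment> \<open>For \<open>t = mtrace g\<close> this is
    \<open>t^3 - 3 t^2 + 3 = 3\<close>.\<close>
  have "mtrace g * mtrace g * (mtrace g - 3) = 0"
    using mtrace_cube[OF g(1)] unfolding g(3) by (simp add: power2_eq_square power3_eq_cube algebra_simps)
  then show ?thesis using mtrace_neq_3[OF g(1,2)] by auto
qed

text \<open>For \<open>g\<close> of order 5, \<open>g\<^sup>3\<close> is the inverse of \<open>g\<^sup>2\<close>, so the two have the same trace.\<close>

lemma mtrace_order_5: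
  assumes g: "g \<in> A" "g \<noteq> 1\<^sub>m 3" "g * (g * (g * (g * g))) = 1\<^sub>m 3" shows "(mtrace g)\<^sup>2 = mtrace g + 1"
proof -
  note gg = A_mult[OF g(1) g(1)]
  have "g * g * (g * (g * g)) = 1\<^sub>m 3" using A_assoc[OF g(1) g(1) A_mult[OF g(1) gg]] g(3) by simp
  then have "mtrace (g * (g * g)) = mtrace (g * g)" by (rule mtrace_inverse[OF gg A_mult[OF g(1) gg]])
  \<comment> \<open>Equating \<open>t^3 - 3 t^2 + 3\<close> and \<open>t^2 - 2 t\<close> gives
    \<open>t^3 - 4 t^2 + 2 t + 3 = 0\<close>, which factors in this way.\<close>
  then have "(mtrace g - 3) * ((mtrace g)\<^sup>2 - mtrace g - 1) = 0"
    unfolding mtrace_cube[OF g(1)] mtrace_square[OF g(1)] by (simp add: power2_eq_square power3_eq_cube algebra_simps)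
  then have "(mtrace g)\<^sup>2 - mtrace g - 1 = 0" using mtrace_neq_3[OF g(1,2)] by simp
  then show ?thesis by (simp add: algebra_simps)
qed

lemma A_classification:
  assumes g: "g \<in> A"
  obtains "g = 1\<^sub>m 3" "mtrace g = 3" | "g \<noteq> 1\<^sub>m 3" "g * g = 1\<^sub>m 3" "mtrace g = - 1"
    | "g \<noteq> 1\<^sub>m 3" "g * (g * g) = 1\<^sub>m 3" "mtrace g = 0"
    | "g \<noteq> 1\<^sub>m 3" "g * (g * (g * (g * g))) = 1\<^sub>m 3" "(mtrace g)\<^sup>2 = mtrace g + 1"
proof (cases "g = 1\<^sub>m 3")
  case True
  then show ?thesis using that(1) by simp
next
  case False
  with A_orders[OF g] consider "g * g = 1\<^sub>m 3" | "g * (g * g) = 1\<^sub>m 3" | "g * (g * (g * (g * g))) = 1\<^sub>m 3" by blast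
  then show ?thesis
  proof cases
    case 1 show ?thesis by (rule that(2)[OF False 1 mtrace_order_2[OF g False 1]])
  next
    case 2 show ?thesis by (rule that(3)[OF False 2 mtrace_order_3[OF g False 2]])
  next
    case 3 show ?thesis by (rule that(4)[OF False 3 mtrace_order_5[OF g False 3]])
  qed
qed

definition trace_fibre :: "complex \<Rightarrow> complex mat set" where
  "trace_fibre t = {g \<in> A. mtrace g = t}"

lemma card_trace_fibre_3: "card (trace_fibre 3) = 1"
proof -
  have "trace_fibre 3 = {1\<^sub>m 3}"
    using mtrace_neq_3 A_one unfolding trace_fibre_def by auto
  then show ?thesis by simp
qed

lemma card_trace_fibre_neg_1: "card (trace_fibre (- 1)) = 15"
proof -
  have "trace_fibre (- 1) = {g \<in> A. g \<noteq> 1\<^sub>m 3 \<and> g * g = 1\<^sub>m 3}"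
    unfolding trace_fibre_def
  proof (rule Collect_cong, rule conj_cong[OF refl])
    fix g assume "g \<in> A"
    then show "mtrace g = - 1 \<longleftrightarrow> g \<noteq> 1\<^sub>m 3 \<and> g * g = 1\<^sub>m 3"
      by (cases rule: A_classification) (use mtrace_order_2 \<open>g \<in> A\<close> golden_root_neq in auto)
  qed
  then show ?thesis using card_order_2 by simp
qed

lemma card_trace_fibre_0: "card (trace_fibre 0) = 20"
proof -
  have "trace_fibre 0 = {g \<in> A. g \<noteq> 1\<^sub>m 3 \<and> g * (g * g) = 1\<^sub>m 3}"
    unfolding trace_fibre_def
  proof (rule Collect_cong, rule conj_cong[OF refl])
    fix g assume "g \<in> A"
    then show "mtrace g = 0 \<longleftrightarrow> g \<noteq> 1\<^sub>m 3 \<and> g * (g * g) = 1\<^sub>m 3"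
      by (cases rule: A_classification) (use mtrace_order_3 \<open>g \<in> A\<close> golden_root_neq in auto)
  qed
  then show ?thesis using card_order_3 by simp
qed

text \<open>Squaring is injective on the elements of order 5 and exchanges the two traces.\<close>

lemma card_trace_fibre_golden_le:
  assumes t: "t\<^sup>2 = t + 1"
  shows "card (trace_fibre t) \<le> card (trace_fibre (1 - t))"
proof (rule card_inj_on_le)
  have five: "g * (g * (g * (g * g))) = 1\<^sub>m 3" if "g \<in> trace_fibre t" for g
  proof -
    from that have g: "g \<in> A" "mtrace g = t" by (simp_all add: trace_fibre_def)
    from g(1) show ?thesis
      by (cases rule: A_classification) (use g golden_root_neq[OF t] in auto)
  qed
  \<comment> \<open>The cube of the square is \<open>g^6\<close>, which is \<open>g\<close> for an
    element with \<open>g^5 = 1\<close>; cubing therefore undoes the squaring.\<close>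
  have cube: "g * g * (g * g * (g * g)) = g" if gt: "g \<in> trace_fibre t" for g
  proof -
    from gt have g: "g \<in> A" by (simp add: trace_fibre_def)
    have "g * g * (g * g * (g * g)) = g * (g * (g * (g * g))) * g"
      by (simp only: A_assoc A_mult g)
    then show ?thesis unfolding five[OF gt] using A_one_mult[OF g] by simp
  qed
  show "inj_on (\<lambda>g. g * g) (trace_fibre t)"
  proof (rule inj_onI)
    fix g h assume gh: "g \<in> trace_fibre t" "h \<in> trace_fibre t" and e: "g * g = h * h"
    have "g = g * g * (g * g * (g * g))" by (rule cube[OF gh(1), symmetric])
    also have "\<dots> = h" unfolding e by (rule cube[OF gh(2)])
    finally show "g = h" .
  qed
  show "(\<lambda>g. g * g) ` trace_fibre t \<subseteq> trace_fibre (1 - t)"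
  proof (rule image_subsetI)
    fix g assume "g \<in> trace_fibre t"
    then have g: "g \<in> A" "mtrace g = t" by (simp_all add: trace_fibre_def)
    \<comment> \<open>From \<open>t^2 - 2 t\<close> and \<open>t^2 = t + 1\<close>.\<close>
    have "mtrace (g * g) = 1 - t" unfolding mtrace_square[OF g(1)] g(2) t by simp
    then show "g * g \<in> trace_fibre (1 - t)" using A_mult[OF g(1,1)] by (simp add: trace_fibre_def)
  qed
  show "finite (trace_fibre (1 - t))" using finite_A by (simp add: trace_fibre_def)
qed

lemma mtrace_values: "mtrace ` A \<subseteq> {3, - 1, 0, golden, 1 - golden}"
proof (rule image_subsetI)
  fix g assume "g \<in> A"
  then show "mtrace g \<in> {3, - 1, 0, golden, 1 - golden}"
    by (cases rule: A_classification) (use golden_root[of "mtrace g"] in auto)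
qed

lemma sum_traces_fibres:
  "(\<Sum>g\<in>A. F (mtrace g)) = of_nat (card (trace_fibre 3)) * F 3 + of_nat (card (trace_fibre (- 1))) * F (- 1)
    + of_nat (card (trace_fibre 0)) * F 0 + of_nat (card (trace_fibre golden)) * F golden
    + of_nat (card (trace_fibre (1 - golden))) * (F (1 - golden) :: complex)"
proof -
  have "(\<Sum>g\<in>A. F (mtrace g)) = (\<Sum>t\<in>{3, - 1, 0, golden, 1 - golden}. \<Sum>g\<in>{g \<in> A. mtrace g = t}. F (mtrace g))"
    by (rule sum.group[symmetric]) (use finite_A mtrace_values in auto)
  also have "\<dots> = (\<Sum>t\<in>{3, - 1, 0, golden, 1 - golden}. of_nat (card (trace_fibre t)) * F t)"
    by (rule sum.cong) (simp_all add: trace_fibre_def)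
  also have "\<dots> = (\<Sum>t\<leftarrow>[3, - 1, 0, golden, 1 - golden]. of_nat (card (trace_fibre t)) * F t)"
  proof -
    have "distinct [3, - 1, 0, golden, 1 - golden]"
      using golden_root_neq[OF golden_square] golden_root_neq[OF golden_conj_square] golden_neq_conj
      by (auto simp del: diff_eq_eq eq_diff_eq)
    from sum_list_distinct_conv_sum_set[OF this, of "\<lambda>t. of_nat (card (trace_fibre t)) * F t"] show ?thesis
      by (simp only: list.set)
  qed
  finally show ?thesis by (simp add: add.assoc)
qed

lemma sum_traces:
  "(\<Sum>g\<in>A. F (mtrace g)) = F 3 + 15 * F (- 1) + 20 * F 0 + 12 * F golden + 12 * (F (1 - golden) :: complex)"
proof -
  have eq: "card (trace_fibre golden) = card (trace_fibre (1 - golden))"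
    using card_trace_fibre_golden_le[OF golden_square] card_trace_fibre_golden_le[OF golden_conj_square] by simp
  \<comment> \<open>The constant function 1 turns the fibre formula into the class equation; the two
    golden fibres have equal size, so each takes half of the remaining 24 elements.\<close>
  have "complex_of_nat 60 = of_nat (1 + 15 + 20 + 2 * card (trace_fibre golden))"
    using sum_traces_fibres[of "\<lambda>_. 1"] unfolding card_trace_fibre_3 card_trace_fibre_neg_1 card_trace_fibre_0 eq
    by (simp add: card_A)
  then have "60 = 1 + 15 + 20 + 2 * card (trace_fibre golden)" by (simp only: of_nat_eq_iff)
  then have c: "card (trace_fibre golden) = 12" by simp
  show ?thesis unfolding sum_traces_fibres card_trace_fibre_3 card_trace_fibre_neg_1 card_trace_fibre_0 eq[symmetric] c
    by simp
qed

end

section \<open>Cube roots of unity and the products of \<open>A\<close> with the centre\<close>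

lemma omega_eq: "omega = Complex (- 1 / 2) (sqrt 3 / 2)"
  by (simp add: omega_def complex_eq_iff cos_120 sin_120)

lemma omega_square: "omega\<^sup>2 = Complex (- 1 / 2) (- sqrt 3 / 2)"
  by (simp add: omega_eq complex_eq_iff power2_eq_square)

lemma omega_cube: "omega ^ 3 = 1"
  by (simp add: omega_def Complex.DeMoivre cis_2pi)

lemma omega_cube_root:
  assumes "c \<in> {1, omega, omega\<^sup>2}" shows "c ^ 3 = 1" "c * cnj c = 1"
proof -
  have "(omega\<^sup>2) ^ 3 = (omega ^ 3)\<^sup>2" by (simp only: power_mult[symmetric] mult.commute)
  then show "c ^ 3 = 1" using assms omega_cube by auto
  have "norm omega = 1" by (simp add: omega_def)
  then have "norm c = 1" using assms by (auto simp: norm_power)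
  then show "c * cnj c = 1" by (simp add: complex_norm_square[symmetric])
qed

lemma omega_powers_distinct: "distinct [1, omega, omega\<^sup>2]"
  unfolding omega_square unfolding omega_eq by (simp add: complex_eq_iff)

text \<open>The ratio of two cube roots of unity is again one, and the only real one is 1.\<close>

lemma omega_powers_real_ratio:
  assumes "c \<in> {1, omega, omega\<^sup>2}" "d \<in> {1, omega, omega\<^sup>2}" "Im (c * cnj d) = 0"
  shows "c = d"
  using assms unfolding omega_square unfolding omega_eq by auto

context A5_in_SU3 begin

lemma centre_in_SU3:
  assumes c: "c \<in> {1, omega, omega\<^sup>2}"
  shows "c \<cdot>\<^sub>m 1\<^sub>m 3 \<in> carrier SU3"
proof -
  have m: "c \<cdot>\<^sub>m 1\<^sub>m 3 \<in> carrier_mat 3 3" by simp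
  have "mat_adjoint (c \<cdot>\<^sub>m 1\<^sub>m 3) = cnj c \<cdot>\<^sub>m 1\<^sub>m 3"
    by (rule eq_matI) (use mat_adjoint_carrier[OF m] in \<open>auto simp: mat_adjoint_index[OF m]\<close>)
  then have "c \<cdot>\<^sub>m 1\<^sub>m 3 * mat_adjoint (c \<cdot>\<^sub>m 1\<^sub>m 3) = c \<cdot>\<^sub>m (cnj c \<cdot>\<^sub>m 1\<^sub>m 3)"
    by (simp add: mult_smult_assoc_mat[of _ 3 3 _ 3])
  also have "\<dots> = 1\<^sub>m 3" by (rule eq_matI) (use omega_cube_root(2)[OF c] in auto)
  finally show ?thesis using m omega_cube_root(1)[OF c] by (simp add: SU3_iff)
qed

text \<open>\<open>A\<close> meets the centre only in the identity: the quotient of \<open>a\<close>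
  and \<open>b\<close> lies in \<open>A\<close> and is a cube root of unity times the identity, so
  its trace is real by \<open>mtrace_real\<close> and the scalar is 1.\<close>

lemma scalar_multiple_inj:
  assumes c: "c \<in> {1, omega, omega\<^sup>2}" "d \<in> {1, omega, omega\<^sup>2}" and a: "a \<in> A" "b \<in> A" and e: "c \<cdot>\<^sub>m a = d \<cdot>\<^sub>m b"
  shows "c = d \<and> a = b"
proof -
  have undo: "cnj c \<cdot>\<^sub>m (c \<cdot>\<^sub>m g) = g" if "c \<in> {1, omega, omega\<^sup>2}" "g \<in> A" for c g
    by (rule eq_matI) (use omega_cube_root(2)[OF that(1)] A_carrier[OF that(2)] in \<open>auto simp: mult.assoc[symmetric] mult.commute\<close>)
  obtain h where h: "h \<in> A" "b * h = 1\<^sub>m 3" "h * b = 1\<^sub>m 3" "h = mat_adjoint b" by (rule A_inv[OF a(2)])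
  have "c \<cdot>\<^sub>m (a * h) = c \<cdot>\<^sub>m a * h" by (rule mult_smult_assoc_mat[OF A_carrier[OF a(1)] A_carrier[OF h(1)], symmetric])
  also have "\<dots> = d \<cdot>\<^sub>m (b * h)" unfolding e by (rule mult_smult_assoc_mat[OF A_carrier[OF a(2)] A_carrier[OF h(1)]])
  finally have "c \<cdot>\<^sub>m (a * h) = d \<cdot>\<^sub>m 1\<^sub>m 3" unfolding h(2) .
  then have "a * h = cnj c \<cdot>\<^sub>m (d \<cdot>\<^sub>m 1\<^sub>m 3)" using undo[OF c(1) A_mult[OF a(1) h(1)]] by simp
  define z where "z = d * cnj c"
  have "mtrace (a * h) = 3 * z"
    unfolding \<open>a * h = cnj c \<cdot>\<^sub>m (d \<cdot>\<^sub>m 1\<^sub>m 3)\<close> z_def by (simp add: mtrace_smult[of _ 3])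
  then have "Im (3 * z) = 0" using mtrace_real[OF A_mult[OF a(1) h(1)]] by (simp only:)
  then have "Im (d * cnj c) = 0" unfolding z_def[symmetric] by simp
  then have dc: "d = c" by (rule omega_powers_real_ratio[OF c(2,1)])
  have "a = cnj c \<cdot>\<^sub>m (c \<cdot>\<^sub>m a)" by (rule undo[OF c(1) a(1), symmetric])
  also have "\<dots> = b" unfolding e dc by (rule undo[OF c(1) a(2)])
  finally show ?thesis using dc by (rule conjI[OF sym, rotated])
qed

text \<open>The 180 distinct products of a central scalar and an element of \<open>A\<close> lie in
  \<open>\<Gamma>\<close>, which has 180 elements, so they exhaust it. This count replaces a
  description of the generated subgroup by words.\<close>

lemma generated_group:
  assumes \<Gamma>: "\<Gamma> = generate SU3 (A \<union> centre_SU3)" and card: "card \<Gamma> = 180"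
  shows "SU3_finite_subgroup \<Gamma>"
    and "(\<Sum>g\<in>\<Gamma>. F (mtrace g)) = (\<Sum>c\<leftarrow>[1, omega, omega\<^sup>2]. \<Sum>g\<in>A. (F (c * mtrace g) :: complex))"
proof -
  interpret S: group SU3 by (rule group_SU3)
  let ?C = "{1, omega, omega\<^sup>2}"
  have gens: "A \<union> centre_SU3 \<subseteq> carrier SU3"
    using A_SU3 centre_in_SU3 by (auto simp: centre_SU3_def)
  have sg: "subgroup \<Gamma> SU3" unfolding \<Gamma> by (rule S.generate_is_subgroup[OF gens])
  have fin: "finite \<Gamma>" by (rule card_ge_0_finite) (simp add: card)
  show "SU3_finite_subgroup \<Gamma>"
    by (intro SU3_finite_subgroup.intro subgroup.subgroup_is_group[OF sg group_SU3] subgroup.subset[OF sg] fin)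
  have inj: "inj_on (\<lambda>(c, a). c \<cdot>\<^sub>m a) (?C \<times> A)"
  proof (rule inj_onI)
    fix x y assume x: "x \<in> ?C \<times> A" and y: "y \<in> ?C \<times> A" and e: "(case x of (c, a) \<Rightarrow> c \<cdot>\<^sub>m a) = (case y of (c, a) \<Rightarrow> c \<cdot>\<^sub>m a)"
    obtain c a d b where xy: "x = (c, a)" "y = (d, b)" by (cases x, cases y)
    from x y e have "c = d \<and> a = b" unfolding xy mem_Times_iff fst_conv snd_conv prod.case
      by (elim conjE) (rule scalar_multiple_inj)
    then show "x = y" by (simp add: xy)
  qed
  have sub\<Gamma>: "(\<lambda>(c, a). c \<cdot>\<^sub>m a) ` (?C \<times> A) \<subseteq> \<Gamma>"
  proof
    fix x assume "x \<in> (\<lambda>(c, a). c \<cdot>\<^sub>m a) ` (?C \<times> A)"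
    then obtain c a where ca: "c \<in> ?C" "a \<in> A" and x: "x = c \<cdot>\<^sub>m a" by auto
    have "c \<cdot>\<^sub>m 1\<^sub>m 3 \<in> \<Gamma>" unfolding \<Gamma> by (rule generate.incl) (use ca in \<open>auto simp: centre_SU3_def\<close>)
    moreover have "a \<in> \<Gamma>" unfolding \<Gamma> by (rule generate.incl) (use ca in auto)
    ultimately have "c \<cdot>\<^sub>m 1\<^sub>m 3 * a \<in> \<Gamma>" using subgroup.m_closed[OF sg] by (simp add: SU3_simps)
    then show "x \<in> \<Gamma>" unfolding x using A_carrier[OF ca(2)] by (simp add: mult_smult_assoc_mat[of _ 3 3 _ 3])
  qed
  have "card ?C = 3" using distinct_card[OF omega_powers_distinct] by simp
  then have "card ((\<lambda>(c, a). c \<cdot>\<^sub>m a) ` (?C \<times> A)) = 180"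
    using card_image[OF inj] by (simp add: card_cartesian_product card_A)
  then have eq: "\<Gamma> = (\<lambda>(c, a). c \<cdot>\<^sub>m a) ` (?C \<times> A)"
    using card_subset_eq[OF fin sub\<Gamma>] card by simp
  have "(\<Sum>g\<in>\<Gamma>. F (mtrace g)) = (\<Sum>(c, a)\<in>?C \<times> A. F (mtrace (c \<cdot>\<^sub>m a)))"
    unfolding eq by (subst sum.reindex[OF inj]) (simp add: case_prod_unfold)
  also have "\<dots> = (\<Sum>c\<in>?C. \<Sum>a\<in>A. F (mtrace (c \<cdot>\<^sub>m a)))" by (rule sum.cartesian_product[symmetric])
  also have "\<dots> = (\<Sum>c\<in>?C. \<Sum>a\<in>A. F (c * mtrace a))"
    by (intro sum.cong refl) (simp only: mtrace_smult[OF A_carrier])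
  also have "\<dots> = (\<Sum>c\<leftarrow>[1, omega, omega\<^sup>2]. \<Sum>a\<in>A. F (c * mtrace a))"
    unfolding sum_list_distinct_conv_sum_set[OF omega_powers_distinct] by (simp only: list.set)
  finally show "(\<Sum>g\<in>\<Gamma>. F (mtrace g)) = (\<Sum>c\<leftarrow>[1, omega, omega\<^sup>2]. \<Sum>g\<in>A. F (c * mtrace g))" .
qed

end

lemma ternary_A5_moments:
  assumes "ternary_A5 \<Gamma>"
  defines "F \<equiv> \<lambda>m n z. z ^ m * cnj z ^ n"
  shows "vertex_inner \<Gamma> ((McKay_op \<Gamma> ^^ m) ((McKay_op_adjoint \<Gamma> ^^ n) (e_trivial \<Gamma>))) (e_trivial \<Gamma>) =
    (\<Sum>c\<leftarrow>[1, omega, omega\<^sup>2]. F m n (3 * c) + 15 * F m n (- c) + 20 * F m n 0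
      + 12 * F m n (c * golden) + 12 * F m n (c * (1 - golden))) / 180"
proof -
  from assms obtain A where A: "subgroup A SU3" "SU3\<lparr>carrier := A\<rparr> \<cong> alt_group 5"
    and \<Gamma>: "\<Gamma> = generate SU3 (A \<union> centre_SU3)" and card: "card \<Gamma> = 180"
    unfolding ternary_A5_def by blast
  interpret A5_in_SU3 A by (rule A5_in_SU3.intro[OF A])
  interpret SU3_finite_subgroup \<Gamma> by (rule generated_group(1)[OF \<Gamma> card])
  have "(\<Sum>g\<in>A. F m n (c * mtrace g)) = F m n (3 * c) + 15 * F m n (- c) + 20 * F m n 0
      + 12 * F m n (c * golden) + 12 * F m n (c * (1 - golden))" for c
    using sum_traces[of "\<lambda>t. F m n (c * t)"] by (simp only: mult.commute[of c 3] mult_minus_right mult_1_right mult_zero_right)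
  then have "(\<Sum>g\<in>\<Gamma>. F m n (mtrace g)) = (\<Sum>c\<leftarrow>[1, omega, omega\<^sup>2]. F m n (3 * c) + 15 * F m n (- c) + 20 * F m n 0
      + 12 * F m n (c * golden) + 12 * F m n (c * (1 - golden)))"
    unfolding generated_group(2)[OF \<Gamma> card, of "F m n"] by (simp only:)
  then show ?thesis unfolding McKay_moment card F_def by simp
qed

section \<open>Sums over the point sets\<close>

text \<open>The trace of the diagonal matrix of determinant one with entries \<open>w1\<close>,
  \<open>inverse w2\<close>, \<open>inverse w1 * w2\<close>. Both the \<open>S\<^sub>3\<close>
  action and the central rotations below are best seen on these three eigenvalues.\<close>

definition fund :: "complex \<times> complex \<Rightarrow> complex" where
  "fund = (\<lambda>(w1, w2). w1 + inverse w2 + inverse w1 * w2)"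

definition conj_monom :: "nat \<Rightarrow> nat \<Rightarrow> complex \<Rightarrow> complex" where
  "conj_monom m n z = z ^ m * cnj z ^ n"

lemma cnj_unit: "norm (z::complex) = 1 \<Longrightarrow> cnj z = inverse z"
  by (metis complex_div_cnj complex_norm_square div_by_1 inverse_eq_divide mult.right_neutral mult_1 of_real_1 one_power2 nonzero_eq_divide_eq mult.commute norm_zero zero_neq_one)

lemma R_fun_eq: "x \<in> torus \<Longrightarrow> R_fun m n x = conj_monom m n (fund x)"
  by (auto simp: torus_def R_fun_def conj_monom_def fund_def cnj_unit inverse_eq_divide)

lemma unit_power_mod: "z ^ k = 1 \<Longrightarrow> (z::complex) ^ n = z ^ (n mod k)"
  by (metis mod_mult_div_eq mult.left_neutral mult.commute power_add power_mult power_one)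

lemma cis_root: "N > 0 \<Longrightarrow> cis (2 * pi / real N) ^ N = 1"
  by (simp add: Complex.DeMoivre)

lemma cis_root_inj:
  assumes N: "N > 0" and e: "cis (2 * pi / real N) ^ i = cis (2 * pi / real N) ^ j" and ij: "i < N" "j < N"
  shows "i = j"
proof -
  have *: "cis (2 * pi / real N) ^ k = cis (2 * pi * real k / real N)" for k
    by (simp add: Complex.DeMoivre mult_ac)
  have "inj_on (\<lambda>k. cis (2 * pi * real k / real N)) {..<N}"
    using Complex.bij_betw_roots_unity[OF N] by (rule bij_betw_imp_inj_on)
  then show ?thesis using e ij unfolding * by (auto dest: inj_onD)
qed

text \<open>The condition on \<open>q1 + q2\<close> says \<open>q2 \<equiv> 2 q1\<close> modulo 3,
  so \<open>q2\<close> has the form \<open>3 a + 2 q1\<close> modulo \<open>3 N\<close> with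
  \<open>a\<close> running modulo \<open>N\<close>. This turns sums over the point set into plain
  double sums.\<close>

lemma D_set_eq:
  assumes N: "N > 0"
  defines "\<zeta> \<equiv> cis (2 * pi / real (3 * N))"
  shows "D_set N = (\<lambda>(q, a). (\<zeta> ^ q, \<zeta> ^ (3 * a + 2 * q))) ` ({..<3 * N} \<times> {..<N})"
proof -
  have p: "cis (2 * pi * real k / (3 * real N)) = \<zeta> ^ k" for k
    by (simp add: \<zeta>_def Complex.DeMoivre mult_ac)
  have z: "\<zeta> ^ (3 * N) = 1" unfolding \<zeta>_def by (rule cis_root) (use N in simp)
  have D: "D_set N = {(\<zeta> ^ q1, \<zeta> ^ q2) | q1 q2. q1 < 3 * N \<and> q2 < 3 * N \<and> (q1 + q2) mod 3 = 0}"
  proof -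
    have "q \<in> {0..3 * N - 1} \<longleftrightarrow> q < 3 * N" for q using N by auto
    then show ?thesis unfolding D_set_def p by (simp only:)
  qed
  show ?thesis
  proof (intro Set.set_eqI iffI)
    fix x assume "x \<in> D_set N"
    then obtain q1 q2 where x: "x = (\<zeta> ^ q1, \<zeta> ^ q2)" and q: "q1 < 3 * N" "q2 < 3 * N" "(q1 + q2) mod 3 = 0"
      unfolding D by (elim CollectE exE conjE)
    \<comment> \<open>\<open>b\<close> solves \<open>3 b + 2 q1 \<equiv> q2\<close> modulo \<open>3 N\<close>\<close>
    from q(3) have "3 dvd (q1 + q2)" by (simp add: dvd_eq_mod_eq_0)
    then obtain c where c: "q1 + q2 = 3 * c" by (elim dvdE)
    define b where "b = c + 2 * N - q1"
    \<comment> \<open>The summand \<open>2 * N\<close>, harmless modulo \<open>N\<close>, keeps the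
      subtraction of natural numbers from being truncated: \<open>3 c \<ge> q1\<close> and
      \<open>q1 < 3 N\<close>.\<close>
    have "q1 \<le> c + 2 * N" using c q(1) by linarith
    then have "b + q1 = c + 2 * N" by (simp add: b_def)
    with c have b: "3 * b + 2 * q1 = q2 + 3 * N * 2" by linarith
    have "\<zeta> ^ (3 * (b mod N) + 2 * q1) = \<zeta> ^ q2"
    proof -
      have "\<zeta> ^ (3 * (b mod N)) = \<zeta> ^ (3 * b)"
        unfolding mult_mod_right by (rule unit_power_mod[OF z, symmetric])
      then have "\<zeta> ^ (3 * (b mod N) + 2 * q1) = \<zeta> ^ (3 * b + 2 * q1)" by (simp add: power_add)
      also note b
      also have "\<zeta> ^ (q2 + 3 * N * 2) = \<zeta> ^ q2" by (simp only: power_add power_mult[of \<zeta> "3 * N" 2] z) simp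
      finally show ?thesis .
    qed
    then have "x = (\<lambda>(q, a). (\<zeta> ^ q, \<zeta> ^ (3 * a + 2 * q))) (q1, b mod N)" by (simp add: x)
    then show "x \<in> (\<lambda>(q, a). (\<zeta> ^ q, \<zeta> ^ (3 * a + 2 * q))) ` ({..<3 * N} \<times> {..<N})"
      by (rule image_eqI) (use q N in simp)
  next
    fix x assume "x \<in> (\<lambda>(q, a). (\<zeta> ^ q, \<zeta> ^ (3 * a + 2 * q))) ` ({..<3 * N} \<times> {..<N})"
    then obtain q a where x: "x = (\<zeta> ^ q, \<zeta> ^ (3 * a + 2 * q))" and q: "q < 3 * N" by auto
    let ?r = "(3 * a + 2 * q) mod (3 * N)"
    have "\<zeta> ^ (3 * a + 2 * q) = \<zeta> ^ ?r" by (rule unit_power_mod[OF z])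
    moreover have "?r < 3 * N" using N by simp
    moreover have "(q + ?r) mod 3 = 0"
    proof -
      have "?r mod 3 = (3 * a + 2 * q) mod 3" by (rule mod_mod_cancel) simp
      from mod_add_cong[OF refl this] have "(q + ?r) mod 3 = (q + (3 * a + 2 * q)) mod 3" .
      also have "q + (3 * a + 2 * q) = 3 * (a + q)" by simp
      finally show ?thesis by simp
    qed
    ultimately show "x \<in> D_set N" unfolding D x using q
      by (intro CollectI exI[of _ q] exI[of _ ?r]) simp
  qed
qed

lemma D_set_param_inj:
  assumes N: "N > 0"
  defines "\<zeta> \<equiv> cis (2 * pi / real (3 * N))"
  shows "inj_on (\<lambda>(q, a). (\<zeta> ^ q, \<zeta> ^ (3 * a + 2 * q))) ({..<3 * N} \<times> {..<N})"
proof (rule inj_onI)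
  fix x y assume x: "x \<in> {..<3 * N} \<times> {..<N}" and y: "y \<in> {..<3 * N} \<times> {..<N}"
    and e: "(\<lambda>(q, a). (\<zeta> ^ q, \<zeta> ^ (3 * a + 2 * q))) x = (\<lambda>(q, a). (\<zeta> ^ q, \<zeta> ^ (3 * a + 2 * q))) y"
  obtain q a r b where xy: "x = (q, a)" "y = (r, b)" by (cases x, cases y)
  have N3: "3 * N > 0" using N by simp
  have qr: "q = r" by (rule cis_root_inj[OF N3]) (use x y e in \<open>auto simp: xy \<zeta>_def\<close>)
  have "\<zeta> \<noteq> 0" by (simp add: \<zeta>_def)
  then have "\<zeta> ^ (3 * a) = \<zeta> ^ (3 * b)" using e by (simp add: xy qr power_add)
  then have "3 * a = 3 * b" by (intro cis_root_inj[OF N3]) (use x y in \<open>auto simp: xy \<zeta>_def\<close>)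
  then show "x = y" using qr xy by simp
qed

lemma sum_D_set:
  assumes N: "N > 0"
  defines "\<zeta> \<equiv> cis (2 * pi / real (3 * N))"
  shows "(\<Sum>x\<in>D_set N. H x) = (\<Sum>q<3 * N. \<Sum>a<N. H (\<zeta> ^ q, \<zeta> ^ (3 * a + 2 * q)))"
proof -
  have "(\<Sum>x\<in>D_set N. H x) = (\<Sum>(q, a)\<in>{..<3 * N} \<times> {..<N}. H (\<zeta> ^ q, \<zeta> ^ (3 * a + 2 * q)))"
    unfolding D_set_eq[OF N] \<zeta>_def by (subst sum.reindex[OF D_set_param_inj[OF N]]) (simp add: case_prod_unfold)
  then show ?thesis by (simp only: sum.cartesian_product)
qed

lemma card_D_set: "N > 0 \<Longrightarrow> card (D_set N) = 3 * N * N"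
  unfolding D_set_eq by (subst card_image[OF D_set_param_inj]) (simp_all add: card_cartesian_product)

lemma finite_D_set: "N > 0 \<Longrightarrow> finite (D_set N)"
  unfolding D_set_eq by simp

lemma D_set_torus: "D_set N \<subseteq> torus"
  by (auto simp: D_set_def torus_def)

lemma D_set_nonempty: "N > 0 \<Longrightarrow> D_set N \<noteq> {}"
  using card_D_set[of N] by auto

lemma omega_powers_sum: "1 + omega + omega\<^sup>2 = 0"
  unfolding omega_square unfolding omega_eq by (simp add: complex_eq_iff)

lemma sum_D_1: "(\<Sum>x\<in>D_set 1. conj_monom m n (fund x)) = (\<Sum>c\<leftarrow>[1, omega, omega\<^sup>2]. conj_monom m n (3 * c))"
proof -
  have o: "cis (2 * pi / real (3 * 1)) = omega" by (simp add: omega_def)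
  have "fund (omega ^ q, omega ^ (3 * 0 + 2 * q)) = 3 * omega ^ q" for q
  proof -
    have "inverse (omega ^ (2 * q)) = omega ^ q"
    proof (rule inverse_unique)
      have "omega ^ (2 * q) * omega ^ q = (omega ^ 3) ^ q" by (simp add: power_add[symmetric] power_mult[symmetric])
      then show "omega ^ (2 * q) * omega ^ q = 1" by (simp add: omega_cube)
    qed
    moreover have "inverse (omega ^ q) * omega ^ (2 * q) = omega ^ q"
    proof -
      have "omega ^ q \<noteq> 0" by (simp add: omega_def)
      then show ?thesis by (simp add: mult_2 power_add)
    qed
    ultimately show ?thesis by (simp add: fund_def)
  qed
  then show ?thesis
    by (subst sum_D_set) (simp_all only: o, simp add: eval_nat_numeral)
qed

text \<open>The sines become imaginary parts of monomials, so that \<open>J\<close> can be evaluated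
  algebraically at roots of unity.\<close>

lemma J_fun_torus:
  assumes "norm w1 = 1" "norm w2 = 1"
  shows "J_fun (w1, w2) = 4 * pi\<^sup>2 * (Im (w1 * w2) - Im (w1 * w1 * inverse w2) - Im (w2 * w2 * inverse w1))"
proof -
  have "w1 = cis (2 * pi * (Arg w1 / (2 * pi)))" "w2 = cis (2 * pi * (Arg w2 / (2 * pi)))"
    using rcis_cmod_Arg[of w1] rcis_cmod_Arg[of w2] assms by (simp_all add: rcis_def)
  then obtain s t where w: "w1 = cis (2 * pi * s)" "w2 = cis (2 * pi * t)" by blast
  show ?thesis unfolding w J_fun_cis by (simp add: cis_mult cis_inverse algebra_simps)
qed

text \<open>Rewrite rules reducing every monomial in the cube roots of unity. In the applications
  the square is hidden behind a variable \<open>v\<close>, so that the simplifier does not expand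
  it.\<close>

lemma omega_table:
  defines "v \<equiv> omega\<^sup>2"
  shows "omega * omega = v" "v * v = omega" "omega * v = 1" "v * omega = 1"
    "omega * (omega * x) = v * x" "v * (v * x) = omega * x" "omega * (v * x) = x" "v * (omega * x) = x"
    "inverse omega = v" "inverse v = omega"
proof -
  have c: "omega * (omega * omega) = 1" using omega_cube by (simp add: power3_eq_cube mult.assoc)
  show 1: "omega * omega = v" by (simp add: v_def power2_eq_square)
  show 3: "omega * v = 1" "v * omega = 1" using c by (simp_all add: v_def power2_eq_square mult.assoc)
  have "v * v = omega * (omega * (omega * omega))" by (simp add: v_def power2_eq_square mult.assoc)
  then show 2: "v * v = omega" unfolding c by simp
  show "omega * (omega * x) = v * x" "v * (v * x) = omega * x" "omega * (v * x) = x" "v * (omega * x) = x"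
    by (simp_all add: mult.assoc[symmetric] 1 2 3)
  show "inverse omega = v" "inverse v = omega" by (rule inverse_unique, rule 3)+
qed

lemma omega_imaginary: "Im omega = sqrt 3 / 2" "Im (omega\<^sup>2) = - sqrt 3 / 2"
  unfolding omega_square unfolding omega_eq by simp_all

lemma sum_D_2:
  "(\<Sum>x\<in>D_set 2. conj_monom m n (fund x)) =
    (\<Sum>c\<leftarrow>[1, omega, omega\<^sup>2]. conj_monom m n (3 * c) + 3 * conj_monom m n (- c))"
proof -
  obtain v where v: "v = omega\<^sup>2" by blast
  note t = omega_table[folded v]
  define z where "z = cis (2 * pi / real (3 * 2))"
  \<comment> \<open>The primitive sixth root of unity is minus a cube root, so all twelve points
    have coordinates plus or minus a cube root.\<close>
  have z: "z = - v"
  proof -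
    have z1: "z = Complex (1 / 2) (sqrt 3 / 2)" by (simp add: z_def complex_eq_iff cos_60 sin_60)
    show ?thesis unfolding v z1 omega_square by (simp add: complex_eq_iff)
  qed
  have p: "z ^ 0 = 1" "z ^ 1 = - v" "z ^ 2 = omega" "z ^ 3 = - 1" "z ^ 4 = v" "z ^ 5 = - omega" "z ^ 6 = 1" "z ^ 7 = - v"
      "z ^ 8 = omega" "z ^ 9 = - 1" "z ^ 10 = v" "z ^ 11 = - omega" "z ^ 13 = - v"
    by (simp_all only: z, simp_all add: eval_nat_numeral t)
  have s: "(\<Sum>q<6. f q) = f 0 + f 1 + f 2 + f 3 + f 4 + f 5" "(\<Sum>a<2. g a) = g 0 + g 1"
    for f g :: "nat \<Rightarrow> complex" by (simp_all add: eval_nat_numeral)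
  have "(\<Sum>x\<in>D_set 2. conj_monom m n (fund x)) = (\<Sum>q<6. \<Sum>a<2. conj_monom m n (fund (z ^ q, z ^ (3 * a + 2 * q))))"
    using sum_D_set[of 2 "\<lambda>x. conj_monom m n (fund x)"] by (simp add: z_def)
  \<comment> \<open>Even \<open>q\<close> contributes one value \<open>3 c\<close> and one value
    \<open>- c\<close>, odd \<open>q\<close> contributes \<open>- c\<close> twice; over all
    \<open>q\<close> each cube root \<open>c\<close> collects one \<open>3 c\<close> and three
    \<open>- c\<close>.\<close>
  also have "\<dots> = conj_monom m n 3 + conj_monom m n (- 1) + (conj_monom m n (- v) + conj_monom m n (- v))
    + (conj_monom m n (3 * omega) + conj_monom m n (- omega)) + (conj_monom m n (- 1) + conj_monom m n (- 1))
    + (conj_monom m n (3 * v) + conj_monom m n (- v)) + (conj_monom m n (- omega) + conj_monom m n (- omega))"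
    unfolding s by (simp only: mult_0_right mult_1_right add_0 add_0_right mult_0 arith_simps p power_0 power_one_right numeral_One)
      (simp add: fund_def t z)
  finally show ?thesis unfolding v[symmetric] by simp
qed

text \<open>With \<open>w1 = u\<close> and \<open>w2 = W u^2\<close> the three monomials in
  \<open>J\<close> are \<open>W u^3\<close>, \<open>1 / W\<close> and \<open>W^2 u^3\<close>. Here
  \<open>u^3\<close> and \<open>W\<close> are cube roots of unity, so only \<open>q mod 3\<close>
  and \<open>a\<close> matter. In the nonzero cases the imaginary parts combine to plus or minus
  \<open>3 sqrt 3 / 2\<close>, whence \<open>16 * 27 / 4 = 108\<close>.\<close>

lemma J_fun_D_3:
  fixes q a :: nat
  assumes "a < 3"
  defines "z \<equiv> cis (2 * pi / real (3 * 3))"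
  shows "(J_fun (z ^ q, z ^ (3 * a + 2 * q)))\<^sup>2 = (if q mod 3 = 0 \<and> a \<noteq> 0 then 108 * pi ^ 4 else 0)"
proof -
  obtain v where v: "v = omega\<^sup>2" by blast
  note t = omega_table[folded v] and i = omega_imaginary[folded v]
  have z3: "z ^ (3 * k) = omega ^ k" for k
  proof -
    have "z ^ 3 = omega" by (simp add: z_def omega_def Complex.DeMoivre)
    then show ?thesis by (simp add: power_mult)
  qed
  define u where "u = z ^ q"
  define W where "W = omega ^ a"
  define w2 where "w2 = z ^ (3 * a + 2 * q)"
  have nz: "u \<noteq> 0" "W \<noteq> 0" by (simp_all add: u_def W_def z_def omega_def)
  have w: "w2 = W * (u * u)" unfolding w2_def u_def W_def by (simp only: power_add z3 mult_2)
  have "3 * q = q + (q + q)" by simp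
  then have uuu: "omega ^ q = u * (u * u)" unfolding u_def by (simp only: z3[of q, symmetric] power_add)
  have n: "norm u = 1" "norm w2 = 1" by (simp_all add: u_def w2_def z_def norm_power)
  have "u * w2 = W * omega ^ q" "u * u * inverse w2 = inverse W" "w2 * w2 * inverse u = W * W * omega ^ q"
    unfolding w uuu using nz by (simp_all add: field_simps)
  then have J: "J_fun (z ^ q, z ^ (3 * a + 2 * q)) =
      4 * pi\<^sup>2 * (Im (omega ^ a * omega ^ q) - Im (inverse (omega ^ a)) - Im (omega ^ a * omega ^ a * omega ^ q))"
    using J_fun_torus[OF n] unfolding u_def[symmetric] w2_def[symmetric] W_def[symmetric] by (simp only:)
  have qr: "omega ^ q = omega ^ (q mod 3)" by (rule unit_power_mod[OF omega_cube])
  have J2: "(4 * pi\<^sup>2 * x)\<^sup>2 = 16 * pi ^ 4 * x\<^sup>2" for x :: real by (simp add: power_mult_distrib)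
  have "q mod 3 = 0 \<or> q mod 3 = 1 \<or> q mod 3 = 2" by (rule less_3_cases) simp
  moreover have "a = 0 \<or> a = 1 \<or> a = 2" using assms(1) by (rule less_3_cases)
  ultimately show ?thesis
    unfolding J J2 qr by (elim disjE) (simp_all add: v[symmetric] t i, simp_all add: power2_eq_square field_simps)
qed

text \<open>At these points the three eigenvalues are a common cube root of unity times 1,
  \<open>omega\<close> and its square, which add up to zero.\<close>

lemma fund_D_3:
  fixes p a :: nat
  assumes "a = 1 \<or> a = 2" "p < 3"
  defines "z \<equiv> cis (2 * pi / real (3 * 3))"
  shows "fund (z ^ (3 * p), z ^ (3 * a + 2 * (3 * p))) = 0"
proof -
  obtain v where v: "v = omega\<^sup>2" by blast
  note t = omega_table[folded v]
  have s: "1 + omega + v = 0" using omega_powers_sum v by simp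
  have z3: "z ^ (3 * k) = omega ^ k" for k
  proof -
    have "z ^ 3 = omega" by (simp add: z_def omega_def Complex.DeMoivre)
    then show ?thesis by (simp add: power_mult)
  qed
  have e: "z ^ (3 * a + 2 * (3 * p)) = omega ^ a * (omega ^ p * omega ^ p)"
    by (simp only: power_add mult_2 z3)
  have "p = 0 \<or> p = 1 \<or> p = 2" using assms(2) by (rule less_3_cases)
  with assms(1) show ?thesis
    unfolding e z3 fund_def using s by (elim disjE) (simp_all add: v[symmetric] t, simp_all add: algebra_simps)
qed

text \<open>Exactly six of the 27 points carry density, namely those with
  \<open>q \<in> {0, 3, 6}\<close> and \<open>a \<in> {1, 2}\<close>, and
  \<open>6 * 108 = 648\<close>.\<close>

lemma sum_D_3:
  "(\<Sum>x\<in>D_set 3. of_real ((J_fun x)\<^sup>2) * conj_monom m n (fund x)) = of_real (648 * pi ^ 4) * conj_monom m n 0"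
proof -
  define z where "z = cis (2 * pi / real (3 * 3))"
  have s: "(\<Sum>q<9. f q) = f (3 * 0) + f 1 + f 2 + f (3 * 1) + f 4 + f 5 + f (3 * 2) + f 7 + f 8" "(\<Sum>a<3. f a) = f 0 + f 1 + f 2"
    for f :: "nat \<Rightarrow> complex" by (simp_all add: eval_nat_numeral)
  have T: "of_real ((J_fun (z ^ q, z ^ (3 * a + 2 * q)))\<^sup>2) * conj_monom m n (fund (z ^ q, z ^ (3 * a + 2 * q))) =
    of_real (if q mod 3 = 0 \<and> a \<noteq> 0 then 108 * pi ^ 4 else 0) * conj_monom m n 0" if q: "q < 9" and a: "a < 3" for q a
  proof (cases "q mod 3 = 0 \<and> a \<noteq> 0")
    case True
    then obtain p where p: "q = 3 * p" by (metis mod_0_imp_dvd dvdE)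
    have "fund (z ^ q, z ^ (3 * a + 2 * q)) = 0"
      unfolding p z_def by (rule fund_D_3) (use True a q p in auto)
    then show ?thesis unfolding J_fun_D_3[OF a, of q, folded z_def] by (simp only:)
  next
    case False
    then show ?thesis unfolding J_fun_D_3[OF a, of q, folded z_def] by (simp only: if_False of_real_0 mult_zero_left)
  qed
  have "(\<Sum>x\<in>D_set 3. of_real ((J_fun x)\<^sup>2) * conj_monom m n (fund x)) =
    (\<Sum>q<9. \<Sum>a<3. of_real ((J_fun (z ^ q, z ^ (3 * a + 2 * q)))\<^sup>2) * conj_monom m n (fund (z ^ q, z ^ (3 * a + 2 * q))))"
    using sum_D_set[of 3 "\<lambda>x. of_real ((J_fun x)\<^sup>2) * conj_monom m n (fund x)"] by (simp add: z_def)
  also have "\<dots> = (\<Sum>q<(9::nat). \<Sum>a<(3::nat). of_real (if q mod 3 = 0 \<and> a \<noteq> 0 then 108 * pi ^ 4 else 0) * conj_monom m n 0)"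
  proof (intro sum.cong refl)
    fix q a :: nat assume "q \<in> {..<9}" "a \<in> {..<3}"
    then have "q < 9" "a < 3" by (simp_all only: lessThan_iff)
    from T[OF this]
    show "of_real ((J_fun (z ^ q, z ^ (3 * a + 2 * q)))\<^sup>2) * conj_monom m n (fund (z ^ q, z ^ (3 * a + 2 * q))) =
      of_real (if q mod 3 = 0 \<and> a \<noteq> 0 then 108 * pi ^ 4 else 0) * conj_monom m n 0" .
  qed
  also have "\<dots> = of_real (648 * pi ^ 4) * conj_monom m n 0"
    unfolding s by simp
  finally show ?thesis .
qed

section \<open>The orbits\<close>

text \<open>In terms of the eigenvalues \<open>a\<close>, \<open>inverse b\<close>,
  \<open>inverse a * b\<close> the six points are the six orderings: \<open>torus_map1\<close> swaps
  the first two and \<open>torus_map2\<close> permutes all three cyclically.\<close>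

definition orbit6 :: "complex \<times> complex \<Rightarrow> (complex \<times> complex) set" where
  "orbit6 = (\<lambda>(a, b). {(a, b), (inverse b, inverse a), (inverse b, a * inverse b), (inverse a * b, inverse a),
     (inverse a * b, b), (a, a * inverse b)})"

lemma torus_nz: "(a, b) \<in> torus \<Longrightarrow> a \<noteq> 0 \<and> b \<noteq> 0"
  by (auto simp: torus_def)

lemma orbit6_self: "x \<in> orbit6 x"
  by (cases x) (simp add: orbit6_def)

lemma orbit6_torus: "x \<in> torus \<Longrightarrow> orbit6 x \<subseteq> torus"
  by (cases x) (auto simp: orbit6_def torus_def norm_mult norm_inverse)

lemma orbit6_trans:
  assumes "x \<in> torus" "y \<in> orbit6 x" shows "orbit6 y \<subseteq> orbit6 x"
proof -
  obtain a b where x: "x = (a, b)" by (cases x)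
  have nz: "a \<noteq> 0" "b \<noteq> 0" using torus_nz assms(1) x by auto
  from assms(2) consider "y = (a, b)" | "y = (inverse b, inverse a)" | "y = (inverse b, a * inverse b)"
    | "y = (inverse a * b, inverse a)" | "y = (inverse a * b, b)" | "y = (a, a * inverse b)"
    unfolding x orbit6_def by auto
  then show ?thesis
    by cases (use nz in \<open>simp_all add: x orbit6_def field_simps\<close>)
qed

lemma orbit6_sym:
  assumes "x \<in> torus" "y \<in> orbit6 x" shows "x \<in> orbit6 y"
proof -
  obtain a b where x: "x = (a, b)" by (cases x)
  have nz: "a \<noteq> 0" "b \<noteq> 0" using torus_nz assms(1) x by auto
  from assms(2) consider "y = (a, b)" | "y = (inverse b, inverse a)" | "y = (inverse b, a * inverse b)"
    | "y = (inverse a * b, inverse a)" | "y = (inverse a * b, b)" | "y = (a, a * inverse b)"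
    unfolding x orbit6_def by auto
  then show ?thesis
    by cases (use nz in \<open>simp_all add: x orbit6_def field_simps\<close>)
qed

lemma torus_map_orbit6: "x \<in> torus \<Longrightarrow> torus_map1 x \<in> orbit6 x" "x \<in> torus \<Longrightarrow> torus_map2 x \<in> orbit6 x"
  by (cases x; simp add: torus_map1_def torus_map2_def orbit6_def)+

text \<open>Induction over the generated group; \<open>orbit6_sym\<close> serves the inverses of
  generators and \<open>orbit6_trans\<close> the products. Carrying \<open>Bij torus\<close> along
  is what lets the operations of \<open>BijGroup\<close> be unfolded.\<close>

lemma S3_group_orbit6:
  assumes "\<phi> \<in> S3_group"
  shows "\<phi> \<in> Bij torus \<and> (\<forall>x\<in>torus. \<phi> x \<in> orbit6 x)"
  using assms unfolding S3_group_def
proof (induction rule: generate.induct)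
  case one
  have "\<one>\<^bsub>BijGroup torus\<^esub> = (\<lambda>x\<in>torus. x)" by (simp add: BijGroup_def)
  moreover have "\<forall>x\<in>torus. (\<lambda>x\<in>torus. x) x \<in> orbit6 x" by (intro ballI) (simp only: restrict_apply' orbit6_self)
  ultimately show ?case using id_Bij[of torus] by (simp only: simp_thms)
next
  case (incl h)
  then show ?case using torus_maps_Bij torus_map_orbit6 by auto
next
  case (inv h)
  then have h: "h \<in> Bij torus" "\<And>x. x \<in> torus \<Longrightarrow> h x \<in> orbit6 x"
    using torus_maps_Bij torus_map_orbit6 by auto
  have i: "inv\<^bsub>BijGroup torus\<^esub> h = (\<lambda>x\<in>torus. inv_into torus h x)" by (rule inv_BijGroup[OF h(1)])
  have b: "bij_betw h torus torus" using h(1) by (simp add: Bij_def)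
  have "inv_into torus h x \<in> orbit6 x" if x: "x \<in> torus" for x
  proof -
    let ?y = "inv_into torus h x"
    have y: "?y \<in> torus" "h ?y = x"
      using bij_betwE[OF bij_betw_inv_into[OF b]] bij_betw_inv_into_right[OF b] x by blast+
    show ?thesis using orbit6_sym[OF y(1) h(2)[OF y(1)]] y(2) by simp
  qed
  then have "\<forall>x\<in>torus. (\<lambda>x\<in>torus. inv_into torus h x) x \<in> orbit6 x" by (intro ballI) (simp only: restrict_apply')
  with restrict_inv_into_Bij[OF h(1)] show ?case unfolding i by (rule conjI)
next
  case (eng h1 h2)
  then have h: "h1 \<in> Bij torus" "h2 \<in> Bij torus" "\<And>x. x \<in> torus \<Longrightarrow> h1 x \<in> orbit6 x" "\<And>x. x \<in> torus \<Longrightarrow> h2 x \<in> orbit6 x" by auto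
  have m: "h1 \<otimes>\<^bsub>BijGroup torus\<^esub> h2 = compose torus h1 h2" using h by (simp add: BijGroup_def)
  have "compose torus h1 h2 x \<in> orbit6 x" if x: "x \<in> torus" for x
  proof -
    have "h2 x \<in> torus" using orbit6_torus[OF x] h(4)[OF x] by blast
    then have "h1 (h2 x) \<in> orbit6 (h2 x)" by (rule h(3))
    then show ?thesis using orbit6_trans[OF x h(4)[OF x]] x by (auto simp: compose_def)
  qed
  with compose_Bij[OF h(1,2)] show ?case unfolding m by (intro conjI ballI)
qed

lemma S3_orbitI: "\<phi> \<in> S3_group \<Longrightarrow> \<phi> x \<in> S3_orbit x"
  unfolding S3_orbit_def by blast

text \<open>One inclusion is \<open>S3_group_orbit6\<close>; for the other, the six points are
  reached by words of length at most three in the two generators.\<close>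

lemma S3_orbit_eq:
  assumes x: "x \<in> torus" shows "S3_orbit x = orbit6 x"
proof
  show "S3_orbit x \<subseteq> orbit6 x" using S3_group_orbit6 x by (auto simp: S3_orbit_def)
  have comp: "\<phi> y \<in> S3_orbit x" if g: "\<phi> \<in> S3_group" and y: "y \<in> S3_orbit x" for \<phi> y
  proof -
    from y obtain \<psi> where \<psi>: "\<psi> \<in> S3_group" "y = \<psi> x" by (auto simp: S3_orbit_def)
    have "\<phi> \<otimes>\<^bsub>BijGroup torus\<^esub> \<psi> \<in> S3_group" using g \<psi>(1) unfolding S3_group_def by (rule generate.eng)
    moreover have "(\<phi> \<otimes>\<^bsub>BijGroup torus\<^esub> \<psi>) x = \<phi> y"
      using S3_group_orbit6[OF g] S3_group_orbit6[OF \<psi>(1)] x \<psi>(2) by (simp add: BijGroup_def compose_def)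
    ultimately show ?thesis using S3_orbitI[of "\<phi> \<otimes>\<^bsub>BijGroup torus\<^esub> \<psi>" x] by simp
  qed
  have m: "torus_map1 \<in> S3_group" "torus_map2 \<in> S3_group"
    unfolding S3_group_def by (rule generate.incl; simp)+
  have "\<one>\<^bsub>BijGroup torus\<^esub> \<in> S3_group" unfolding S3_group_def by (rule generate.one)
  moreover have "\<one>\<^bsub>BijGroup torus\<^esub> x = x" using x by (simp add: BijGroup_def)
  ultimately have x0: "x \<in> S3_orbit x" using S3_orbitI[of "\<one>\<^bsub>BijGroup torus\<^esub>" x] by simp
  obtain a b where ab: "x = (a, b)" by (cases x)
  have nz: "a \<noteq> 0" "b \<noteq> 0" using torus_nz x ab by auto
  have T: "y \<in> torus" if "y \<in> orbit6 x" for y using orbit6_torus[OF x] that by blast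
  have m1: "torus_map1 (c, d) = (inverse d, inverse c)" and m2: "torus_map2 (c, d) = (inverse d, c * inverse d)"
    if "(c, d) \<in> torus" for c d using that by (simp_all add: torus_map1_def torus_map2_def)
  have t: "(a, b) \<in> torus" "(inverse b, a * inverse b) \<in> torus" "(inverse a * b, inverse a) \<in> torus"
    by (rule T; simp add: ab orbit6_def)+
  have 1: "(inverse b, inverse a) \<in> S3_orbit x" using comp[OF m(1) x0] m1[OF t(1)] ab by simp
  have 2: "(inverse b, a * inverse b) \<in> S3_orbit x" using comp[OF m(2) x0] m2[OF t(1)] ab by simp
  have "torus_map2 (inverse b, a * inverse b) = (inverse a * b, inverse a)"
    unfolding m2[OF t(2)] using nz by (simp add: field_simps)
  then have 3: "(inverse a * b, inverse a) \<in> S3_orbit x" using comp[OF m(2) 2] by simp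
  have "torus_map1 (inverse b, a * inverse b) = (inverse a * b, b)"
    unfolding m1[OF t(2)] using nz by (simp add: field_simps)
  then have 4: "(inverse a * b, b) \<in> S3_orbit x" using comp[OF m(1) 2] by simp
  have "torus_map1 (inverse a * b, inverse a) = (a, a * inverse b)"
    unfolding m1[OF t(3)] using nz by (simp add: field_simps)
  then have 5: "(a, a * inverse b) \<in> S3_orbit x" using comp[OF m(1) 3] by simp
  show "orbit6 x \<subseteq> S3_orbit x" using x0 1 2 3 4 5 unfolding ab orbit6_def by simp
qed

section \<open>The supports of the two fifth-root measures as rotated hexagons\<close>

lemma omega_small_powers:
  "omega ^ (2 * 0) = 1" "omega ^ (2 * 1) = omega\<^sup>2" "omega ^ (2 * 2) = omega" "omega ^ 1 = omega" "omega ^ 0 = 1"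
proof -
  have "omega ^ (2 * 2) = omega ^ 3 * omega" by (simp add: eval_nat_numeral)
  then show "omega ^ (2 * 2) = omega" unfolding omega_cube by simp
qed simp_all

text \<open>The torus points with eigenvalues \<open>t\<close>, \<open>inverse t\<close> and 1 in
  any order, that is, the orbit of \<open>(t, t)\<close>.\<close>

definition hexagon :: "complex \<Rightarrow> (complex \<times> complex) set" where
  "hexagon t = {(t, t), (inverse t, inverse t), (inverse t, 1), (1, inverse t), (1, t), (t, 1)}"

text \<open>Multiplying the coordinates by \<open>omega ^ k\<close> and
  \<open>omega ^ (2 * k)\<close> multiplies all three eigenvalues by \<open>omega ^ k\<close>, so
  these are the translates of the hexagon by the centre.\<close>

definition ddN_set :: "complex \<Rightarrow> (complex \<times> complex) set" where
  "ddN_set t = (\<lambda>(k, x, y). (omega ^ k * x, omega ^ (2 * k) * y)) ` ({..<3} \<times> hexagon t)"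

lemma norm_omega: "norm omega = 1"
  by (simp add: omega_def)

lemma cnj_omega: "cnj omega = omega\<^sup>2"
  using omega_table(9) cnj_unit[OF norm_omega] by simp

text \<open>The eigenvalues at the two other base points are those at \<open>(t, t)\<close> times
  the square of \<open>omega\<close> and times \<open>omega\<close> respectively, so their orbits
  are the rotated hexagons for \<open>k = 2\<close> and \<open>k = 1\<close>.\<close>

lemma S3_orbits_ddN:
  assumes t: "norm t = 1"
  shows "S3_orbit (t, t) \<union> S3_orbit (cnj omega * cnj t, omega) \<union> S3_orbit (omega, cnj omega * cnj t) = ddN_set t"
proof -
  obtain v where v: "v = omega\<^sup>2" by blast
  note tab = omega_table[folded v]
  define s where "s = inverse t"
  have s: "cnj t = s" using cnj_unit[OF t] by (simp add: s_def)
  have t0: "t \<noteq> 0" using t by auto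
  have ts: "t * s = 1" "s * t = 1" "inverse t = s" "inverse s = t" using t0 by (simp_all add: s_def)
  have ns: "norm s = 1" "norm v = 1" using t norm_omega by (simp_all add: s_def norm_inverse v norm_power)
  have tor: "(t, t) \<in> torus" "(v * s, omega) \<in> torus" "(omega, v * s) \<in> torus"
    using t ns norm_omega by (simp_all add: torus_def norm_mult)
  have 0: "orbit6 (t, t) = {(t, t), (s, s), (s, 1), (1, s), (1, t), (t, 1)}"
    unfolding orbit6_def prod.case ts(3) by (simp only: ts)
  have e1: "inverse (v * s) = omega * t" by (simp only: inverse_mult_distrib tab ts)
  have "v * s * v = (v * v) * s" "omega * t * omega = (omega * omega) * t" "omega * (omega * t) = (omega * omega) * t" "v * (v * s) = (v * v) * s"
    by (simp_all only: mult_ac)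
  then have e2: "v * s * v = omega * s" and e: "inverse (v * s) = omega * t" "v * s * inverse omega = omega * s" "omega * t * omega = v * t"
    and e3: "omega * (omega * t) = v * t" and e4: "v * (v * s) = omega * s"
    by (simp_all only: e1 tab)
  have 1: "orbit6 (v * s, omega) = {(v * s, omega * 1), (v * 1, omega * t), (v * 1, omega * s), (v * t, omega * t), (v * t, omega * 1), (v * s, omega * s)}"
    by (simp only: orbit6_def prod.case tab(9) e1 e2 e(3) mult_1_right)
  have 2: "orbit6 (omega, v * s) = {(omega * 1, v * s), (omega * t, v * 1), (omega * t, v * t), (omega * s, v * 1), (omega * s, v * s), (omega * 1, v * t)}"
    by (simp only: orbit6_def prod.case tab(9) e1 e3 e4 mult_1_right)
  have k: "{..<3} = {0, 1, 2::nat}" by (rule Set.set_eqI) (use less_3_cases in auto)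
  note p = omega_small_powers[folded v] v[symmetric]
  have "ddN_set t = (\<Union>k\<in>{0,1,2}. (\<lambda>(x, y). (omega ^ k * x, omega ^ (2 * k) * y)) ` hexagon t)"
  proof -
    have "{0, 1, 2::nat} \<times> hexagon t = Pair 0 ` hexagon t \<union> Pair 1 ` hexagon t \<union> Pair 2 ` hexagon t" by auto
    then show ?thesis unfolding ddN_set_def k by (simp add: image_Un image_image case_prod_unfold Un_assoc)
  qed
  also have "\<dots> = orbit6 (t, t) \<union> (orbit6 (omega, v * s) \<union> orbit6 (v * s, omega))"
  proof -
    have "(\<lambda>(x, y). (omega ^ 0 * x, omega ^ (2 * 0) * y)) ` hexagon t = orbit6 (t, t)"
      unfolding 0 hexagon_def ts(3) by (simp only: image_insert image_empty prod.case p mult_1_left)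
    moreover have "(\<lambda>(x, y). (omega ^ 1 * x, omega ^ (2 * 1) * y)) ` hexagon t = orbit6 (omega, v * s)"
      unfolding 2 hexagon_def ts(3) by (simp only: image_insert image_empty prod.case p mult_1_left insert_commute)
    moreover have "(\<lambda>(x, y). (omega ^ 2 * x, omega ^ (2 * 2) * y)) ` hexagon t = orbit6 (v * s, omega)"
      unfolding 1 hexagon_def ts(3) by (simp only: image_insert image_empty prod.case p mult_1_left insert_commute)
    ultimately show ?thesis by (simp only: UN_insert UN_empty Un_empty_right)
  qed
  finally show ?thesis
    unfolding s cnj_omega v[symmetric] S3_orbit_eq[OF tor(1)] S3_orbit_eq[OF tor(2)] S3_orbit_eq[OF tor(3)] by (simp only: Un_ac)
qed

lemma hexagon_fund: "norm t = 1 \<Longrightarrow> x \<in> hexagon t \<Longrightarrow> fund x = 1 + t + inverse t"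
proof -
  assume t: "norm t = 1" and x: "x \<in> hexagon t"
  have "t \<noteq> 0" using t by auto
  then show ?thesis using x unfolding hexagon_def by (elim insertE emptyE) (simp_all add: fund_def)
qed

lemma fund_translate:
  assumes "k < 3"
  shows "fund (omega ^ k * x, omega ^ (2 * k) * y) = omega ^ k * fund (x, y)"
proof -
  obtain v where v: "v = omega\<^sup>2" by blast
  note tab = omega_table[folded v]
  note p = omega_small_powers[folded v] v[symmetric]
  define i j where "i = inverse x" and "j = inverse y"
  have c: "v * i * (v * y) = v * v * (i * y)" "omega * i * (omega * y) = omega * omega * (i * y)"
    by (simp_all only: mult_ac)
  from less_3_cases[OF assms] show ?thesis
    unfolding fund_def prod.case inverse_mult_distrib i_def[symmetric] j_def[symmetric]
    by (elim disjE) (simp_all only: p tab c distrib_left mult_1_left inverse_1)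
qed

context
  fixes t :: complex
  assumes t5: "t ^ 5 = 1" and t1: "t \<noteq> 1"
begin

lemma t_norm: "norm t = 1"
proof -
  have "norm t ^ 5 = 1" using t5 by (simp add: norm_power[symmetric])
  then show ?thesis using power_eq_imp_eq_base[of "norm t" 5 1] by simp
qed

lemma t_neq_inverse: "t \<noteq> inverse t"
proof
  assume e: "t = inverse t"
  have "t * t = t * inverse t" by (rule arg_cong[OF e, of "\<lambda>x. t * x"])
  also have "\<dots> = 1" using t_norm by (intro right_inverse) auto
  finally have "t * t = 1" .
  then have "t ^ 5 = t" by (simp add: eval_nat_numeral mult.assoc)
  then show False using t5 t1 by simp
qed

lemma card_hexagon: "card (hexagon t) = 6"
proof -
  have "inverse t \<noteq> 1" using t1 by simp
  then show ?thesis unfolding hexagon_def using t_neq_inverse t1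
    by (simp add: card_insert_if eq_commute[of "inverse t"])
qed

text \<open>The coordinates on the hexagon are fifth roots of unity and the rotations are cube
  roots; as 3 and 5 are coprime, the two factors can be separated. Hence there are 18
  points.\<close>

lemma ddN_inj: "inj_on (\<lambda>(k, x, y). (omega ^ k * x, omega ^ (2 * k) * y)) ({..<3} \<times> hexagon t)"
proof (rule inj_onI)
  fix a b assume a: "a \<in> {..<3} \<times> hexagon t" and b: "b \<in> {..<3} \<times> hexagon t"
    and e: "(\<lambda>(k, x, y). (omega ^ k * x, omega ^ (2 * k) * y)) a = (\<lambda>(k, x, y). (omega ^ k * x, omega ^ (2 * k) * y)) b"
  obtain k x y l x' y' where ab: "a = (k, x, y)" "b = (l, x', y')" by (cases a, cases b)
  have five: "z ^ 5 = 1" if "(z, u) \<in> hexagon t" for z u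
    using that t5 by (auto simp: hexagon_def power_inverse)
  have o0: "omega \<noteq> 0" by (simp add: omega_def)
  have e1: "omega ^ k * x = omega ^ l * x'" and e2: "omega ^ (2 * k) * y = omega ^ (2 * l) * y'" using e by (simp_all add: ab)
  \<comment> \<open>the fifth power of the first coordinate determines \<open>k\<close>\<close>
  have "omega ^ (5 * k) = (omega ^ k * x) ^ 5" using five[of x y] a ab by (simp add: power_mult_distrib power_mult[symmetric] mult.commute)
  also have "\<dots> = omega ^ (5 * l)" using five[of x' y'] b ab unfolding e1 by (simp add: power_mult_distrib power_mult[symmetric] mult.commute)
  finally have "(omega ^ (5 * k)) ^ 2 = (omega ^ (5 * l)) ^ 2" by simp
  \<comment> \<open>Squaring undoes the fifth power on cube roots of unity, as 10 is 1 modulo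
    3.\<close>
  moreover have "(omega ^ (5 * k)) ^ 2 = omega ^ k" for k
  proof -
    have "(omega ^ (5 * k)) ^ 2 = omega ^ (3 * (3 * k) + k)" by (simp add: power_mult[symmetric] mult.commute)
    also have "\<dots> = omega ^ k" by (simp only: power_add power_mult omega_cube power_one mult_1_left)
    finally show ?thesis .
  qed
  ultimately have "omega ^ k = omega ^ l" by simp
  then have "cis (2 * pi / real 3) ^ k = cis (2 * pi / real 3) ^ l" by (simp add: omega_def)
  then have kl: "k = l" by (intro cis_root_inj[of 3]) (use a b ab in auto)
  then show "a = b" using e1 e2 o0 by (simp add: ab)
qed

lemma sum_ddN_set:
  "(\<Sum>x\<in>ddN_set t. conj_monom m n (fund x)) =
    6 * (\<Sum>c\<leftarrow>[1, omega, omega\<^sup>2]. conj_monom m n (c * (1 + t + inverse t)))"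
proof -
  have "(\<Sum>x\<in>ddN_set t. conj_monom m n (fund x)) =
    (\<Sum>(k, x)\<in>{..<3} \<times> hexagon t. conj_monom m n (fund (case (k, x) of (k, x, y) \<Rightarrow> (omega ^ k * x, omega ^ (2 * k) * y))))"
    unfolding ddN_set_def by (subst sum.reindex[OF ddN_inj]) (simp add: case_prod_unfold)
  also have "\<dots> = (\<Sum>k<3. \<Sum>x\<in>hexagon t. conj_monom m n (fund (case (k, x) of (k, x, y) \<Rightarrow> (omega ^ k * x, omega ^ (2 * k) * y))))"
    by (rule sum.cartesian_product[symmetric])
  also have "\<dots> = (\<Sum>k<3. \<Sum>x\<in>hexagon t. conj_monom m n (omega ^ k * (1 + t + inverse t)))"
  proof (intro sum.cong refl)
    fix k x assume k: "k \<in> {..<3::nat}" and x: "x \<in> hexagon t"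
    obtain a b where ab: "x = (a, b)" by (cases x)
    show "conj_monom m n (fund (case (k, x) of (k, x, y) \<Rightarrow> (omega ^ k * x, omega ^ (2 * k) * y))) = conj_monom m n (omega ^ k * (1 + t + inverse t))"
      using fund_translate[of k a b] k hexagon_fund[OF t_norm x] by (simp add: ab)
  qed
  also have "\<dots> = 6 * (\<Sum>k<3. conj_monom m n (omega ^ k * (1 + t + inverse t)))"
    by (simp add: card_hexagon sum_distrib_left)
  also have "(\<Sum>k<3. conj_monom m n (omega ^ k * (1 + t + inverse t))) =
    (\<Sum>c\<leftarrow>[1, omega, omega\<^sup>2]. conj_monom m n (c * (1 + t + inverse t)))"
    by (simp add: sum_less_3)
  finally show ?thesis .
qed

lemma card_ddN_set: "card (ddN_set t) = 18"
  unfolding ddN_set_def card_image[OF ddN_inj] by (simp add: card_cartesian_product card_hexagon)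

lemma ddN_set_torus: "ddN_set t \<subseteq> torus"
  using t_norm by (auto simp: ddN_set_def hexagon_def torus_def norm_mult norm_power norm_omega norm_inverse)

text \<open>Dividing \<open>1 + t + t^2 + t^3 + t^4 = 0\<close> by \<open>t^2\<close> gives a
  relation symmetric in \<open>t\<close> and its inverse, from which both claims are read off. The
  second shows that passing from \<open>t\<close> to its square exchanges the two golden
  roots.\<close>

lemma golden_fund: "(1 + t + inverse t)\<^sup>2 = (1 + t + inverse t) + 1" "1 + t\<^sup>2 + inverse (t\<^sup>2) = 1 - (1 + t + inverse t)"
proof -
  define s where "s = inverse t"
  have "t \<noteq> 0" using t_norm by auto
  then have ts: "t * s = 1" by (simp add: s_def)
  have "(t - 1) * (1 + t + t^2 + t^3 + t^4) = t ^ 5 - 1" by (simp add: eval_nat_numeral algebra_simps)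
  then have "1 + t + t^2 + t^3 + t^4 = 0" using t5 t1 by simp
  then have "(1 + t + t^2 + t^3 + t^4) * (s * s) = 0" by simp
  moreover have "(1 + t + t^2 + t^3 + t^4) * (s * s) = s * s + (t * s) * s + (t * s) * (t * s) + t * ((t * s) * (t * s)) + t * t * ((t * s) * (t * s))"
    by (simp add: eval_nat_numeral algebra_simps)
  ultimately have r: "s * s + s + 1 + t + t * t = 0" unfolding ts by simp
  have "(1 + t + s)\<^sup>2 = (s * s + s + 1 + t + t * t) + (1 + t + s) - 1 + 2 * (t * s)"
    by (simp add: power2_eq_square algebra_simps)
  then show "(1 + t + inverse t)\<^sup>2 = (1 + t + inverse t) + 1" unfolding r ts s_def[symmetric] by simp
  have "1 + t\<^sup>2 + s\<^sup>2 = (s * s + s + 1 + t + t * t) + (1 - (1 + t + s)) - 1 + 1" by (simp add: power2_eq_square algebra_simps)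
  then show "1 + t\<^sup>2 + inverse (t\<^sup>2) = 1 - (1 + t + inverse t)" unfolding r power_inverse[symmetric] s_def[symmetric] by simp
qed

end

section \<open>The measure\<close>

abbreviation zeta5 :: complex where "zeta5 \<equiv> cis (2 * pi / 5)"

lemma zeta5: "zeta5 ^ 5 = 1" "zeta5 \<noteq> 1" "(zeta5\<^sup>2) ^ 5 = 1" "zeta5\<^sup>2 \<noteq> 1"
proof -
  show 1: "zeta5 ^ 5 = 1" using cis_root[of 5] by simp
  show "(zeta5\<^sup>2) ^ 5 = 1"
  proof -
    have "(zeta5\<^sup>2) ^ 5 = (zeta5 ^ 5)\<^sup>2" by (simp flip: power_mult)
    then show ?thesis unfolding 1 by simp
  qed
  have "zeta5 ^ 0 \<noteq> zeta5 ^ 1" "zeta5 ^ 0 \<noteq> zeta5 ^ 2"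
    using cis_root_inj[of 5 0 1] cis_root_inj[of 5 0 2] by auto
  then show "zeta5 \<noteq> 1" "zeta5\<^sup>2 \<noteq> 1" by auto
qed

lemma ddN_5: "ddN 5 = pmf_of_set (ddN_set zeta5)"
  by (simp add: ddN_def Let_def S3_orbits_ddN)

lemma ddN_5_2: "ddN (5 / 2) = pmf_of_set (ddN_set (zeta5\<^sup>2))"
proof -
  \<comment> \<open>For \<open>s = 5 / 2\<close> the base point is \<open>exp (4 pi i / 5)\<close>,
    the Galois conjugate of the case \<open>s = 5\<close> that supplies the other golden
    root.\<close>
  have e: "cis (2 * pi / (5 / 2)) = zeta5\<^sup>2" by (simp add: Complex.DeMoivre)
  show ?thesis unfolding ddN_def Let_def e by (subst S3_orbits_ddN) (simp_all add: norm_power)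
qed

lemma finite_ddN_set: "finite (ddN_set t)"
  by (simp add: ddN_set_def hexagon_def)

lemma ddN_set_nonempty: "ddN_set t \<noteq> {}"
proof -
  have "(0, t, t) \<in> {..<3::nat} \<times> hexagon t" by (simp add: hexagon_def)
  then show ?thesis unfolding ddN_set_def by blast
qed

lemma sum_pmf_of_set:
  fixes h :: "'a \<Rightarrow> complex"
  assumes "finite S" "B \<subseteq> S" "B \<noteq> {}"
  shows "(\<Sum>x\<in>S. of_real (pmf (pmf_of_set B) x) * h x) = (\<Sum>x\<in>B. h x) / of_nat (card B)"
proof -
  have f: "finite B" using assms finite_subset by blast
  have "(\<Sum>x\<in>S. of_real (pmf (pmf_of_set B) x) * h x) = (\<Sum>x\<in>B. of_real (pmf (pmf_of_set B) x) * h x)"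
    by (rule sum.mono_neutral_right) (use assms f in auto)
  also have "\<dots> = (\<Sum>x\<in>B. h x) / of_nat (card B)"
    using assms f by (simp add: sum_divide_distrib)
  finally show ?thesis .
qed

section \<open>A positive Borel measure realising the signed combination\<close>

definition eps_support :: "(complex \<times> complex) set" where
  "eps_support = D_set 3 \<union> D_set 2 \<union> D_set 1 \<union> ddN_set zeta5 \<union> ddN_set (zeta5\<^sup>2)"

definition eps_weight :: "complex \<times> complex \<Rightarrow> real" where
  "eps_weight x = 1 / (72 * pi ^ 4) * ((J_fun x)\<^sup>2 * pmf (dN 3) x) + 1 / 3 * pmf (dN 2) x - 1 / 15 * pmf (dN 1) x
     + 1 / 5 * pmf (ddN 5) x + 1 / 5 * pmf (ddN (5 / 2)) x"

text \<open>A finite measure given by point weights, pushed along the identity to replace the power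
  set by the Borel sets of the torus. Weights enter \<open>point_measure\<close> as extended
  nonnegative reals, so a negative one would be lost; hence
  \<open>eps_weight_nonneg\<close>.\<close>

definition eps :: "(complex \<times> complex) measure" where
  "eps = distr (point_measure eps_support eps_weight) (restrict_space borel torus) (\<lambda>x. x)"

lemma finite_eps_support: "finite eps_support"
  by (simp add: eps_support_def finite_D_set finite_ddN_set)

lemma eps_support_torus: "eps_support \<subseteq> torus"
  using D_set_torus ddN_set_torus[OF zeta5(1,2)] ddN_set_torus[OF zeta5(3,4)] by (auto simp: eps_support_def)

text \<open>Doubling both exponents rewrites cube roots of unity as sixth roots and preserves the
  congruence modulo 3.\<close>

lemma D_set_1_subset_2: "D_set 1 \<subseteq> D_set 2"
proof
  fix x assume "x \<in> D_set 1"
  then obtain q1 q2 where x: "x = (cis (2 * pi * real q1 / 3), cis (2 * pi * real q2 / 3))"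
    and q: "q1 \<le> 2" "q2 \<le> 2" "(q1 + q2) mod 3 = 0" by (auto simp: D_set_def)
  have "x = (cis (2 * pi * real (2 * q1) / (3 * real 2)), cis (2 * pi * real (2 * q2) / (3 * real 2)))" by (simp add: x mult.assoc)
  moreover have "2 * q1 \<in> {0..3 * 2 - 1}" "2 * q2 \<in> {0..3 * 2 - 1}" using q by auto
  moreover have "(2 * q1 + 2 * q2) mod 3 = 0" using q(3) by presburger
  ultimately show "x \<in> D_set 2"
    unfolding D_set_def by (intro CollectI exI[of _ "2 * q1"] exI[of _ "2 * q2"] conjI)
qed

text \<open>The only negative contribution is supported on \<open>D_set 1\<close>, where it is dominated by that of \<open>D_set 2\<close>.\<close>

lemma eps_weight_nonneg: "eps_weight x \<ge> 0"
proof -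
  \<comment> \<open>At a point of \<open>D_set 1\<close> the comparison is
    \<open>1 / (15 * 3) = 1 / 45\<close> against \<open>1 / (3 * 12) = 1 / 36\<close>; elsewhere the
    left side is zero.\<close>
  have "1 / 15 * pmf (dN 1) x \<le> 1 / 3 * pmf (dN 2) x"
    using D_set_1_subset_2 card_D_set[of 1] card_D_set[of 2]
    by (auto simp: dN_def pmf_of_set D_set_nonempty finite_D_set indicator_def)
  moreover have "1 / (72 * pi ^ 4) * ((J_fun x)\<^sup>2 * pmf (dN 3) x) \<ge> 0" by simp
  ultimately show ?thesis unfolding eps_weight_def using pmf_nonneg[of "ddN 5" x] pmf_nonneg[of "ddN (5/2)" x] by linarith
qed

lemma eps_measurable: "(\<lambda>x. x) \<in> measurable (point_measure eps_support eps_weight) (restrict_space borel torus)"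
  using eps_support_torus by (auto simp: space_restrict_space)

lemma finite_measure_eps: "finite_measure eps"
proof -
  have "finite_measure (point_measure eps_support eps_weight)"
    by (rule finite_measureI) (simp add: space_point_measure emeasure_point_measure_finite finite_eps_support)
  then show ?thesis unfolding eps_def by (rule finite_measure.finite_measure_distr[OF _ eps_measurable])
qed

lemma sets_eps: "sets eps = sets (restrict_space borel torus)"
  by (simp add: eps_def)

lemma measure_pmf_support:
  assumes "set_pmf p \<subseteq> S" "finite S"
  shows "measure (measure_pmf p) A = (\<Sum>x\<in>A \<inter> S. pmf p x)"
proof -
  have "measure (measure_pmf p) A = measure (measure_pmf p) (A \<inter> S)"
    by (rule measure_pmf.finite_measure_eq_AE) (use assms in \<open>auto simp: AE_measure_pmf_iff\<close>)
  also have "\<dots> = (\<Sum>x\<in>A \<inter> S. pmf p x)" by (rule measure_measure_pmf_finite) (use assms in simp)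
  finally show ?thesis .
qed

lemma measure_density_pmf_support:
  assumes S: "set_pmf p \<subseteq> S" "finite S" and g: "\<And>x. g x \<ge> 0"
  shows "measure (density (measure_pmf p) (\<lambda>x. ennreal (g x))) A = (\<Sum>x\<in>A \<inter> S. g x * pmf p x)"
proof -
  have "emeasure (density (measure_pmf p) (\<lambda>x. ennreal (g x))) A = (\<integral>\<^sup>+x. ennreal (g x) * indicator A x \<partial>measure_pmf p)"
    by (rule emeasure_density) simp_all
  also have "\<dots> = (\<Sum>x\<in>S. ennreal (g x) * indicator A x * ennreal (pmf p x))"
    by (rule nn_integral_measure_pmf_support) (use S in auto)
  also have "\<dots> = (\<Sum>x\<in>A \<inter> S. ennreal (g x * pmf p x))"
    by (rule sum.mono_neutral_cong_right) (use S g in \<open>auto simp: indicator_def ennreal_mult\<close>)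
  also have "\<dots> = ennreal (\<Sum>x\<in>A \<inter> S. g x * pmf p x)" using g by (intro sum_ennreal) simp
  finally show ?thesis using g by (simp add: measure_def sum_nonneg)
qed

text \<open>All the measures involved are finite sums of point masses on the common set
  \<open>eps_support\<close>, where the combination is the definition of
  \<open>eps_weight\<close>.\<close>

lemma measure_eps:
  assumes A: "A \<in> sets eps"
  shows "measure eps A = 1 / (72 * pi ^ 4) * measure (J2_dN 3) A + 1 / 3 * measure (measure_pmf (dN 2)) A
      - 1 / 15 * measure (measure_pmf (dN 1)) A + 1 / 5 * measure (measure_pmf (ddN 5)) A
      + 1 / 5 * measure (measure_pmf (ddN (5 / 2))) A"
proof -
  have s: "set_pmf (dN 3) \<subseteq> eps_support" "set_pmf (dN 2) \<subseteq> eps_support" "set_pmf (dN 1) \<subseteq> eps_support"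
    "set_pmf (ddN 5) \<subseteq> eps_support" "set_pmf (ddN (5 / 2)) \<subseteq> eps_support"
    by (auto simp: dN_def ddN_5 ddN_5_2 D_set_nonempty finite_D_set finite_ddN_set ddN_set_nonempty eps_support_def)
  note m = measure_pmf_support[OF _ finite_eps_support]
  have "measure eps A = measure (point_measure eps_support eps_weight) (A \<inter> eps_support)"
    unfolding eps_def using A by (subst measure_distr[OF eps_measurable]) (simp_all add: sets_eps space_point_measure)
  also have "\<dots> = (\<Sum>x\<in>A \<inter> eps_support. eps_weight x)"
    by (simp add: measure_point_measure_finite_if finite_eps_support eps_weight_nonneg)
  also have "\<dots> = 1 / (72 * pi ^ 4) * (\<Sum>x\<in>A \<inter> eps_support. (J_fun x)\<^sup>2 * pmf (dN 3) x)
      + 1 / 3 * (\<Sum>x\<in>A \<inter> eps_support. pmf (dN 2) x) - 1 / 15 * (\<Sum>x\<in>A \<inter> eps_support. pmf (dN 1) x)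
      + 1 / 5 * (\<Sum>x\<in>A \<inter> eps_support. pmf (ddN 5) x) + 1 / 5 * (\<Sum>x\<in>A \<inter> eps_support. pmf (ddN (5 / 2)) x)"
    by (simp only: eps_weight_def sum.distrib sum_subtractf sum_distrib_left)
  finally show ?thesis
    unfolding m[OF s(2)] m[OF s(3)] m[OF s(4)] m[OF s(5)] J2_dN_def
      measure_density_pmf_support[OF s(1) finite_eps_support zero_le_power2] .
qed

lemma integral_eps:
  "(\<integral>x. R_fun m n x \<partial>eps) = (\<Sum>c\<leftarrow>[1, omega, omega\<^sup>2]. conj_monom m n (3 * c) + 15 * conj_monom m n (- c)
     + 20 * conj_monom m n 0 + 12 * conj_monom m n (c * golden) + 12 * conj_monom m n (c * (1 - golden))) / 180"
proof -
  let ?h = "\<lambda>x. conj_monom m n (fund x)"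
  let ?S = eps_support
  have sub: "D_set 3 \<subseteq> ?S" "D_set 2 \<subseteq> ?S" "D_set 1 \<subseteq> ?S" "ddN_set zeta5 \<subseteq> ?S" "ddN_set (zeta5\<^sup>2) \<subseteq> ?S"
    by (auto simp: eps_support_def)
  note sp = sum_pmf_of_set[OF finite_eps_support]
  have mb: "R_fun m n \<in> borel_measurable (restrict_space borel torus)"
  proof (rule borel_measurable_continuous_on_restrict)
    show "continuous_on torus (R_fun m n)"
      unfolding R_fun_def case_prod_unfold
      by (intro continuous_intros) (auto simp: torus_def)
  qed
  have "(\<integral>x. R_fun m n x \<partial>eps) = (\<integral>x. R_fun m n x \<partial>point_measure ?S eps_weight)"
    unfolding eps_def by (rule integral_distr[OF eps_measurable mb])
  also have "\<dots> = (\<Sum>x\<in>?S. eps_weight x *\<^sub>R R_fun m n x)"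
    by (rule lebesgue_integral_point_measure_finite[OF finite_eps_support eps_weight_nonneg])
  also have "\<dots> = (\<Sum>x\<in>?S. of_real (1 / (72 * pi ^ 4)) * (of_real (pmf (dN 3) x) * (of_real ((J_fun x)\<^sup>2) * ?h x))
      + 1 / 3 * (of_real (pmf (dN 2) x) * ?h x) - 1 / 15 * (of_real (pmf (dN 1) x) * ?h x)
      + 1 / 5 * (of_real (pmf (ddN 5) x) * ?h x) + 1 / 5 * (of_real (pmf (ddN (5 / 2)) x) * ?h x))"
  proof (rule sum.cong[OF refl])
    fix x assume "x \<in> ?S"
    then have "x \<in> torus" using eps_support_torus by blast
    then show "eps_weight x *\<^sub>R R_fun m n x = of_real (1 / (72 * pi ^ 4)) * (of_real (pmf (dN 3) x) * (of_real ((J_fun x)\<^sup>2) * ?h x))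
      + 1 / 3 * (of_real (pmf (dN 2) x) * ?h x) - 1 / 15 * (of_real (pmf (dN 1) x) * ?h x)
      + 1 / 5 * (of_real (pmf (ddN 5) x) * ?h x) + 1 / 5 * (of_real (pmf (ddN (5 / 2)) x) * ?h x)"
      by (simp add: R_fun_eq eps_weight_def scaleR_conv_of_real algebra_simps)
  qed
  also have "\<dots> = of_real (1 / (72 * pi ^ 4)) * ((\<Sum>x\<in>D_set 3. of_real ((J_fun x)\<^sup>2) * ?h x) / 27)
      + 1 / 3 * ((\<Sum>x\<in>D_set 2. ?h x) / 12) - 1 / 15 * ((\<Sum>x\<in>D_set 1. ?h x) / 3)
      + 1 / 5 * ((\<Sum>x\<in>ddN_set zeta5. ?h x) / 18) + 1 / 5 * ((\<Sum>x\<in>ddN_set (zeta5\<^sup>2). ?h x) / 18)"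
  proof -
    have ne: "D_set 3 \<noteq> {}" "D_set 2 \<noteq> {}" "D_set 1 \<noteq> {}" by (rule D_set_nonempty, simp)+
    have cd: "card (D_set 3) = 27" "card (D_set 2) = 12" "card (D_set 1) = 3" by (simp_all add: card_D_set)
    show ?thesis
      unfolding sum.distrib sum_subtractf sum_distrib_left[symmetric] dN_def ddN_5 ddN_5_2
        sp[OF sub(1) ne(1)] sp[OF sub(2) ne(2)] sp[OF sub(3) ne(3)] sp[OF sub(4) ddN_set_nonempty] sp[OF sub(5) ddN_set_nonempty]
        card_ddN_set[OF zeta5(1,2)] card_ddN_set[OF zeta5(3,4)] cd of_nat_numeral by (rule refl)
  qed
  \<comment> \<open>\<open>648 / (72 * 27) = 1 / 3\<close>, which explains the normalising
    constant.\<close>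
  also have "of_real (1 / (72 * pi ^ 4)) * ((\<Sum>x\<in>D_set 3. of_real ((J_fun x)\<^sup>2) * ?h x) / 27) = 1 / 3 * conj_monom m n 0"
    unfolding sum_D_3 by (simp add: field_simps)
  finally have I: "(\<integral>x. R_fun m n x \<partial>eps) = 1 / 3 * conj_monom m n 0
      + 1 / 3 * ((\<Sum>x\<in>D_set 2. ?h x) / 12) - 1 / 15 * ((\<Sum>x\<in>D_set 1. ?h x) / 3)
      + 1 / 5 * ((\<Sum>x\<in>ddN_set zeta5. ?h x) / 18) + 1 / 5 * ((\<Sum>x\<in>ddN_set (zeta5\<^sup>2). ?h x) / 18)" .
  define F where "F = 1 + zeta5 + inverse zeta5"
  have F2: "1 + zeta5\<^sup>2 + inverse (zeta5\<^sup>2) = 1 - F" unfolding F_def by (rule golden_fund(2)[OF zeta5(1,2)])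
  have "F\<^sup>2 = F + 1" unfolding F_def by (rule golden_fund(1)[OF zeta5(1,2)])
  \<comment> \<open>It is not decided which golden root belongs to \<open>zeta5\<close>: both orbit
    measures have weight \<open>1 / 5\<close>, so either case gives the same sum.\<close>
  then have "F = golden \<or> F = 1 - golden" by (rule golden_root)
  then show ?thesis
    unfolding I sum_D_1 sum_D_2 sum_ddN_set[OF zeta5(1,2)] sum_ddN_set[OF zeta5(3,4)] F2 F_def[symmetric]
    by (elim disjE ssubst) (simp_all add: field_simps)
qed

theorem theorem3p10:
  fixes \<Gamma> :: "complex mat set"
  assumes "ternary_A5 \<Gamma>"
  shows "\<exists>\<epsilon> :: (complex \<times> complex) measure.
    spectral_measure_over_torus \<Gamma> \<epsilon> \<and>
    (\<forall>A\<in>sets \<epsilon>. measure \<epsilon> A =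
        1 / (72 * pi ^ 4) * measure (J2_dN 3) A
      + 1 / 3 * measure (measure_pmf (dN 2)) A
      - 1 / 15 * measure (measure_pmf (dN 1)) A
      + 1 / 5 * measure (measure_pmf (ddN 5)) A
      + 1 / 5 * measure (measure_pmf (ddN (5 / 2))) A)"
proof (intro exI[of _ eps] conjI ballI)
  show "spectral_measure_over_torus \<Gamma> eps"
    unfolding spectral_measure_over_torus_def
    by (intro conjI finite_measure_eps sets_eps allI)
      (simp only: integral_eps ternary_A5_moments[OF assms] conj_monom_def)
qed (rule measure_eps)

end
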